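(* Let $(\hat v_0,\vec A_0)\in V\times K_0$ be a minimizer of $\mathcal{G}_{h_0}$ over $V\times K_0$, and let $\vec B_0:=\nabla\times(\vec A_0-\vec a)$. Then $A_0^3=0$ and $(\nabla\times\vec B_0)^3=0$, where the superscript $3$ denotes the $x_3$-component. Moreover, if $\vec w_0\in L^2(\mathbb{R}^3;\mathbb{R}^3)$ is any vector field such that $\hat w_0|_D=(w_0^1|_D,w_0^2|_D)=\hat v_0$, then $$\int_{\mathbb{R}^3}(\nabla\times\vec B_0)\cdot\vec w_0\,dx=-\frac1{2h_0}|\mathrm{curl}\,\hat w_0|(D).$$
   Context: Setting: $\Omega\subset\mathbb{R}^2$ is a smooth bounded simply-connected domain, $L>0$, $D:=\Omega\times(0,L)$, $h_0>0$, $\vec e_3=(0,0,1)$. For $\vec w=(w^1,w^2,w^3)$ write $\hat w=(w^1,w^2)$. For a two-dimensional field $\hat w=(w^1,w^2)$ of the variable $x=(x_1,x_2,x_3)$, $\mathrm{curl}\,\hat w:=\partial_1w^2-\partial_2w^1$ (distributional); $\nabla\times$ is the usual three-dimensional curl. $\mathcal{M}(D)$ is the space of finite signed Radon measures on $D$ and $|\mu|(D)$ denotes total variation. $\vec a$ is a fixed smooth vector field on $\mathbb{R}^3$ with $a^3=0$, $\nabla\times\vec a=\vec e_3$, $\nabla\cdot\vec a=0$. $\check H^1(\mathbb{R}^3;\mathbb{R}^3)$ is the completion of $C_0^\infty(\mathbb{R}^3;\mathbb{R}^3)$ with respect to the norm $\|\vec C\|_{\check H^1}=(\int_{\mathbb{R}^3}|\nabla\vec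 C|^2dx)^{1/2}$; each of its elements has a representative in $L^6(\mathbb{R}^3;\mathbb{R}^3)$. $V:=\{\hat v\in L^2(D;\mathbb{R}^2):\mathrm{curl}\,\hat v\in\mathcal{M}(D)\}$. $E_0:=\{\vec C\in H^1_{loc}(\mathbb{R}^3;\mathbb{R}^3):\nabla\times\vec C-\vec e_3\in L^2(\mathbb{R}^3;\mathbb{R}^3)\}$. $K_0:=\{\vec C\in E_0:\nabla\cdot\vec C=0,\ \vec C-\vec a\in\check H^1(\mathbb{R}^3;\mathbb{R}^3)\cap L^6(\mathbb{R}^3;\mathbb{R}^3)\}$. $\mathcal{G}_{h_0}(\hat v,\vec A):=\frac12\big[\|\hat v-\hat A\|_{L^2(D)}^2+\frac1{h_0}|\mathrm{curl}\,\hat v|(D)+\|\nabla\times\vec A-\vec e_3\|_{L^2(\mathbb{R}^3)}^2\big]$. *)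

theory Defs
  imports "HOL-Analysis.Analysis"
begin

section \<open>Classical differential operators and test functions\<close>

primrec Ck_on :: "nat \<Rightarrow> 'a::euclidean_space set \<Rightarrow> ('a \<Rightarrow> 'b::real_normed_vector) \<Rightarrow> bool" where
  "Ck_on 0 S f \<longleftrightarrow> continuous_on S f"
| "Ck_on (Suc k) S f \<longleftrightarrow>
     f differentiable_on S \<and> (\<forall>v. Ck_on k S (\<lambda>x. frechet_derivative f (at x) v))"

text \<open>Only used for open \<open>S\<close>.\<close>
definition smooth_on :: "'a::euclidean_space set \<Rightarrow> ('a \<Rightarrow> 'b::real_normed_vector) \<Rightarrow> bool" where
  "smooth_on S f \<longleftrightarrow> (\<forall>k. Ck_on k S f)"

definition test_function :: "'a::euclidean_space set \<Rightarrow> ('a \<Rightarrow> 'b::real_normed_vector) \<Rightarrow> bool" where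
  "test_function U \<phi> \<longleftrightarrow> smooth_on UNIV \<phi> \<and>
     compact (closure {x. \<phi> x \<noteq> 0}) \<and> closure {x. \<phi> x \<noteq> 0} \<subseteq> U"

definition pderiv_at :: "'n::finite \<Rightarrow> (real^'n \<Rightarrow> 'b::real_normed_vector) \<Rightarrow> real^'n \<Rightarrow> 'b" where
  "pderiv_at i f x = frechet_derivative f (at x) (axis i 1)"

definition gradient :: "(real^'n::finite \<Rightarrow> real) \<Rightarrow> real^'n \<Rightarrow> real^'n" where
  "gradient f x = (\<chi> i. pderiv_at i f x)"

definition divergence :: "(real^'n::finite \<Rightarrow> real^'n) \<Rightarrow> real^'n \<Rightarrow> real" where
  "divergence f x = (\<Sum>i\<in>UNIV. pderiv_at i f x $ i)"

definition curl3 :: "(real^3 \<Rightarrow> real^3) \<Rightarrow> real^3 \<Rightarrow> real^3" where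
  "curl3 f x = vector
     [pderiv_at 2 f x $ 3 - pderiv_at 3 f x $ 2,
      pderiv_at 3 f x $ 1 - pderiv_at 1 f x $ 3,
      pderiv_at 1 f x $ 2 - pderiv_at 2 f x $ 1]"

definition e3 :: "real^3" where
  "e3 = axis 3 1"

definition hat :: "real^3 \<Rightarrow> real^2" where
  "hat w = vector [w $ 1, w $ 2]"

section \<open>Domains\<close>

text \<open>Smoothness of the boundary is expressed by local defining functions.\<close>
definition smooth_domain :: "'a::euclidean_space set \<Rightarrow> bool" where
  "smooth_domain \<Omega> \<longleftrightarrow> open \<Omega> \<and> connected \<Omega> \<and> \<Omega> \<noteq> {} \<and>
     (\<forall>p\<in>frontier \<Omega>. \<exists>U (\<rho> :: 'a \<Rightarrow> real). open U \<and> p \<in> U \<and> smooth_on U \<rho> \<and>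
        frechet_derivative \<rho> (at p) \<noteq> (\<lambda>_. 0) \<and> \<Omega> \<inter> U = {x \<in> U. \<rho> x < 0})"

definition cylinder :: "(real^2) set \<Rightarrow> real \<Rightarrow> (real^3) set" where
  "cylinder \<Omega> L = {x. hat x \<in> \<Omega> \<and> 0 < x $ 3 \<and> x $ 3 < L}"

section \<open>Lebesgue spaces and weak derivatives\<close>

text \<open>Elements of Lebesgue and Sobolev spaces are represented by functions; equality of such
  elements is equality almost everywhere, and values outside the set \<open>S\<close> are irrelevant.\<close>

definition Lp_on :: "nat \<Rightarrow> 'a::euclidean_space set \<Rightarrow> ('a \<Rightarrow> 'b::euclidean_space) \<Rightarrow> bool" where
  "Lp_on p S f \<longleftrightarrow> f \<in> borel_measurable (lebesgue_on S) \<and>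
     integrable (lebesgue_on S) (\<lambda>x. norm (f x) ^ p)"

definition L2_norm_on :: "'a::euclidean_space set \<Rightarrow> ('a \<Rightarrow> 'b::euclidean_space) \<Rightarrow> real" where
  "L2_norm_on S f = sqrt (LINT x|lebesgue_on S. norm (f x) ^ 2)"

definition locally_integrable :: "('a::euclidean_space \<Rightarrow> 'b::euclidean_space) \<Rightarrow> bool" where
  "locally_integrable f \<longleftrightarrow> (\<forall>K. compact K \<longrightarrow> f absolutely_integrable_on K)"

definition has_weak_pderiv ::
  "'n::finite \<Rightarrow> (real^'n \<Rightarrow> 'b::euclidean_space) \<Rightarrow> (real^'n \<Rightarrow> 'b) \<Rightarrow> bool" where
  "has_weak_pderiv i f g \<longleftrightarrow> locally_integrable f \<and> locally_integrable g \<and>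
     (\<forall>\<phi>. test_function UNIV \<phi> \<longrightarrow>
        (LINT x|lebesgue. pderiv_at i \<phi> x *\<^sub>R f x) = - (LINT x|lebesgue. \<phi> x *\<^sub>R g x))"

definition weakly_div_free :: "(real^'n::finite \<Rightarrow> real^'n) \<Rightarrow> bool" where
  "weakly_div_free f \<longleftrightarrow> locally_integrable f \<and>
     (\<forall>\<phi>. test_function UNIV \<phi> \<longrightarrow> (LINT x|lebesgue. f x \<bullet> gradient \<phi> x) = 0)"

definition has_weak_curl :: "(real^3 \<Rightarrow> real^3) \<Rightarrow> (real^3 \<Rightarrow> real^3) \<Rightarrow> bool" where
  "has_weak_curl f g \<longleftrightarrow> locally_integrable f \<and> locally_integrable g \<and>
     (\<forall>\<Phi>. test_function UNIV \<Phi> \<longrightarrow>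
        (LINT x|lebesgue. g x \<bullet> \<Phi> x) = (LINT x|lebesgue. f x \<bullet> curl3 \<Phi> x))"

text \<open>The distributional curl, when it is a locally integrable function; it is then unique up to
  null sets. No meaning otherwise.\<close>
definition weak_curl :: "(real^3 \<Rightarrow> real^3) \<Rightarrow> real^3 \<Rightarrow> real^3" where
  "weak_curl f = (SOME g. has_weak_curl f g)"

definition H1_loc :: "(real^'n::finite \<Rightarrow> 'b::euclidean_space) \<Rightarrow> bool" where
  "H1_loc f \<longleftrightarrow> (\<forall>K. compact K \<longrightarrow> Lp_on 2 K f) \<and>
     (\<forall>i. \<exists>g. has_weak_pderiv i f g \<and> (\<forall>K. compact K \<longrightarrow> Lp_on 2 K g))"

text \<open>Completion of the test fields in the norm \<open>\<parallel>\<nabla>f\<parallel>\<close> in \<open>L\<^sup>2\<close>: the gradients of a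
  Cauchy sequence converge in \<open>L\<^sup>2\<close>, and the limit is the gradient of a function that is unique
  up to an additive constant. The predicate holds for all these functions \<open>f\<close>; demanding
  \<open>L\<^sup>6\<close> integrability in addition singles out one of them.\<close>
definition check_H1 :: "(real^'n::finite \<Rightarrow> 'b::euclidean_space) \<Rightarrow> bool" where
  "check_H1 f \<longleftrightarrow> (\<exists>G \<phi>. (\<forall>i. has_weak_pderiv i f (G i) \<and> Lp_on 2 UNIV (G i)) \<and>
     (\<forall>n::nat. test_function UNIV (\<phi> n)) \<and>
     (\<forall>i. (\<lambda>n. L2_norm_on UNIV (\<lambda>x. pderiv_at i (\<phi> n) x - G i x)) \<longlonglongrightarrow> 0))"

section \<open>Signed measures and the two-dimensional curl\<close>

definition finite_borel_measure_on :: "'a::euclidean_space set \<Rightarrow> 'a measure \<Rightarrow> bool" where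
  "finite_borel_measure_on D P \<longleftrightarrow> sets P = sets (restrict_space borel D) \<and> finite_measure P"

text \<open>A finite signed measure is a set function \<open>\<mu>\<close> on the Borel subsets of \<open>D\<close> that is a
  difference \<open>P - N\<close> of finite measures (Jordan decomposition; \<open>P\<close> and \<open>N\<close> need not be mutually
  singular). On an open subset of Euclidean space all of these are Radon.\<close>
definition signed_measure_diff ::
  "'a::euclidean_space set \<Rightarrow> ('a set \<Rightarrow> real) \<Rightarrow> 'a measure \<Rightarrow> 'a measure \<Rightarrow> bool" where
  "signed_measure_diff D \<mu> P N \<longleftrightarrow> finite_borel_measure_on D P \<and> finite_borel_measure_on D N \<and>
     (\<forall>E\<in>sets (restrict_space borel D). \<mu> E = measure P E - measure N E)"

definition total_variation :: "'a::euclidean_space set \<Rightarrow> ('a set \<Rightarrow> real) \<Rightarrow> real" where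
  "total_variation D \<mu> =
     (SUP E \<in> {E :: nat \<Rightarrow> 'a set. disjoint_family E \<and>
                 (\<forall>i. E i \<in> sets (restrict_space borel D)) \<and> (\<Union>i. E i) = D}.
        \<Sum>i. \<bar>\<mu> (E i)\<bar>)"

text \<open>\<open>\<mu>\<close> is the distribution \<open>\<partial>\<^sub>1 v\<^sup>2 - \<partial>\<^sub>2 v\<^sup>1\<close> on \<open>D\<close>; the integral against \<open>\<mu>\<close> does not
  depend on the choice of \<open>P\<close> and \<open>N\<close>.\<close>
definition has_curl_measure ::
  "(real^3) set \<Rightarrow> (real^3 \<Rightarrow> real^2) \<Rightarrow> ((real^3) set \<Rightarrow> real) \<Rightarrow> bool" where
  "has_curl_measure D v \<mu> \<longleftrightarrow> (\<exists>P N. signed_measure_diff D \<mu> P N \<and>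
     (\<forall>\<phi>. test_function D \<phi> \<longrightarrow>
        (\<integral>x. \<phi> x \<partial>P) - (\<integral>x. \<phi> x \<partial>N) =
        (LINT x|lebesgue_on D. v x $ 1 * pderiv_at 2 \<phi> x - v x $ 2 * pderiv_at 1 \<phi> x)))"

text \<open>Meaningful only if some \<open>\<mu>\<close> exists; \<open>\<mu>\<close> is then unique on the Borel subsets of an open \<open>D\<close>.\<close>
definition curl_measure :: "(real^3) set \<Rightarrow> (real^3 \<Rightarrow> real^2) \<Rightarrow> (real^3) set \<Rightarrow> real" where
  "curl_measure D v = (SOME \<mu>. has_curl_measure D v \<mu>)"

section \<open>The function spaces and the functional\<close>

definition V_space :: "(real^3) set \<Rightarrow> (real^3 \<Rightarrow> real^2) set" where
  "V_space D = {v. Lp_on 2 D v \<and> (\<exists>\<mu>. has_curl_measure D v \<mu>)}"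

definition E0_space :: "(real^3 \<Rightarrow> real^3) set" where
  "E0_space = {C. H1_loc C \<and> (\<exists>B. has_weak_curl C B \<and> Lp_on 2 UNIV (\<lambda>x. B x - e3))}"

definition K0_space :: "(real^3 \<Rightarrow> real^3) \<Rightarrow> (real^3 \<Rightarrow> real^3) set" where
  "K0_space a = {C \<in> E0_space. weakly_div_free C \<and>
     check_H1 (\<lambda>x. C x - a x) \<and> Lp_on 6 UNIV (\<lambda>x. C x - a x)}"

definition G_energy ::
  "(real^3) set \<Rightarrow> real \<Rightarrow> (real^3 \<Rightarrow> real^2) \<Rightarrow> (real^3 \<Rightarrow> real^3) \<Rightarrow> real" where
  "G_energy D h0 v A = 1 / 2 *
     ((L2_norm_on D (\<lambda>x. v x - hat (A x)))\<^sup>2 +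
      1 / h0 * total_variation D (curl_measure D v) +
      (L2_norm_on UNIV (\<lambda>x. weak_curl A x - e3))\<^sup>2)"

end

theory Submission
  imports Defs
begin

text \<open>
  Write \<open>C = A0 - a\<close> and \<open>B = curl C\<close>, so that \<open>B = curl A0 - e3\<close>, and let \<open>F\<close> be the horizontal field
  \<open>v0 - hat A0\<close> on \<open>D\<close>, completed by a vanishing third component and extended by zero. The claim is in
  essence the Euler--Lagrange equation \<open>curl B = F\<close>, and it comes from three one-parameter families of
  competitors.

  \<^item> Adding \<open>t hat (grad q)\<close> to \<open>v0\<close> leaves the curl measure unchanged, so \<open>F\<close> is orthogonal to
    every gradient of a test function.
  \<^item> Adding \<open>t curl \<eta>\<close> to \<open>A0\<close> respects the divergence constraint, so
    \<open>\<integral> F \<bullet> curl \<eta> = \<integral> B \<bullet> curl (curl \<eta>)\<close>.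
  \<^item> Multiplying \<open>v0\<close> by \<open>1 + t\<close> multiplies the total variation by \<open>1 + t\<close>, so
    \<open>\<integral> (v0 - hat A0) \<bullet> v0\<close> over \<open>D\<close> is \<open>- 1 / (2 h0)\<close> times the total variation of the curl of \<open>v0\<close>.

  A general test field is not admissible as a variation of \<open>A0\<close>, since it has a divergence. The functional
  \<open>T \<Phi> = \<integral> F \<bullet> \<Phi> - \<integral> B \<bullet> curl \<Phi>\<close> is nevertheless zero on all test fields: by the first two families it
  kills gradients and curls, hence all Laplacians \<open>grad div \<Xi> - curl curl \<Xi>\<close>, and \<open>F\<close> and \<open>B\<close> are
  square integrable, so that a Liouville theorem applies. This yields \<open>curl B = F\<close>
  (\<open>has_weak_curl_B0\<close>); its third component vanishes, and the third family evaluates its pairing with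
  \<open>w0\<close>. Testing \<open>curl B = F\<close> with vertical fields \<open>f e3\<close> and using \<open>div C = 0\<close> gives \<open>\<integral> C\<^sup>3 \<Delta> f = 0\<close>;
  as \<open>C\<^sup>3\<close> is in \<open>L\<^sup>6\<close>, the same Liouville theorem gives \<open>C\<^sup>3 = 0\<close>, that is \<open>A0\<^sup>3 = a\<^sup>3 = 0\<close>.

  The Liouville theorem (\<open>liouville_principle\<close>) is proved by averaging. Let \<open>\<rho>\<^sub>R\<close> be the bump
  \<open>R\<^sup>-\<^sup>3 (1 - \<bar>y\<bar>\<^sup>2 / R\<^sup>2)\<^sub>+\<close>. Up to a factor, \<open>\<rho>\<^sub>R - \<rho>\<^sub>r\<close> is the Laplacian of a compactly supported \<open>C\<^sup>2\<close>
  kernel, the difference of two Newtonian potentials that are smoothed inside balls of radius \<open>r\<close> and \<open>R\<close>.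
  So \<open>\<rho>\<^sub>R * \<Phi> - \<rho>\<^sub>r * \<Phi>\<close> is the Laplacian of a test field (\<open>conv_bump_invariance\<close>), and \<open>T (\<rho>\<^sub>R * \<Phi>)\<close>
  does not depend on \<open>R\<close>. As \<open>R\<close> tends to zero it tends to a positive multiple of \<open>T \<Phi>\<close>; as \<open>R\<close> tends
  to infinity it tends to zero, because the averages are of size \<open>R\<^sup>-\<^sup>3\<close> while the integral of an \<open>L\<^sup>p\<close>
  function over a ball of radius \<open>R\<close> is \<open>o(R\<^sup>3)\<close>.

  The energy refers to the curl of \<open>A\<close> and to the curl measure of \<open>v\<close> only up to the choice of a
  representative. Comparing energies therefore rests on two uniqueness statements,
  \<open>has_weak_curl_unique\<close> and \<open>has_curl_measure_unique\<close>, both obtained by approximating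
  indicators of boxes by test functions.
\<close>

section \<open>Functions of class \<open>C\<^sup>k\<close>\<close>

lemma differentiable_on_UNIV_iff: "f differentiable_on UNIV \<longleftrightarrow> (\<forall>x. f differentiable (at x))"
  by (simp add: differentiable_on_def)

lemma has_derivative_imp_frechet: "(f has_derivative f') (at x) \<Longrightarrow> frechet_derivative f (at x) v = f' v"
  by (metis frechet_derivative_at)

text \<open>
  The definition speaks of the Frechet derivative as a choice; with this rule one works with any
  derivative that is known explicitly.
\<close>
lemma Ck_on_Suc_has_derivative:
  assumes "\<And>x. (f has_derivative f' x) (at x)" "\<And>v. Ck_on k UNIV (\<lambda>x. f' x v)"
  shows "Ck_on (Suc k) UNIV f"
proof -
  have "frechet_derivative f (at x) v = f' x v" for x v
    using assms(1) by (rule has_derivative_imp_frechet)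
  then show ?thesis
    using assms by (auto simp: differentiable_on_UNIV_iff differentiable_def)
qed

lemma Ck_on_SucD:
  assumes "Ck_on (Suc k) UNIV f"
  shows "(f has_derivative frechet_derivative f (at x)) (at x)"
    "Ck_on k UNIV (\<lambda>x. frechet_derivative f (at x) v)"
  using assms by (auto simp: differentiable_on_UNIV_iff frechet_derivative_works)

lemma Ck_on_Suc_lower: "Ck_on (Suc k) S f \<Longrightarrow> Ck_on k S f"
proof (induction k arbitrary: f)
  case 0
  then show ?case by (simp add: differentiable_imp_continuous_on)
next
  case (Suc k)
  from Suc.prems have "f differentiable_on S" "\<And>v. Ck_on (Suc k) S (\<lambda>x. frechet_derivative f (at x) v)"
    by simp_all
  with Suc.IH show ?case by simp
qed

lemma Ck_on_const: "Ck_on k UNIV (\<lambda>x. c)"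
  by (induction k arbitrary: c) simp_all

lemma Ck_on_add: "Ck_on k UNIV f \<Longrightarrow> Ck_on k UNIV g \<Longrightarrow> Ck_on k UNIV (\<lambda>x. f x + g x)"
proof (induction k arbitrary: f g)
  case 0
  then show ?case by (auto intro: continuous_intros)
next
  case (Suc k)
  note f = Ck_on_SucD[OF Suc.prems(1)] and g = Ck_on_SucD[OF Suc.prems(2)]
  show ?case
    by (rule Ck_on_Suc_has_derivative[OF has_derivative_add[OF f(1) g(1)]])
      (intro Suc.IH f(2) g(2))
qed

lemma Ck_on_linear:
  assumes "bounded_linear h"
  shows "Ck_on k UNIV f \<Longrightarrow> Ck_on k UNIV (\<lambda>x. h (f x))"
proof (induction k arbitrary: f)
  case 0
  then show ?case
    using assms by (auto intro: bounded_linear.continuous_on)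
next
  case (Suc k)
  note f = Ck_on_SucD[OF Suc.prems(1)]
  show ?case
    by (rule Ck_on_Suc_has_derivative[OF bounded_linear.has_derivative[OF assms f(1)]])
      (intro Suc.IH f(2))
qed

lemma Ck_on_bilinear:
  assumes "bounded_bilinear h"
  shows "Ck_on k UNIV f \<Longrightarrow> Ck_on k UNIV g \<Longrightarrow> Ck_on k UNIV (\<lambda>x. h (f x) (g x))"
proof (induction k arbitrary: f g)
  case 0
  then show ?case
    using assms by (auto intro: bounded_bilinear.continuous_on)
next
  case (Suc k)
  note f = Ck_on_SucD[OF Suc.prems(1)] and g = Ck_on_SucD[OF Suc.prems(2)]
  show ?case
    by (rule Ck_on_Suc_has_derivative[OF bounded_bilinear.FDERIV[OF assms f(1) g(1)]])
      (intro Ck_on_add Suc.IH f(2) g(2) Ck_on_Suc_lower[OF Suc.prems(1)] Ck_on_Suc_lower[OF Suc.prems(2)])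
qed

lemma Ck_on_compose_affine:
  assumes "bounded_linear l"
  shows "Ck_on k UNIV f \<Longrightarrow> Ck_on k UNIV (\<lambda>x. f (c + l x))"
proof (induction k arbitrary: f)
  case 0
  have "continuous_on UNIV (\<lambda>x. c + l x)"
    using assms by (intro continuous_intros linear_continuous_on)
  with 0 show ?case
    by (auto intro: continuous_on_compose2)
next
  case (Suc k)
  note f = Ck_on_SucD[OF Suc.prems(1)]
  have l: "((\<lambda>x. c + l x) has_derivative l) (at x)" for x
    using has_derivative_add[OF has_derivative_const[of c] bounded_linear.has_derivative[OF assms has_derivative_ident]]
    by simp
  show ?case
    by (rule Ck_on_Suc_has_derivative[OF has_derivative_compose[OF l f(1)]])
      (intro Suc.IH f(2))
qed

lemma smooth_on_has_derivative:
  "smooth_on UNIV f \<Longrightarrow> (f has_derivative frechet_derivative f (at x)) (at x)"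
  unfolding smooth_on_def using Ck_on_SucD(1) by blast

lemma smooth_on_frechet: "smooth_on UNIV f \<Longrightarrow> smooth_on UNIV (\<lambda>x. frechet_derivative f (at x) v)"
  unfolding smooth_on_def using Ck_on_SucD(2) by blast

lemma smooth_on_continuous: "smooth_on UNIV f \<Longrightarrow> continuous_on UNIV f"
  unfolding smooth_on_def using Ck_on.simps(1) by blast

lemma smooth_on_const: "smooth_on UNIV (\<lambda>x. c)"
  unfolding smooth_on_def by (simp add: Ck_on_const)

lemma smooth_on_add: "smooth_on UNIV f \<Longrightarrow> smooth_on UNIV g \<Longrightarrow> smooth_on UNIV (\<lambda>x. f x + g x)"
  unfolding smooth_on_def by (simp add: Ck_on_add)

lemma smooth_on_linear: "bounded_linear h \<Longrightarrow> smooth_on UNIV f \<Longrightarrow> smooth_on UNIV (\<lambda>x. h (f x))"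
  unfolding smooth_on_def by (simp add: Ck_on_linear)

lemma smooth_on_bilinear:
  "bounded_bilinear h \<Longrightarrow> smooth_on UNIV f \<Longrightarrow> smooth_on UNIV g \<Longrightarrow> smooth_on UNIV (\<lambda>x. h (f x) (g x))"
  unfolding smooth_on_def by (simp add: Ck_on_bilinear)

lemma smooth_on_pderiv: "smooth_on UNIV f \<Longrightarrow> smooth_on UNIV (pderiv_at i f)"
  unfolding pderiv_at_def[abs_def] by (rule smooth_on_frechet)

lemma smooth_on_sum: "(\<And>i. i \<in> I \<Longrightarrow> smooth_on UNIV (f i)) \<Longrightarrow> smooth_on UNIV (\<lambda>x. \<Sum>i\<in>I. f i x)"
  by (induction I rule: infinite_finite_induct) (auto intro: smooth_on_const smooth_on_add)

lemma smooth_on_prod: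
  fixes f :: "'i \<Rightarrow> 'a::euclidean_space \<Rightarrow> real"
  shows "(\<And>i. i \<in> I \<Longrightarrow> smooth_on UNIV (f i)) \<Longrightarrow> smooth_on UNIV (\<lambda>x. \<Prod>i\<in>I. f i x)"
  by (induction I rule: infinite_finite_induct)
    (auto intro: smooth_on_const smooth_on_bilinear[OF bounded_bilinear_mult])

text \<open>
  The second increment is symmetric in \<open>u\<close> and \<open>v\<close>. Two applications of the mean value theorem, first along
  \<open>v\<close> and then along \<open>u\<close>, identify it with a mixed derivative at a nearby point; letting \<open>t\<close> tend to zero
  then yields the symmetry of second derivatives.
\<close>
lemma symmetric_increment_mvt:
  fixes f :: "'a::euclidean_space \<Rightarrow> real"
  assumes f: "Ck_on 2 UNIV f" and t: "t > 0"
  shows "\<exists>a b. 0 < a \<and> a < t \<and> 0 < b \<and> b < t \<and>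
    f (x + t *\<^sub>R u + t *\<^sub>R v) - f (x + t *\<^sub>R u) - f (x + t *\<^sub>R v) + f x =
    t\<^sup>2 * frechet_derivative (\<lambda>y. frechet_derivative f (at y) v) (at (x + a *\<^sub>R u + b *\<^sub>R v)) u"
proof -
  have f: "Ck_on (Suc (Suc 0)) UNIV f" using f by (simp add: numeral_2_eq_2)
  let ?fv = "\<lambda>y. frechet_derivative f (at y) v"
  note f1 = Ck_on_SucD(1)[OF f] and f2 = Ck_on_SucD(1)[OF Ck_on_SucD(2)[OF f]]
  have lin: "((\<lambda>s. p + s *\<^sub>R w) has_derivative (\<lambda>h. h *\<^sub>R w)) (at s)" for p w :: 'a and s :: real
    by (auto intro!: derivative_eq_intros)
  have c1: "((\<lambda>s. f (p + s *\<^sub>R v)) has_real_derivative ?fv (p + s *\<^sub>R v)) (at s)" for p s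
    using has_derivative_compose[OF lin f1]
      linear_cmul[OF has_derivative_linear[OF f1]]
    by (simp add: has_field_derivative_def mult_commute_abs)
  have c2: "((\<lambda>s. ?fv (p + s *\<^sub>R u)) has_real_derivative frechet_derivative ?fv (at (p + s *\<^sub>R u)) u) (at s)" for p s
    using has_derivative_compose[OF lin f2]
      linear_cmul[OF has_derivative_linear[OF f2]]
    by (simp add: has_field_derivative_def mult_commute_abs)
  let ?g = "\<lambda>s. f (x + t *\<^sub>R u + s *\<^sub>R v) - f (x + s *\<^sub>R v)"
  have "\<exists>b>0. b < t \<and> ?g t - ?g 0 = (t - 0) * (?fv (x + t *\<^sub>R u + b *\<^sub>R v) - ?fv (x + b *\<^sub>R v))"
    by (rule MVT2[OF t DERIV_diff[OF c1 c1]])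
  then obtain b where b: "b > 0" "b < t" "?g t - ?g 0 = t * (?fv (x + t *\<^sub>R u + b *\<^sub>R v) - ?fv (x + b *\<^sub>R v))"
    by auto
  let ?h = "\<lambda>s. ?fv (x + b *\<^sub>R v + s *\<^sub>R u)"
  have "\<exists>a>0. a < t \<and> ?h t - ?h 0 = (t - 0) * frechet_derivative ?fv (at (x + b *\<^sub>R v + a *\<^sub>R u)) u"
    by (rule MVT2[OF t c2])
  then obtain a where a: "a > 0" "a < t" "?h t - ?h 0 = t * frechet_derivative ?fv (at (x + b *\<^sub>R v + a *\<^sub>R u)) u"
    by auto
  show ?thesis
    using a b by (intro exI[of _ a] exI[of _ b]) (simp add: algebra_simps power2_eq_square)
qed

lemma frechet_derivative_symmetric_real:
  fixes f :: "'a::euclidean_space \<Rightarrow> real"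
  assumes f: "Ck_on 2 UNIV f"
  shows "frechet_derivative (\<lambda>y. frechet_derivative f (at y) u) (at x) v =
         frechet_derivative (\<lambda>y. frechet_derivative f (at y) v) (at x) u"
proof -
  have f': "Ck_on (Suc (Suc 0)) UNIV f" using f by (simp add: numeral_2_eq_2)
  define g where "g u v y = frechet_derivative (\<lambda>y. frechet_derivative f (at y) v) (at y) u" for u v y
  define t where "t n = 1 / real (Suc n)" for n
  have t: "t n > 0" for n by (simp add: t_def)
  have t0: "t \<longlonglongrightarrow> 0" unfolding t_def[abs_def] using LIMSEQ_inverse_real_of_nat by (simp add: inverse_eq_divide)
  let ?I = "\<lambda>n u v. f (x + t n *\<^sub>R u + t n *\<^sub>R v) - f (x + t n *\<^sub>R u) - f (x + t n *\<^sub>R v) + f x"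
  have lim: "(\<lambda>n. ?I n u v / (t n)\<^sup>2) \<longlonglongrightarrow> g u v x" for u v
  proof -
    have "\<forall>n. \<exists>a b. 0 < a \<and> a < t n \<and> 0 < b \<and> b < t n \<and> ?I n u v = (t n)\<^sup>2 * g u v (x + a *\<^sub>R u + b *\<^sub>R v)"
      unfolding g_def using symmetric_increment_mvt[OF f t] by blast
    then obtain a b where ab: "\<And>n. 0 < a n \<and> a n < t n \<and> 0 < b n \<and> b n < t n \<and>
        ?I n u v = (t n)\<^sup>2 * g u v (x + a n *\<^sub>R u + b n *\<^sub>R v)"
      by metis
    have "a \<longlonglongrightarrow> 0" "b \<longlonglongrightarrow> 0"
      using ab by (auto intro!: tendsto_sandwich[OF _ _ tendsto_const t0] always_eventually less_imp_le)
    then have "(\<lambda>n. x + a n *\<^sub>R u + b n *\<^sub>R v) \<longlonglongrightarrow> x + 0 *\<^sub>R u + 0 *\<^sub>R v"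
      by (intro tendsto_intros)
    moreover have "continuous_on UNIV (g u v)"
      unfolding g_def using Ck_on_SucD(2)[OF Ck_on_SucD(2)[OF f']] by simp
    ultimately have "(\<lambda>n. g u v (x + a n *\<^sub>R u + b n *\<^sub>R v)) \<longlonglongrightarrow> g u v x"
      by (intro continuous_on_tendsto_compose[where s=UNIV and f="g u v"]) auto
    moreover have "?I n u v / (t n)\<^sup>2 = g u v (x + a n *\<^sub>R u + b n *\<^sub>R v)" for n
      using ab[of n] t[of n] by simp
    ultimately show ?thesis by simp
  qed
  have eq: "?I n u v = ?I n v u" for n by (simp add: algebra_simps)
  have "(\<lambda>n. ?I n v u / (t n)\<^sup>2) \<longlonglongrightarrow> g u v x"
    using lim[of u v] unfolding eq .
  then show ?thesis
    using lim[of v u] LIMSEQ_unique unfolding g_def by blast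
qed

section \<open>Test functions\<close>

lemma pderiv_at_eqI: "(f has_derivative f') (at x) \<Longrightarrow> pderiv_at i f x = f' (axis i 1)"
  unfolding pderiv_at_def by (rule has_derivative_imp_frechet)

lemma pderiv_at_add:
  assumes "f differentiable (at x)" "g differentiable (at x)"
  shows "pderiv_at i (\<lambda>x. f x + g x) x = pderiv_at i f x + pderiv_at i g x"
  using pderiv_at_eqI[OF has_derivative_add[OF assms[unfolded frechet_derivative_works]]]
  by (simp add: pderiv_at_def)

lemma pderiv_at_diff:
  assumes "f differentiable (at x)" "g differentiable (at x)"
  shows "pderiv_at i (\<lambda>x. f x - g x) x = pderiv_at i f x - pderiv_at i g x"
  using pderiv_at_eqI[OF has_derivative_diff[OF assms[unfolded frechet_derivative_works]]]
  by (simp add: pderiv_at_def)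

lemma pderiv_at_linear:
  assumes "bounded_linear h" "f differentiable (at x)"
  shows "pderiv_at i (\<lambda>x. h (f x)) x = h (pderiv_at i f x)"
  using pderiv_at_eqI[OF bounded_linear.has_derivative[OF assms(1) assms(2)[unfolded frechet_derivative_works]]]
  by (simp add: pderiv_at_def)

lemma pderiv_at_bilinear:
  assumes "bounded_bilinear h" "f differentiable (at x)" "g differentiable (at x)"
  shows "pderiv_at i (\<lambda>x. h (f x) (g x)) x = h (f x) (pderiv_at i g x) + h (pderiv_at i f x) (g x)"
  using pderiv_at_eqI[OF bounded_bilinear.FDERIV[OF assms(1) assms(2,3)[unfolded frechet_derivative_works]]]
  by (simp add: pderiv_at_def)

lemma smooth_on_differentiable: "smooth_on UNIV f \<Longrightarrow> f differentiable (at x)"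
  using smooth_on_has_derivative differentiable_def by blast

lemma smooth_on_vec:
  fixes f :: "'a::euclidean_space \<Rightarrow> real^'n"
  assumes "\<And>j. smooth_on UNIV (\<lambda>x. f x $ j)"
  shows "smooth_on UNIV f"
proof -
  have "smooth_on UNIV (\<lambda>x. \<Sum>j\<in>UNIV. f x $ j *\<^sub>R axis j (1::real))"
    by (intro smooth_on_sum smooth_on_linear[OF bounded_linear_scaleR_left] assms)
  moreover have "(\<Sum>j\<in>UNIV. v $ j *\<^sub>R axis j (1::real)) = v" for v :: "real^'n"
    using basis_expansion[of v] by (simp add: scalar_mult_eq_scaleR)
  ultimately show ?thesis by simp
qed

lemma smooth_on_nth: "smooth_on UNIV f \<Longrightarrow> smooth_on UNIV (\<lambda>x. f x $ j :: real)"
  by (rule smooth_on_linear[OF bounded_linear_vec_nth])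

lemma smooth_on_diff: "smooth_on UNIV f \<Longrightarrow> smooth_on UNIV g \<Longrightarrow> smooth_on UNIV (\<lambda>x. f x - g x)"
  using smooth_on_add[of f "\<lambda>x. - g x"] smooth_on_linear[OF bounded_linear_minus[OF bounded_linear_ident], of g]
  by simp

lemma pderiv_at_nth:
  "f differentiable (at x) \<Longrightarrow> pderiv_at i (\<lambda>x. f x $ j :: real) x = pderiv_at i f x $ j"
  by (rule pderiv_at_linear[OF bounded_linear_vec_nth])

lemma pderiv_at_symmetric:
  fixes f :: "real^'n \<Rightarrow> real"
  assumes "smooth_on UNIV f"
  shows "pderiv_at i (pderiv_at j f) x = pderiv_at j (pderiv_at i f) x"
  unfolding pderiv_at_def[abs_def]
  using assms by (intro frechet_derivative_symmetric_real) (simp add: smooth_on_def)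

text \<open>
  Any compact set outside of which the function vanishes will do; this is easier to
  propagate through sums and derivatives than the closure of the set of nonzeros.
\<close>
lemma test_function_iff:
  "test_function U \<phi> \<longleftrightarrow> smooth_on UNIV \<phi> \<and> (\<exists>K. compact K \<and> K \<subseteq> U \<and> (\<forall>x. x \<notin> K \<longrightarrow> \<phi> x = 0))"
proof (intro iffI conjI)
  assume *: "smooth_on UNIV \<phi> \<and> (\<exists>K. compact K \<and> K \<subseteq> U \<and> (\<forall>x. x \<notin> K \<longrightarrow> \<phi> x = 0))"
  then obtain K where K: "compact K" "K \<subseteq> U" "\<And>x. x \<notin> K \<Longrightarrow> \<phi> x = 0" by blast
  have sub: "closure {x. \<phi> x \<noteq> 0} \<subseteq> K"
    using K(3) by (intro closure_minimal compact_imp_closed K(1)) auto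
  then have "compact (closure {x. \<phi> x \<noteq> 0})"
    using compact_Int_closed[OF K(1) closed_closure, of "{x. \<phi> x \<noteq> 0}"] by (simp add: Int_absorb1)
  with * K(2) sub show "test_function U \<phi>"
    unfolding test_function_def by auto
next
  assume *: "test_function U \<phi>"
  show "smooth_on UNIV \<phi>" using * unfolding test_function_def by blast
  show "\<exists>K. compact K \<and> K \<subseteq> U \<and> (\<forall>x. x \<notin> K \<longrightarrow> \<phi> x = 0)"
    using * closure_subset[of "{x. \<phi> x \<noteq> 0}"] unfolding test_function_def
    by (intro exI[of _ "closure {x. \<phi> x \<noteq> 0}"]) auto
qed

lemma test_function_smooth: "test_function U \<phi> \<Longrightarrow> smooth_on UNIV \<phi>"
  by (simp add: test_function_def)

lemma test_functionI:
  "smooth_on UNIV \<phi> \<Longrightarrow> compact K \<Longrightarrow> K \<subseteq> U \<Longrightarrow> (\<And>x. x \<notin> K \<Longrightarrow> \<phi> x = 0) \<Longrightarrow> test_function U \<phi>"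
  unfolding test_function_iff by blast

lemma test_function_mono: "test_function U \<phi> \<Longrightarrow> U \<subseteq> V \<Longrightarrow> test_function V \<phi>"
  unfolding test_function_def by blast

lemma test_function_linear:
  assumes "bounded_linear h" "test_function U f"
  shows "test_function U (\<lambda>x. h (f x))"
proof -
  obtain K where K: "smooth_on UNIV f" "compact K" "K \<subseteq> U" "\<And>x. x \<notin> K \<Longrightarrow> f x = 0"
    using assms(2) unfolding test_function_iff by blast
  show ?thesis
    by (rule test_functionI[OF smooth_on_linear[OF assms(1) K(1)] K(2,3)])
      (simp add: K(4) linear_0[OF bounded_linear.linear[OF assms(1)]])
qed

lemma test_function_add:
  assumes "test_function U f" "test_function U g"
  shows "test_function U (\<lambda>x. f x + g x)"
proof -
  obtain K where K: "smooth_on UNIV f" "compact K" "K \<subseteq> U" "\<And>x. x \<notin> K \<Longrightarrow> f x = 0"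
    using assms(1) unfolding test_function_iff by blast
  obtain L where L: "smooth_on UNIV g" "compact L" "L \<subseteq> U" "\<And>x. x \<notin> L \<Longrightarrow> g x = 0"
    using assms(2) unfolding test_function_iff by blast
  show ?thesis
    by (rule test_functionI[OF smooth_on_add[OF K(1) L(1)] compact_Un[OF K(2) L(2)]]) (use K L in auto)
qed

lemma test_function_scaleR: "test_function U f \<Longrightarrow> test_function U (\<lambda>x. c *\<^sub>R f x)"
  by (rule test_function_linear[OF bounded_linear_scaleR_right])

lemma test_function_diff: "test_function U f \<Longrightarrow> test_function U g \<Longrightarrow> test_function U (\<lambda>x. f x - g x)"
  using test_function_add[of U f "\<lambda>x. (-1) *\<^sub>R g x"] test_function_scaleR[of U g "-1"] by simp

lemma test_function_sum:
  "(\<And>i. i \<in> I \<Longrightarrow> test_function U (f i)) \<Longrightarrow> test_function U (\<lambda>x. \<Sum>i\<in>I. f i x)"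
proof -
  have zero: "test_function U (\<lambda>x. 0)"
    by (rule test_functionI[OF smooth_on_const compact_empty]) simp_all
  show "(\<And>i. i \<in> I \<Longrightarrow> test_function U (f i)) \<Longrightarrow> test_function U (\<lambda>x. \<Sum>i\<in>I. f i x)"
    by (induction I rule: infinite_finite_induct) (simp_all add: zero test_function_add)
qed

lemma test_function_nth: "test_function U f \<Longrightarrow> test_function U (\<lambda>x. f x $ j :: real)"
  by (rule test_function_linear[OF bounded_linear_vec_nth])

lemma test_function_axis: "test_function U f \<Longrightarrow> test_function U (\<lambda>x. f x *\<^sub>R axis j (1::real))"
  by (rule test_function_linear[OF bounded_linear_scaleR_left])

lemma test_function_vec:
  fixes f :: "'a::euclidean_space \<Rightarrow> real^'n"
  assumes "\<And>j. test_function U (\<lambda>x. f x $ j)"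
  shows "test_function U f"
proof -
  have "test_function U (\<lambda>x. \<Sum>j\<in>UNIV. f x $ j *\<^sub>R axis j (1::real))"
    by (intro test_function_sum test_function_axis assms)
  moreover have "(\<Sum>j\<in>UNIV. v $ j *\<^sub>R axis j (1::real)) = v" for v :: "real^'n"
    using basis_expansion[of v] by (simp add: scalar_mult_eq_scaleR)
  ultimately show ?thesis by simp
qed

lemma pderiv_at_eq_0_off_support:
  assumes "closed K" "\<And>x. x \<notin> K \<Longrightarrow> f x = 0" "x \<notin> K"
  shows "pderiv_at i f x = 0"
proof -
  have "((\<lambda>_. 0) has_derivative (\<lambda>_. 0)) (at x)" by simp
  then have "(f has_derivative (\<lambda>_. 0)) (at x)"
    by (rule has_derivative_transform_within_open[where s="-K"]) (use assms in auto)
  then show ?thesis by (simp add: pderiv_at_eqI)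
qed

lemma test_function_pderiv:
  assumes "test_function U f"
  shows "test_function U (pderiv_at i f)"
proof -
  obtain K where K: "smooth_on UNIV f" "compact K" "K \<subseteq> U" "\<And>x. x \<notin> K \<Longrightarrow> f x = 0"
    using assms unfolding test_function_iff by blast
  show ?thesis
    by (rule test_functionI[OF smooth_on_pderiv[OF K(1)] K(2,3)])
      (rule pderiv_at_eq_0_off_support[OF compact_imp_closed[OF K(2)] K(4)])
qed

lemma test_function_gradient: "test_function U f \<Longrightarrow> test_function U (gradient f)"
  unfolding gradient_def by (rule test_function_vec) (simp add: test_function_pderiv)

lemma test_function_divergence: "test_function U f \<Longrightarrow> test_function U (divergence f)"
  unfolding divergence_def[abs_def] by (intro test_function_sum test_function_nth test_function_pderiv)

lemma curl3_nth [simp]: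
  "curl3 f x $ 1 = pderiv_at 2 f x $ 3 - pderiv_at 3 f x $ 2"
  "curl3 f x $ 2 = pderiv_at 3 f x $ 1 - pderiv_at 1 f x $ 3"
  "curl3 f x $ 3 = pderiv_at 1 f x $ 2 - pderiv_at 2 f x $ 1"
  by (simp_all add: curl3_def)

lemma test_function_curl3:
  assumes "test_function U f"
  shows "test_function U (curl3 f)"
proof (rule test_function_vec)
  have "\<forall>j. test_function U (\<lambda>x. curl3 f x $ j)"
    unfolding forall_3 curl3_nth
    by (intro conjI test_function_diff test_function_nth test_function_pderiv assms)
  then show "test_function U (\<lambda>x. curl3 f x $ j)" for j by blast
qed

lemma smooth_on_gradient: "smooth_on UNIV f \<Longrightarrow> smooth_on UNIV (gradient f)"
  unfolding gradient_def by (rule smooth_on_vec) (simp add: smooth_on_pderiv)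

lemma smooth_on_divergence: "smooth_on UNIV f \<Longrightarrow> smooth_on UNIV (divergence f)"
  unfolding divergence_def[abs_def] by (intro smooth_on_sum smooth_on_nth smooth_on_pderiv)

lemma smooth_on_curl3:
  assumes "smooth_on UNIV f"
  shows "smooth_on UNIV (curl3 f)"
proof (rule smooth_on_vec)
  have "\<forall>j. smooth_on UNIV (\<lambda>x. curl3 f x $ j)"
    unfolding forall_3 curl3_nth
    by (intro conjI smooth_on_diff smooth_on_nth smooth_on_pderiv assms)
  then show "smooth_on UNIV (\<lambda>x. curl3 f x $ j)" for j by blast
qed

section \<open>Second-order vector identities\<close>

lemma pderiv_at_curl3_nth:
  assumes "smooth_on UNIV f"
  defines "f' \<equiv> \<lambda>j x. f x $ j"
  shows "pderiv_at i (curl3 f) x $ 1 = pderiv_at i (pderiv_at 2 (f' 3)) x - pderiv_at i (pderiv_at 3 (f' 2)) x"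
    "pderiv_at i (curl3 f) x $ 2 = pderiv_at i (pderiv_at 3 (f' 1)) x - pderiv_at i (pderiv_at 1 (f' 3)) x"
    "pderiv_at i (curl3 f) x $ 3 = pderiv_at i (pderiv_at 1 (f' 2)) x - pderiv_at i (pderiv_at 2 (f' 1)) x"
proof -
  have d: "pderiv_at i (f' j) x = pderiv_at i f x $ j" for i j x
    unfolding f'_def by (intro pderiv_at_nth smooth_on_differentiable assms)
  have dd: "pderiv_at i (f' j) differentiable (at x)" for i j x
    unfolding f'_def by (intro smooth_on_differentiable smooth_on_pderiv smooth_on_nth assms)
  have n: "pderiv_at i (curl3 f) x $ j = pderiv_at i (\<lambda>x. curl3 f x $ j) x" for j
    by (intro pderiv_at_nth[symmetric] smooth_on_differentiable smooth_on_curl3 assms)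
  show "pderiv_at i (curl3 f) x $ 1 = pderiv_at i (pderiv_at 2 (f' 3)) x - pderiv_at i (pderiv_at 3 (f' 2)) x"
    "pderiv_at i (curl3 f) x $ 2 = pderiv_at i (pderiv_at 3 (f' 1)) x - pderiv_at i (pderiv_at 1 (f' 3)) x"
    "pderiv_at i (curl3 f) x $ 3 = pderiv_at i (pderiv_at 1 (f' 2)) x - pderiv_at i (pderiv_at 2 (f' 1)) x"
    unfolding n by (simp_all add: d[symmetric] pderiv_at_diff dd)
qed

lemma divergence_curl3:
  assumes "smooth_on UNIV f"
  shows "divergence (curl3 f) x = 0"
proof -
  note s = pderiv_at_symmetric[OF smooth_on_nth[OF assms]]
  show ?thesis
    unfolding divergence_def sum_3 pderiv_at_curl3_nth[OF assms]
    using s[of 1 2 3] s[of 1 3 2] s[of 2 3 1] by simp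
qed

lemma curl3_gradient:
  assumes "smooth_on UNIV (q :: real^3 \<Rightarrow> real)"
  shows "curl3 (gradient q) x = 0"
proof -
  have "pderiv_at i (gradient q) x $ j = pderiv_at i (pderiv_at j q) x" for i j
    using pderiv_at_nth[of "gradient q" x i j] smooth_on_differentiable[OF smooth_on_gradient[OF assms]]
    by (simp add: gradient_def)
  then show ?thesis
    by (simp add: vec_eq_iff forall_3 pderiv_at_symmetric[OF assms, of 2 1]
        pderiv_at_symmetric[OF assms, of 3 1] pderiv_at_symmetric[OF assms, of 3 2])
qed

definition laplacian :: "(real^'n::finite \<Rightarrow> 'b::real_normed_vector) \<Rightarrow> real^'n \<Rightarrow> 'b" where
  "laplacian f x = (\<Sum>i\<in>UNIV. pderiv_at i (pderiv_at i f) x)"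

lemma laplacian_linear:
  assumes "bounded_linear h" "smooth_on UNIV f"
  shows "laplacian (\<lambda>x. h (f x)) x = h (laplacian f x)"
proof -
  have "pderiv_at i (\<lambda>x. h (f x)) = (\<lambda>x. h (pderiv_at i f x))" for i
    by (intro ext pderiv_at_linear smooth_on_differentiable assms)
  then show ?thesis
    unfolding laplacian_def linear_sum[OF bounded_linear.linear[OF assms(1)]]
    by (simp add: pderiv_at_linear[OF assms(1)] smooth_on_differentiable smooth_on_pderiv assms(2))
qed

text \<open>
  This identity is what connects the variations: if a functional vanishes on gradients and on curls,
  then it vanishes on Laplacians.
\<close>
lemma curl3_curl3:
  assumes "smooth_on UNIV f"
  shows "curl3 (curl3 f) x = gradient (divergence f) x - laplacian f x"
proof -
  note s = pderiv_at_symmetric[OF smooth_on_nth[OF assms]]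
  have d: "pderiv_at i (\<lambda>x. f x $ j) x = pderiv_at i f x $ j" for i j x
    by (intro pderiv_at_nth smooth_on_differentiable assms)
  have dd: "pderiv_at i (\<lambda>x. f x $ j) differentiable (at x)" for i j x
    by (intro smooth_on_differentiable smooth_on_pderiv smooth_on_nth assms)
  have "divergence f = (\<lambda>x. pderiv_at 1 (\<lambda>x. f x $ 1) x + pderiv_at 2 (\<lambda>x. f x $ 2) x + pderiv_at 3 (\<lambda>x. f x $ 3) x)"
    by (simp add: divergence_def sum_3 d fun_eq_iff)
  then have g: "gradient (divergence f) x $ j = pderiv_at j (pderiv_at 1 (\<lambda>x. f x $ 1)) x +
      pderiv_at j (pderiv_at 2 (\<lambda>x. f x $ 2)) x + pderiv_at j (pderiv_at 3 (\<lambda>x. f x $ 3)) x" for j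
    by (simp add: gradient_def pderiv_at_add dd)
  have l: "laplacian f x $ j = laplacian (\<lambda>x. f x $ j) x" for j
    by (rule laplacian_linear[OF bounded_linear_vec_nth assms, symmetric])
  show ?thesis
    unfolding vec_eq_iff forall_3 vector_minus_component g l curl3_nth pderiv_at_curl3_nth[OF assms]
    unfolding laplacian_def sum_3
    using s[of 1 2 1] s[of 1 2 2] s[of 1 2 3] s[of 1 3 1] s[of 1 3 2] s[of 1 3 3] s[of 2 3 1] s[of 2 3 2] s[of 2 3 3]
    by simp
qed

section \<open>Integration by parts\<close>

lemma integrable_continuous_compact_support:
  fixes f :: "'a::euclidean_space \<Rightarrow> 'b::euclidean_space"
  assumes "continuous_on UNIV f" "compact K" "\<And>x. x \<notin> K \<Longrightarrow> f x = 0"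
  shows "integrable lborel f" "integrable lebesgue f"
proof -
  have "integrable lborel (\<lambda>x. indicator K x *\<^sub>R f x)"
    by (rule borel_integrable_compact[OF assms(2) continuous_on_subset[OF assms(1)]]) simp
  moreover have "(\<lambda>x. indicator K x *\<^sub>R f x) = f"
    using assms(3) by (force simp: indicator_def)
  ultimately show "integrable lborel f" by simp
  then show "integrable lebesgue f" by (simp add: integrable_completion)
qed

lemma bounded_continuous_compact_support:
  fixes f :: "'a::euclidean_space \<Rightarrow> 'b::real_normed_vector"
  assumes "continuous_on UNIV f" "compact K" "\<And>x. x \<notin> K \<Longrightarrow> f x = 0"
  obtains C where "C > 0" "\<And>x. norm (f x) \<le> C"
proof -
  have "bounded (f ` K)"
    by (intro compact_imp_bounded compact_continuous_image continuous_on_subset[OF assms(1)] assms(2)) simp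
  then obtain C where "C > 0" "\<And>x. x \<in> K \<Longrightarrow> norm (f x) \<le> C"
    unfolding bounded_pos by blast
  then show ?thesis using assms(3) by (intro that[of C]) (metis less_imp_le norm_zero)+
qed

lemma lborel_integral_translate:
  fixes f :: "'a::euclidean_space \<Rightarrow> 'b::{banach, second_countable_topology}"
  assumes [measurable]: "f \<in> borel_measurable borel"
  shows "(LINT x|lborel. f (c + x)) = (LINT x|lborel. f x)"
  by (subst (2) lborel_distr_plus[of c, symmetric]) (subst integral_distr; simp)

text \<open>
  By translation invariance all difference quotients of \<open>f\<close> have integral
  zero, and they converge to the derivative, dominated by a constant on a compact set.
\<close>
lemma integral_pderiv_eq_0:
  fixes f :: "real^'n \<Rightarrow> 'b::euclidean_space"
  assumes diff: "\<And>x. f differentiable (at x)" and cont: "continuous_on UNIV (pderiv_at i f)"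
    and K: "compact K" "\<And>x. x \<notin> K \<Longrightarrow> f x = 0"
  shows "(LINT x|lebesgue. pderiv_at i f x) = 0"
proof -
  let ?e = "axis i (1::real) :: real^'n"
  have cf: "continuous_on UNIV f"
    using diff by (simp add: differentiable_imp_continuous_on differentiable_on_UNIV_iff)
  have [measurable]: "f \<in> borel_measurable borel" "pderiv_at i f \<in> borel_measurable borel"
    using cf cont by (auto intro: borel_measurable_continuous_onI)
  note K' = pderiv_at_eq_0_off_support[OF compact_imp_closed[OF K(1)] K(2)]
  obtain C where C: "C > 0" "\<And>x. norm (pderiv_at i f x) \<le> C"
    using bounded_continuous_compact_support[OF cont K(1) K'] by blast
  define t where "t n = 1 / real (Suc n)" for n
  have t: "0 < t n" "t n \<le> 1" for n by (simp_all add: t_def)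
  have t0: "t \<longlonglongrightarrow> 0" unfolding t_def[abs_def] using LIMSEQ_inverse_real_of_nat by (simp add: inverse_eq_divide)
  \<comment> \<open>All translates of \<open>K\<close> by the steps \<open>t n \<le> 1\<close> lie in one compact set.\<close>
  define L where "L = (\<lambda>(x, s). x - s *\<^sub>R ?e) ` (K \<times> {0..1})"
  have L: "compact L"
    unfolding L_def by (intro compact_continuous_image compact_Times K(1) compact_Icc)
      (auto intro!: continuous_intros simp: case_prod_unfold)
  have KL: "K \<subseteq> L" unfolding L_def by force
  define q where "q n x = (1 / t n) *\<^sub>R (f (t n *\<^sub>R ?e + x) - f x)" for n x
  have intq: "(LINT x|lborel. q n x) = 0" for n
  proof -
    have int: "integrable lborel f" by (rule integrable_continuous_compact_support[OF cf K])
    have "integrable lborel (\<lambda>x. f (t n *\<^sub>R ?e + x))"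
      using int by (subst (asm) lborel_distr_plus[of "t n *\<^sub>R ?e", symmetric]) (subst (asm) integrable_distr_eq; simp)
    then show ?thesis
      unfolding q_def using int by (simp add: lborel_integral_translate)
  qed
  have line: "((\<lambda>s. f (x + s *\<^sub>R ?e)) has_vector_derivative pderiv_at i f (x + s *\<^sub>R ?e)) (at s)" for x s
  proof -
    have l: "((\<lambda>s. x + s *\<^sub>R ?e) has_derivative (\<lambda>h. h *\<^sub>R ?e)) (at s)"
      by (auto intro!: derivative_eq_intros)
    have f1: "(f has_derivative frechet_derivative f (at y)) (at y)" for y
      using diff frechet_derivative_works by blast
    show ?thesis
      using has_derivative_compose[OF l f1] linear_cmul[OF has_derivative_linear[OF f1]]
      by (simp add: has_vector_derivative_def pderiv_at_def)
  qed
  have bound: "norm (q n x) \<le> indicator L x *\<^sub>R C" for n x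
  proof (cases "x \<in> L")
    case True
    have "norm (f (x + t n *\<^sub>R ?e) - f (x + 0 *\<^sub>R ?e)) \<le> C * norm (t n - 0)"
      by (rule differentiable_bound[where S=UNIV and f'="\<lambda>s h. h *\<^sub>R pderiv_at i f (x + s *\<^sub>R ?e)"])
        (use line C in \<open>auto simp: has_vector_derivative_def onorm_scaleR_left onorm_id\<close>)
    moreover have "norm (q n x) = norm (f (x + t n *\<^sub>R ?e) - f x) / t n"
      using t[of n] by (simp add: q_def add.commute)
    ultimately show ?thesis
      using True t[of n] by (simp add: divide_le_eq)
  next
    case False
    have "x \<notin> K" using False KL by blast
    moreover have "t n *\<^sub>R ?e + x \<notin> K"
    proof
      assume "t n *\<^sub>R ?e + x \<in> K"
      then have "(\<lambda>(x, s). x - s *\<^sub>R ?e) (t n *\<^sub>R ?e + x, t n) \<in> L"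
        unfolding L_def using t[of n] by (intro imageI) auto
      then show False using False by simp
    qed
    ultimately show ?thesis using K(2) False by (simp add: q_def)
  qed
  have lim: "(\<lambda>n. q n x) \<longlonglongrightarrow> pderiv_at i f x" for x
  proof -
    have "((\<lambda>h. norm (f (x + h *\<^sub>R ?e) - f x - h *\<^sub>R pderiv_at i f x) / norm h) \<longlongrightarrow> 0) (at 0)"
      using line[of x 0] by (simp add: has_vector_derivative_def has_derivative_at)
    moreover have "filterlim t (at 0) sequentially"
      using t0 t(1) by (simp add: filterlim_at less_imp_neq[symmetric] order_less_imp_not_eq2)
    ultimately have "(\<lambda>n. norm (f (x + t n *\<^sub>R ?e) - f x - t n *\<^sub>R pderiv_at i f x) / norm (t n)) \<longlonglongrightarrow> 0"
      by (rule filterlim_compose)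
    moreover have "norm (f (x + t n *\<^sub>R ?e) - f x - t n *\<^sub>R pderiv_at i f x) / norm (t n) = norm (q n x - pderiv_at i f x)" for n
    proof -
      have "q n x - pderiv_at i f x = (1 / t n) *\<^sub>R (f (x + t n *\<^sub>R ?e) - f x - t n *\<^sub>R pderiv_at i f x)"
        using t(1)[of n] by (simp add: q_def algebra_simps)
      then show ?thesis using t(1)[of n] by simp
    qed
    ultimately have "(\<lambda>n. norm (q n x - pderiv_at i f x)) \<longlonglongrightarrow> 0" by simp
    then show ?thesis by (rule LIM_zero_cancel[OF tendsto_norm_zero_cancel])
  qed
  have "(\<lambda>n. LINT x|lborel. q n x) \<longlonglongrightarrow> (LINT x|lborel. pderiv_at i f x)"
    by (rule integral_dominated_convergence[where w="\<lambda>x. indicator L x *\<^sub>R C"])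
      (use lim bound borel_integrable_compact[OF L continuous_on_const[of L "1::real"]] in \<open>simp_all add: q_def\<close>)
  then have "(LINT x|lborel. pderiv_at i f x) = 0"
    by (simp add: intq LIMSEQ_const_iff)
  then show ?thesis by (simp add: integral_completion)
qed

text \<open>
  The support conditions are disjunctions so that either factor may provide the compact support: the test function
  in weak formulations, the kernel in convolutions.
\<close>
lemma integral_by_parts:
  fixes f :: "real^'n \<Rightarrow> 'b::real_normed_vector" and g :: "real^'n \<Rightarrow> 'c::real_normed_vector"
    and h :: "'b \<Rightarrow> 'c \<Rightarrow> 'd::euclidean_space"
  assumes h: "bounded_bilinear h"
    and f: "\<And>x. f differentiable (at x)" "continuous_on UNIV (pderiv_at i f)"
    and g: "\<And>x. g differentiable (at x)" "continuous_on UNIV (pderiv_at i g)"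
    and K: "compact K" "\<And>x. x \<notin> K \<Longrightarrow> f x = 0 \<or> g x = 0"
      "\<And>x. x \<notin> K \<Longrightarrow> f x = 0 \<or> pderiv_at i g x = 0" "\<And>x. x \<notin> K \<Longrightarrow> pderiv_at i f x = 0 \<or> g x = 0"
  shows "(LINT x|lebesgue. h (f x) (pderiv_at i g x)) = - (LINT x|lebesgue. h (pderiv_at i f x) (g x))"
proof -
  have c: "continuous_on UNIV f" "continuous_on UNIV g"
    using f g by (simp_all add: differentiable_imp_continuous_on differentiable_on_UNIV_iff)
  have p: "pderiv_at i (\<lambda>x. h (f x) (g x)) x = h (f x) (pderiv_at i g x) + h (pderiv_at i f x) (g x)" for x
    by (rule pderiv_at_bilinear[OF h f(1) g(1)])
  note h0 = bounded_bilinear.zero_left[OF h] bounded_bilinear.zero_right[OF h]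
  have i: "integrable lebesgue (\<lambda>x. h (f x) (pderiv_at i g x))" "integrable lebesgue (\<lambda>x. h (pderiv_at i f x) (g x))"
    by (rule integrable_continuous_compact_support[where K=K];
        use K h0 in \<open>force intro!: bounded_bilinear.continuous_on[OF h] c f g\<close>)+
  have "(LINT x|lebesgue. pderiv_at i (\<lambda>x. h (f x) (g x)) x) = 0"
  proof (rule integral_pderiv_eq_0[OF _ _ K(1)])
    show "(\<lambda>x. h (f x) (g x)) differentiable at x" for x
      using bounded_bilinear.FDERIV[OF h f(1)[unfolded frechet_derivative_works] g(1)[unfolded frechet_derivative_works]]
      by (auto simp: differentiable_def)
    show "continuous_on UNIV (pderiv_at i (\<lambda>x. h (f x) (g x)))"
      unfolding p by (intro continuous_intros bounded_bilinear.continuous_on[OF h] c f g)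
  qed (use K(2) h0 in force)
  then show ?thesis
    unfolding p using i by (simp add: eq_neg_iff_add_eq_0)
qed

section \<open>Smooth bump functions\<close>

text \<open>
  The functions \<open>exp (- 1 / t) / t ^ m\<close>, continued by zero. This family is closed under differentiation up
  to linear combinations, which gives smoothness of all its members at once.
\<close>
definition flat :: "nat \<Rightarrow> real \<Rightarrow> real" where
  "flat m t = (if t \<le> 0 then 0 else exp (- (1 / t)) * (1 / t) ^ m)"

text \<open>
  A quadratic bound is just what makes the derivative at the origin vanish. It follows from
  \<open>(1 + s / n) ^ n \<le> exp s\<close> at \<open>s = 1 / t\<close> with \<open>n = m + 2\<close>.
\<close>
lemma flat_le: "\<bar>flat m t\<bar> \<le> real (m + 2) ^ (m + 2) * t\<^sup>2"
proof (cases "t \<le> 0")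
  case False
  then have t: "t > 0" by simp
  define n where "n = m + 2"
  define s where "s = 1 / t"
  have s: "s > 0" using t by (simp add: s_def)
  have n: "n > 0" by (simp add: n_def)
  have sn: "s ^ n = s ^ m * s\<^sup>2" by (simp add: n_def power2_eq_square)
  have "(1 + s / real n) ^ n \<le> exp s"
  proof (rule exp_ge_one_plus_x_over_n_power_n[OF _ n])
    show "- real n \<le> s" using s by linarith
  qed
  moreover have "(s / real n) ^ n \<le> (1 + s / real n) ^ n"
    using s by (intro power_mono) simp_all
  ultimately have "s ^ n / real n ^ n \<le> exp s"
    unfolding power_divide by (rule order_trans[rotated])
  then have "s ^ n \<le> exp s * real n ^ n"
    using n by (simp add: pos_divide_le_eq)
  then have "exp (- s) * s ^ n \<le> exp (- s) * (exp s * real n ^ n)"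
    by (rule mult_left_mono) simp
  also have "\<dots> = real n ^ n"
    by (simp add: exp_minus)
  finally have "exp (- s) * s ^ m * s\<^sup>2 \<le> real n ^ n"
    unfolding sn by (simp only: mult.assoc)
  then have "exp (- s) * s ^ m * s\<^sup>2 * t\<^sup>2 \<le> real n ^ n * t\<^sup>2"
    by (rule mult_right_mono) simp
  moreover have "s\<^sup>2 * t\<^sup>2 = 1"
    using t by (simp add: s_def power_divide)
  ultimately have "exp (- s) * s ^ m \<le> real n ^ n * t\<^sup>2"
    by (simp add: mult.assoc)
  then show ?thesis
    using t by (simp add: flat_def s_def n_def)
qed (simp add: flat_def)

lemma DERIV_flat: "(flat m has_real_derivative flat (m + 2) t - real m * flat (m + 1) t) (at t)"
proof (cases t "0::real" rule: linorder_cases)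
  case less
  have "((\<lambda>_. 0) has_real_derivative flat (m + 2) t - real m * flat (m + 1) t) (at t)"
    using less by (simp add: flat_def)
  then show ?thesis
    by (rule has_field_derivative_transform_within_open[where S="{..<0}"]) (use less in \<open>auto simp: flat_def\<close>)
next
  case greater
  have u: "((\<lambda>t. 1 / t) has_real_derivative - ((1 / t)\<^sup>2)) (at t)"
    using greater by (auto intro!: derivative_eq_intros simp: power2_eq_square)
  have "((\<lambda>t. exp (- (1 / t)) * (1 / t) ^ m) has_real_derivative
      exp (- (1 / t)) * (1 / t)\<^sup>2 * (1 / t) ^ m - real m * (exp (- (1 / t)) * (1 / t) ^ (m - 1) * (1 / t)\<^sup>2)) (at t)"
    by (rule derivative_eq_intros u refl | simp)+
  moreover have "exp (- s) * s\<^sup>2 * s ^ m - real m * (exp (- s) * s ^ (m - 1) * s\<^sup>2) =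
      exp (- s) * s ^ (m + 2) - real m * (exp (- s) * s ^ (m + 1))" for s :: real
    by (cases m) (simp_all add: power2_eq_square)
  ultimately have "((\<lambda>t. exp (- (1 / t)) * (1 / t) ^ m) has_real_derivative flat (m + 2) t - real m * flat (m + 1) t) (at t)"
    using greater by (simp add: flat_def)
  then show ?thesis
    by (rule has_field_derivative_transform_within_open[where S="{0<..}"]) (use greater in \<open>auto simp: flat_def\<close>)
next
  case equal
  have "((\<lambda>h. (flat m (0 + h) - flat m 0) / h) \<longlongrightarrow> 0) (at 0)"
  proof (rule Lim_null_comparison)
    show "\<forall>\<^sub>F h in at 0. norm ((flat m (0 + h) - flat m 0) / h) \<le> real (m + 2) ^ (m + 2) * \<bar>h\<bar>"
      unfolding eventually_at_filter
    proof (intro always_eventually allI impI)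
      fix h :: real assume "h \<noteq> 0"
      define C where "C = real (m + 2) ^ (m + 2)"
      have "C * h\<^sup>2 = C * \<bar>h\<bar> * \<bar>h\<bar>"
        by (simp add: power2_eq_square)
      then have "\<bar>flat m h\<bar> \<le> C * \<bar>h\<bar> * \<bar>h\<bar>"
        using flat_le[of m h] unfolding C_def by (simp only:)
      then have "\<bar>flat m h\<bar> / \<bar>h\<bar> \<le> C * \<bar>h\<bar>"
        using \<open>h \<noteq> 0\<close> by (simp add: pos_divide_le_eq)
      then show "norm ((flat m (0 + h) - flat m 0) / h) \<le> real (m + 2) ^ (m + 2) * \<bar>h\<bar>"
        unfolding C_def by (simp add: flat_def[of m 0])
    qed
    show "((\<lambda>h. real (m + 2) ^ (m + 2) * \<bar>h\<bar>) \<longlongrightarrow> 0) (at 0)"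
      by (auto intro!: tendsto_eq_intros)
  qed
  then show ?thesis
    unfolding equal by (simp add: DERIV_def flat_def[of _ 0])
qed

lemma smooth_on_flat: "smooth_on UNIV (flat m)"
proof -
  have "Ck_on k UNIV (flat m)" for k
  proof (induction k arbitrary: m)
    case 0
    show ?case using DERIV_isCont[OF DERIV_flat] by (simp add: continuous_at_imp_continuous_on)
  next
    case (Suc k)
    show ?case
    proof (rule Ck_on_Suc_has_derivative)
      show "(flat m has_derivative (\<lambda>v. (flat (m + 2) t + (- real m) *\<^sub>R flat (m + 1) t) * v)) (at t)" for t
        using DERIV_flat[of m t] by (simp add: has_field_derivative_def)
      show "Ck_on k UNIV (\<lambda>t. (flat (m + 2) t + (- real m) *\<^sub>R flat (m + 1) t) * v)" for v
        by (intro Ck_on_linear[OF bounded_linear_mult_left] Ck_on_add Ck_on_linear[OF bounded_linear_scaleR_right] Suc)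
    qed
  qed
  then show ?thesis by (simp add: smooth_on_def)
qed

text \<open>
  The shift by \<open>- 1\<close> moves the support away from the faces of the box by \<open>1 / (n + 1)\<close>, so that the support
  is a compact subset of the open box. The factor \<open>n + 1\<close> drives each exponential to \<open>1\<close> in the interior.
\<close>
definition box_bump :: "'a::euclidean_space \<Rightarrow> 'a \<Rightarrow> nat \<Rightarrow> 'a \<Rightarrow> real" where
  "box_bump a b n x = (\<Prod>i\<in>Basis. flat 0 (real (Suc n) * (x \<bullet> i - a \<bullet> i) - 1) * flat 0 (real (Suc n) * (b \<bullet> i - x \<bullet> i) - 1))"

lemma flat_0_bounds: "0 \<le> flat 0 t" "flat 0 t \<le> 1"
  by (auto simp: flat_def)

lemma test_function_box_bump: "test_function (box a b) (box_bump a b n)"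
proof (rule test_functionI)
  let ?N = "real (Suc n)"
  have l: "bounded_linear (\<lambda>x::'a. c * (x \<bullet> i))" for i c
    by (intro bounded_linear_mult_right[THEN bounded_linear_compose] bounded_linear_inner_left)
  have "smooth_on UNIV (\<lambda>x::'a. flat 0 (d + c * (x \<bullet> i)))" for i c d
    using smooth_on_flat[of 0] Ck_on_compose_affine[OF l[of c i], of _ "flat 0" d] by (simp add: smooth_on_def)
  from this[of "- ?N * (a \<bullet> i) - 1" ?N i for i] this[of "?N * (b \<bullet> i) - 1" "- ?N" i for i]
  have "smooth_on UNIV (\<lambda>x::'a. flat 0 (?N * (x \<bullet> i - a \<bullet> i) - 1))" "smooth_on UNIV (\<lambda>x::'a. flat 0 (?N * (b \<bullet> i - x \<bullet> i) - 1))" for i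
    by (simp_all add: algebra_simps)
  then show "smooth_on UNIV (box_bump a b n)"
    unfolding box_bump_def[abs_def] by (intro smooth_on_prod smooth_on_bilinear[OF bounded_bilinear_mult])
  let ?K = "cbox (a + (1 / ?N) *\<^sub>R One) (b - (1 / ?N) *\<^sub>R One)"
  show "compact ?K" by simp
  have N: "0 < 1 / ?N" by simp
  show "?K \<subseteq> box a b"
  proof
    fix x assume "x \<in> ?K"
    then have "a \<bullet> i + 1 / ?N \<le> x \<bullet> i \<and> x \<bullet> i \<le> b \<bullet> i - 1 / ?N" if "i \<in> Basis" for i
      using that by (simp add: mem_box inner_simps)
    note le = this
    have "a \<bullet> i < x \<bullet> i \<and> x \<bullet> i < b \<bullet> i" if "i \<in> Basis" for i
      using le[OF that] N by linarith
    then show "x \<in> box a b" by (simp add: mem_box)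
  qed
  show "box_bump a b n x = 0" if "x \<notin> ?K" for x
  proof -
    have "\<not> (\<forall>i\<in>Basis. a \<bullet> i + 1 / ?N \<le> x \<bullet> i \<and> x \<bullet> i \<le> b \<bullet> i - 1 / ?N)"
      using that by (simp add: mem_box inner_simps)
    then obtain i where i: "i \<in> Basis" "\<not> (a \<bullet> i + 1 / ?N \<le> x \<bullet> i \<and> x \<bullet> i \<le> b \<bullet> i - 1 / ?N)"
      by blast
    then have "?N * (x \<bullet> i - a \<bullet> i) - 1 \<le> 0 \<or> ?N * (b \<bullet> i - x \<bullet> i) - 1 \<le> 0"
      by (auto simp: field_simps simp del: of_nat_Suc)
    then have "flat 0 (?N * (x \<bullet> i - a \<bullet> i) - 1) * flat 0 (?N * (b \<bullet> i - x \<bullet> i) - 1) = 0"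
      by (auto simp: flat_def simp del: of_nat_Suc)
    with i(1) show ?thesis
      unfolding box_bump_def by (intro prod_zero) auto
  qed
qed

lemma box_bump_bounds: "0 \<le> box_bump a b n x" "box_bump a b n x \<le> 1"
  unfolding box_bump_def using flat_0_bounds
  by (auto intro!: prod_nonneg prod_le_1 mult_le_one)

lemma box_bump_tendsto_indicator: "(\<lambda>n. box_bump a b n x) \<longlonglongrightarrow> indicator (box a b) x"
proof (cases "x \<in> box a b")
  case True
  have flat_lim: "(\<lambda>n. flat 0 (real (Suc n) * s - 1)) \<longlonglongrightarrow> 1" if "s > 0" for s
  proof -
    have lim: "filterlim (\<lambda>n. real (Suc n) * s - 1) at_top sequentially"
      using that by real_asymp
    have "(\<lambda>n. exp (- (1 / (real (Suc n) * s - 1)))) \<longlonglongrightarrow> exp (- 0)"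
      by (intro tendsto_exp tendsto_minus tendsto_divide_0[OF tendsto_const] filterlim_at_top_imp_at_infinity lim)
    moreover have "\<forall>\<^sub>F n in sequentially. exp (- (1 / (real (Suc n) * s - 1))) = flat 0 (real (Suc n) * s - 1)"
      using filterlim_at_top_dense[THEN iffD1, OF lim, rule_format, of 0]
      by eventually_elim (simp add: flat_def)
    ultimately show ?thesis by (simp add: tendsto_cong)
  qed
  have "(\<lambda>n. box_bump a b n x) \<longlonglongrightarrow> (\<Prod>i\<in>(Basis::'a set). 1 * 1)"
    unfolding box_bump_def using True
    by (intro tendsto_prod tendsto_mult flat_lim) (auto simp: box_def)
  then show ?thesis using True by simp
next
  case False
  then have "box_bump a b n x = 0" for n
    using test_function_box_bump[of a b n] unfolding test_function_iff by blast
  then show ?thesis using False by simp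
qed

section \<open>The fundamental lemma of the calculus of variations\<close>

lemma norm_less_imp_mem_box:
  fixes x :: "'a::euclidean_space"
  assumes "norm x < r"
  shows "x \<in> box (- (r *\<^sub>R One)) (r *\<^sub>R One)"
proof -
  have "\<bar>x \<bullet> i\<bar> < r" if "i \<in> Basis" for i
    using Basis_le_norm[OF that, of x] assms by linarith
  then show ?thesis by (simp add: mem_box abs_less_iff) (metis minus_less_iff)
qed

lemma locally_integrableD:
  "locally_integrable f \<Longrightarrow> compact K \<Longrightarrow> integrable lebesgue (\<lambda>x. indicator K x *\<^sub>R f x)"
  unfolding locally_integrable_def set_integrable_def by simp

lemma locally_integrable_measurable:
  fixes f :: "'a::euclidean_space \<Rightarrow> 'b::euclidean_space"
  assumes "locally_integrable f"
  shows "f \<in> borel_measurable lebesgue"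
proof (rule borel_measurable_LIMSEQ_metric)
  let ?Q = "\<lambda>n. cbox (- (real n *\<^sub>R One)) (real n *\<^sub>R One) :: 'a set"
  show "(\<lambda>x. indicator (?Q n) x *\<^sub>R f x) \<in> borel_measurable lebesgue" for n
    by (rule borel_measurable_integrable[OF locally_integrableD[OF assms compact_cbox]])
  show "(\<lambda>n. indicator (?Q n) x *\<^sub>R f x) \<longlonglongrightarrow> f x" for x
  proof -
    obtain N where N: "norm x < real N" using reals_Archimedean2 by blast
    have "x \<in> ?Q n" if "n \<ge> N" for n
      using norm_less_imp_mem_box[of x "real n"] that N box_subset_cbox by force
    then have "\<forall>\<^sub>F n in sequentially. indicator (?Q n) x *\<^sub>R f x = f x"
      unfolding eventually_sequentially by (intro exI[of _ N]) simp
    then show ?thesis by (rule tendsto_eventually)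
  qed
qed

lemma integrable_dominated_by_locally_integrable:
  fixes f :: "'a::euclidean_space \<Rightarrow> 'b::euclidean_space" and g :: "'a \<Rightarrow> 'c::euclidean_space"
  assumes f: "locally_integrable f" and g: "g \<in> borel_measurable lebesgue"
    and K: "compact K" and le: "\<And>x. norm (g x) \<le> C * norm (indicator K x *\<^sub>R f x)"
  shows "integrable lebesgue g"
proof (rule Bochner_Integration.integrable_bound)
  show "integrable lebesgue (\<lambda>x. C *\<^sub>R (indicator K x *\<^sub>R f x))"
    by (intro integrable_scaleR_right locally_integrableD[OF f K])
  show "AE x in lebesgue. norm (g x) \<le> norm (C *\<^sub>R (indicator K x *\<^sub>R f x))"
    by (intro always_eventually allI order_trans[OF le]) (subst norm_scaleR, rule mult_right_mono, simp_all)
qed fact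

lemma
  fixes f :: "'a::euclidean_space \<Rightarrow> 'b::euclidean_space"
  assumes f: "locally_integrable f"
  shows integrable_test_scaleR: "test_function U \<phi> \<Longrightarrow> integrable lebesgue (\<lambda>x. \<phi> x *\<^sub>R f x)"
    and integrable_test_inner: "test_function U \<Phi> \<Longrightarrow> integrable lebesgue (\<lambda>x. f x \<bullet> \<Phi> x)"
proof -
  note [measurable] = locally_integrable_measurable[OF f]
  { assume "test_function U \<phi>"
    then obtain K where K: "smooth_on UNIV \<phi>" "compact K" "\<And>x. x \<notin> K \<Longrightarrow> \<phi> x = 0"
      unfolding test_function_iff by blast
    note c = smooth_on_continuous[OF K(1)]
    obtain C where C: "C > 0" "\<And>x. norm (\<phi> x) \<le> C"
      using bounded_continuous_compact_support[OF c K(2,3)] by blast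
    have [measurable]: "\<phi> \<in> borel_measurable lebesgue"
      using borel_measurable_continuous_onI[OF c] by (intro measurable_completion) simp
    show "integrable lebesgue (\<lambda>x. \<phi> x *\<^sub>R f x)"
    proof (rule integrable_dominated_by_locally_integrable[OF f _ K(2), where C=C])
      show "norm (\<phi> x *\<^sub>R f x) \<le> C * norm (indicator K x *\<^sub>R f x)" for x
        using C(2)[of x] K(3)[of x] by (cases "x \<in> K") (auto intro: mult_right_mono)
    qed measurable }
  { assume "test_function U \<Phi>"
    then obtain K where K: "smooth_on UNIV \<Phi>" "compact K" "\<And>x. x \<notin> K \<Longrightarrow> \<Phi> x = 0"
      unfolding test_function_iff by blast
    note c = smooth_on_continuous[OF K(1)]
    obtain C where C: "C > 0" "\<And>x. norm (\<Phi> x) \<le> C"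
      using bounded_continuous_compact_support[OF c K(2,3)] by blast
    have [measurable]: "\<Phi> \<in> borel_measurable lebesgue"
      using borel_measurable_continuous_onI[OF c] by (intro measurable_completion) simp
    show "integrable lebesgue (\<lambda>x. f x \<bullet> \<Phi> x)"
    proof (rule integrable_dominated_by_locally_integrable[OF f _ K(2), where C=C])
      show "norm (f x \<bullet> \<Phi> x) \<le> C * norm (indicator K x *\<^sub>R f x)" for x
      proof (cases "x \<in> K")
        case True
        have "norm (f x \<bullet> \<Phi> x) \<le> norm (f x) * norm (\<Phi> x)" by (simp add: Cauchy_Schwarz_ineq2)
        also have "\<dots> \<le> norm (f x) * C" by (intro mult_left_mono C(2) norm_ge_zero)
        finally show ?thesis using True by (simp add: mult.commute)
      qed (simp add: K(3))
    qed measurable }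
qed

text \<open>
  Boxes are stable under intersection and generate the Borel sets, so all integrals over Borel sets vanish.
  The integral over the whole space enters separately because Dynkin's lemma passes to complements.
\<close>
lemma integral_box_eq_0_imp_AE_eq_0:
  fixes v :: "'a::euclidean_space \<Rightarrow> 'b::euclidean_space"
  assumes v: "integrable lebesgue v" and box: "\<And>a b. (LINT x|lebesgue. indicator (box a b) x *\<^sub>R v x) = 0"
    and total: "(LINT x|lebesgue. v x) = 0"
  shows "AE x in lebesgue. v x = 0"
proof -
  interpret sigma_finite_measure "lebesgue :: 'a measure"
  proof
    from lborel.sigma_finite_countable obtain A :: "'a set set" where
      "countable A \<and> A \<subseteq> sets lborel \<and> \<Union>A = space lborel \<and> (\<forall>a\<in>A. emeasure lborel a \<noteq> \<infinity>)" ..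
    then show "\<exists>A::'a set set. countable A \<and> A \<subseteq> sets lebesgue \<and> \<Union>A = space lebesgue \<and> (\<forall>a\<in>A. emeasure lebesgue a \<noteq> \<infinity>)"
      by (intro exI[of _ A]) (auto simp: emeasure_completion)
  qed
  have borel: "(LINT x|lebesgue. indicator A x *\<^sub>R v x) = 0" if "A \<in> sets borel" for A
  proof -
    let ?G = "range (\<lambda>(a, b). box a b) :: 'a set set"
    have borel_sets: "sets borel = sigma_sets UNIV ?G"
      by (subst borel_eq_box) (rule sets_measure_of, simp)
    have A: "A \<in> sigma_sets UNIV ?G"
      using that borel_sets by simp
    have sub: "B \<in> sets lebesgue" if "B \<in> sigma_sets UNIV ?G" for B
      using that unfolding borel_sets[symmetric] by (intro sets_completionI_sets) simp
    have int: "integrable lebesgue (\<lambda>x. indicator B x *\<^sub>R v x)" if "B \<in> sets lebesgue" for B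
      by (rule integrable_mult_indicator[OF that v])
    show ?thesis
    proof (rule sigma_sets_induct_disjoint[OF _ _ A])
      show "Int_stable ?G"
      proof (rule Int_stableI)
        fix X Y assume "X \<in> ?G" "Y \<in> ?G"
        then obtain a b c d where "X = box a b" "Y = box c d" by auto
        then show "X \<inter> Y \<in> ?G" by (auto simp: box_Int_box)
      qed
      show "(LINT x|lebesgue. indicator B x *\<^sub>R v x) = 0" if "B \<in> ?G" for B
        using that box by auto
      show "(LINT x|lebesgue. indicator (UNIV - B) x *\<^sub>R v x) = 0"
        if "B \<in> sigma_sets UNIV ?G" "(LINT x|lebesgue. indicator B x *\<^sub>R v x) = 0" for B
      proof -
        have "indicator (UNIV - B) x *\<^sub>R v x = v x - indicator B x *\<^sub>R v x" for x
          by (simp add: indicator_def)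
        then show ?thesis
          using that(2) total v int[OF sub[OF that(1)]] by simp
      qed
      show "(LINT x|lebesgue. indicator (\<Union>i. B i) x *\<^sub>R v x) = 0"
        if "disjoint_family B" "range B \<subseteq> sigma_sets UNIV ?G" "\<And>i. (LINT x|lebesgue. indicator (B i) x *\<^sub>R v x) = 0"
        for B :: "nat \<Rightarrow> 'a set"
      proof -
        have "B i \<in> sets lebesgue" for i using that(2) sub by blast
        then have "set_lebesgue_integral lebesgue (\<Union>i. B i) v = (\<Sum>i. set_lebesgue_integral lebesgue (B i) v)"
          using that(1) int
          by (intro lebesgue_integral_countable_add) (auto simp: disjoint_family_on_def set_integrable_def)
        then show ?thesis using that(3) by (simp add: set_lebesgue_integral_def)
      qed
    qed auto
  qed
  show ?thesis
  proof (rule density_zero[OF v])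
    fix A :: "'a set" assume "A \<in> sets lebesgue"
    then obtain S N N' where A: "A = S \<union> N" "N \<subseteq> N'" "N' \<in> null_sets lborel" "S \<in> sets lborel"
      by (rule sets_completionE)
    have "AE x in lebesgue. x \<notin> N'"
      using A(3) by (intro AE_not_in null_sets_completionI)
    then have "AE x in lebesgue. indicator A x *\<^sub>R v x = indicator S x *\<^sub>R v x"
      by eventually_elim (use A(1,2) in \<open>auto simp: indicator_def\<close>)
    then have "(LINT x|lebesgue. indicator A x *\<^sub>R v x) = (LINT x|lebesgue. indicator S x *\<^sub>R v x)"
      using \<open>A \<in> sets lebesgue\<close> A(4) v
      by (intro integral_cong_AE borel_measurable_scaleR borel_measurable_indicator) (auto simp: sets_completionI_sets)
    then show "set_lebesgue_integral lebesgue A v = 0"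
      using borel A(4) by (simp add: set_lebesgue_integral_def)
  qed
qed

text \<open>
  The bumps turn the hypothesis into vanishing integrals over all boxes. Cutting \<open>u\<close> off by a large open
  box keeps this property and makes \<open>u\<close> integrable.
\<close>
lemma fundamental_lemma:
  fixes u :: "'a::euclidean_space \<Rightarrow> 'b::euclidean_space"
  assumes u: "locally_integrable u"
    and test: "\<And>\<phi>. test_function UNIV \<phi> \<Longrightarrow> (LINT x|lebesgue. \<phi> x *\<^sub>R u x) = 0"
  shows "AE x in lebesgue. u x = 0"
proof -
  note [measurable] = locally_integrable_measurable[OF u]
  have box: "(LINT x|lebesgue. indicator (box a b) x *\<^sub>R u x) = 0" for a b
  proof -
    have t: "test_function UNIV (box_bump a b n)" for n
      by (rule test_function_mono[OF test_function_box_bump]) simp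
    have "(\<lambda>n. LINT x|lebesgue. box_bump a b n x *\<^sub>R u x) \<longlonglongrightarrow> (LINT x|lebesgue. indicator (box a b) x *\<^sub>R u x)"
    proof (rule integral_dominated_convergence)
      show "integrable lebesgue (\<lambda>x. norm (indicator (cbox a b) x *\<^sub>R u x))"
        by (intro integrable_norm locally_integrableD[OF u] compact_cbox)
      show "AE x in lebesgue. norm (box_bump a b n x *\<^sub>R u x) \<le> norm (indicator (cbox a b) x *\<^sub>R u x)" for n
      proof (intro always_eventually allI)
        fix x
        have "box_bump a b n x = 0" if "x \<notin> cbox a b"
          using test_function_box_bump[of a b n] that box_subset_cbox unfolding test_function_iff by blast
        then show "norm (box_bump a b n x *\<^sub>R u x) \<le> norm (indicator (cbox a b) x *\<^sub>R u x)"
          using box_bump_bounds[of a b n x] by (auto simp: indicator_def mult_left_le_one_le)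
      qed
      show "AE x in lebesgue. (\<lambda>n. box_bump a b n x *\<^sub>R u x) \<longlonglongrightarrow> indicator (box a b) x *\<^sub>R u x"
        by (intro always_eventually allI tendsto_scaleR box_bump_tendsto_indicator tendsto_const)
      show "(\<lambda>x. box_bump a b n x *\<^sub>R u x) \<in> borel_measurable lebesgue" for n
        by (rule borel_measurable_integrable[OF integrable_test_scaleR[OF u t]])
    qed (intro borel_measurable_scaleR borel_measurable_indicator locally_integrable_measurable[OF u], simp)
    then show ?thesis by (simp add: test[OF t] LIMSEQ_const_iff)
  qed
  let ?Q = "\<lambda>n. box (- (real n *\<^sub>R One)) (real n *\<^sub>R One) :: 'a set"
  have "AE x in lebesgue. indicator (?Q n) x *\<^sub>R u x = 0" for n
  proof (rule integral_box_eq_0_imp_AE_eq_0)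
    have "integrable lebesgue (\<lambda>x. indicator (cbox (- (real n *\<^sub>R One)) (real n *\<^sub>R One)) x *\<^sub>R u x)"
      by (intro locally_integrableD[OF u] compact_cbox)
    from integrable_mult_indicator[OF _ this, of "?Q n"]
    have "integrable lebesgue (\<lambda>x. indicator (?Q n) x *\<^sub>R indicator (cbox (- (real n *\<^sub>R One)) (real n *\<^sub>R One)) x *\<^sub>R u x)"
      by simp
    moreover have "(\<lambda>x. indicator (?Q n) x *\<^sub>R indicator (cbox (- (real n *\<^sub>R One)) (real n *\<^sub>R One)) x *\<^sub>R u x) =
        (\<lambda>x. indicator (?Q n) x *\<^sub>R u x)"
      by (rule ext) (use box_subset_cbox in \<open>auto simp: indicator_def\<close>)
    ultimately show "integrable lebesgue (\<lambda>x. indicator (?Q n) x *\<^sub>R u x)" by (simp only:)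
    show "(LINT x|lebesgue. indicator (?Q n) x *\<^sub>R u x) = 0" by (rule box)
    fix a b :: 'a
    have "(\<lambda>x. indicator (box a b) x *\<^sub>R indicator (?Q n) x *\<^sub>R u x) = (\<lambda>x. indicator (box a b \<inter> ?Q n) x *\<^sub>R u x)"
      by (simp add: indicator_inter_arith)
    then show "(LINT x|lebesgue. indicator (box a b) x *\<^sub>R indicator (?Q n) x *\<^sub>R u x) = 0"
      unfolding box_Int_box using box by (simp only:)
  qed
  then have "AE x in lebesgue. \<forall>n. indicator (?Q n) x *\<^sub>R u x = 0"
    unfolding AE_all_countable by blast
  then show ?thesis
  proof eventually_elim
    case (elim x)
    obtain N where N: "norm x < real N" using reals_Archimedean2 by blast
    have "x \<in> ?Q N"
      by (rule norm_less_imp_mem_box[OF N])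
    then show ?case using elim[rule_format, of N] by simp
  qed
qed

section \<open>Uniqueness of the curl measure\<close>

lemma sets_restrict_borel_eq_boxes:
  fixes D :: "'a::euclidean_space set"
  assumes D: "open D"
  shows "sets (restrict_space borel D) = sigma_sets D {X. \<exists>a b. X = box a b \<and> X \<subseteq> D}"
proof -
  let ?E = "{X. \<exists>a b. X = box a b \<and> X \<subseteq> D}"
  have "sets (restrict_space borel D) = (\<inter>) D ` sets borel"
    by (rule sets_restrict_space)
  also have "sets (borel :: 'a measure) = sigma_sets UNIV {S. open S}"
    unfolding borel_def by simp
  also have "(\<inter>) D ` sigma_sets UNIV {S. open S} = sigma_sets D ((\<inter>) D ` {S. open S})"
    by (rule sigma_sets_Int) (use D in auto)
  also have "\<dots> = sigma_sets D ?E"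
  proof (rule sigma_sets_eqI)
    fix T assume "T \<in> (\<inter>) D ` {S. open S}"
    then have T: "open T" "T \<subseteq> D" using D by auto
    from open_countable_Union_open_box[OF T(1)] obtain \<D> where
      \<D>: "countable \<D>" "\<D> \<subseteq> Pow T" "\<And>X. X \<in> \<D> \<Longrightarrow> \<exists>a b. X = box a b" "\<Union>\<D> = T"
      by blast
    have "\<Union>\<D> \<in> sigma_sets D ?E"
      using \<D>(1-3) T(2) by (intro sigma_sets_UNION sigma_sets.Basic) blast+
    then show "T \<in> sigma_sets D ?E" using \<D>(4) by simp
  next
    fix X assume "X \<in> ?E"
    then obtain a b where "X = box a b" "X \<subseteq> D" by blast
    then have "X = D \<inter> box a b" by blast
    then show "X \<in> sigma_sets D ((\<inter>) D ` {S. open S})"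
      by (intro sigma_sets.Basic) auto
  qed
  finally show ?thesis .
qed

text \<open>
  Equality of two differences \<open>P - N\<close> and \<open>P' - N'\<close> is equality of the positive measures \<open>P + N'\<close> and
  \<open>P' + N\<close>, to which uniqueness on a generator applies.
\<close>
definition sum_measure :: "'a measure \<Rightarrow> 'a measure \<Rightarrow> 'a measure" where
  "sum_measure M N = measure_of (space M) (sets M) (\<lambda>A. emeasure M A + emeasure N A)"

lemma
  assumes "sets N = sets M"
  shows sets_sum_measure: "sets (sum_measure M N) = sets M"
    and emeasure_sum_measure: "A \<in> sets M \<Longrightarrow> emeasure (sum_measure M N) A = emeasure M A + emeasure N A"
proof -
  show "sets (sum_measure M N) = sets M" unfolding sum_measure_def by simp
  assume A: "A \<in> sets M"
  show "emeasure (sum_measure M N) A = emeasure M A + emeasure N A"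
    unfolding sum_measure_def
  proof (rule emeasure_measure_of_sigma[OF sets.sigma_algebra_axioms _ _ A])
    show "positive (sets M) (\<lambda>A. emeasure M A + emeasure N A)" by (simp add: positive_def)
    show "countably_additive (sets M) (\<lambda>A. emeasure M A + emeasure N A)"
    proof (rule countably_additiveI)
      fix B :: "nat \<Rightarrow> 'a set" assume "range B \<subseteq> sets M" "disjoint_family B" "(\<Union>i. B i) \<in> sets M"
      then show "(\<Sum>i. emeasure M (B i) + emeasure N (B i)) = emeasure M (\<Union>i. B i) + emeasure N (\<Union>i. B i)"
        using assms by (simp add: suminf_add[symmetric] suminf_emeasure)
    qed
  qed
qed

lemma integral_box_bump_tendsto:
  assumes P: "finite_borel_measure_on D P" and sub: "box a b \<subseteq> D"
  shows "(\<lambda>n. \<integral>x. box_bump a b n x \<partial>P) \<longlonglongrightarrow> measure P (box a b)"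
proof -
  interpret finite_measure P using P by (simp add: finite_borel_measure_on_def)
  have sets: "sets P = sets (restrict_space borel D)" using P by (simp add: finite_borel_measure_on_def)
  have "box a b \<in> sets (restrict_space borel D)"
    unfolding sets_restrict_space using sub by (intro image_eqI[of _ _ "box a b"]) auto
  then have b: "box a b \<in> sets P" by (simp add: sets)
  have m: "box_bump a b n \<in> borel_measurable P" for n
  proof -
    have "box_bump a b n \<in> borel_measurable borel"
      by (intro borel_measurable_continuous_onI smooth_on_continuous test_function_smooth[OF test_function_box_bump])
    then show ?thesis
      using measurable_restrict_space1 measurable_cong_sets[OF sets refl] by blast
  qed
  have "(\<lambda>n. \<integral>x. box_bump a b n x \<partial>P) \<longlonglongrightarrow> (\<integral>x. indicator (box a b) x \<partial>P)"
    by (rule integral_dominated_convergence[where w="\<lambda>_. 1"])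
      (use b m box_bump_bounds[of a b] in \<open>auto intro: box_bump_tendsto_indicator\<close>)
  then show ?thesis
    using b sets.sets_into_space[OF b] by (simp add: Int_absorb2)
qed

text \<open>
  For a box inside \<open>D\<close> the integrals of its bumps converge to its measure, and the boxes
  inside \<open>D\<close> form a generator that is stable under intersection.
\<close>
lemma signed_measure_unique:
  fixes D :: "'a::euclidean_space set"
  assumes D: "open D" and PN: "signed_measure_diff D \<mu> P N" "signed_measure_diff D \<nu> P' N'"
    and eq: "\<And>\<phi> :: 'a \<Rightarrow> real. test_function D \<phi> \<Longrightarrow> (\<integral>x. \<phi> x \<partial>P) - (\<integral>x. \<phi> x \<partial>N) = (\<integral>x. \<phi> x \<partial>P') - (\<integral>x. \<phi> x \<partial>N')"
    and A: "A \<in> sets (restrict_space borel D)"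
  shows "\<mu> A = \<nu> A"
proof -
  let ?E = "{X. \<exists>a b. X = box a b \<and> X \<subseteq> D}"
  have fin: "finite_borel_measure_on D P" "finite_borel_measure_on D N"
      "finite_borel_measure_on D P'" "finite_borel_measure_on D N'"
    using PN by (simp_all add: signed_measure_diff_def)
  then have sets: "sets P = sets (restrict_space borel D)" "sets N = sets (restrict_space borel D)"
      "sets P' = sets (restrict_space borel D)" "sets N' = sets (restrict_space borel D)"
    by (simp_all add: finite_borel_measure_on_def)
  interpret P: finite_measure P using fin(1) by (simp add: finite_borel_measure_on_def)
  interpret N: finite_measure N using fin(2) by (simp add: finite_borel_measure_on_def)
  interpret P': finite_measure P' using fin(3) by (simp add: finite_borel_measure_on_def)
  interpret N': finite_measure N' using fin(4) by (simp add: finite_borel_measure_on_def)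
  note gen = sets_restrict_borel_eq_boxes[OF D]
  have em: "emeasure (sum_measure P N') B = ennreal (measure P B + measure N' B)"
      "emeasure (sum_measure P' N) B = ennreal (measure P' B + measure N B)"
    if "B \<in> sets (restrict_space borel D)" for B
    using that by (simp_all add: emeasure_sum_measure sets P.emeasure_eq_measure P'.emeasure_eq_measure
        N.emeasure_eq_measure N'.emeasure_eq_measure)
  have "sum_measure P N' = sum_measure P' N"
  proof -
    obtain \<D> where \<D>: "countable \<D>" "\<D> \<subseteq> Pow D" "\<And>X. X \<in> \<D> \<Longrightarrow> \<exists>a b. X = box a b" "\<Union>\<D> = D"
      using open_countable_Union_open_box[OF D] by blast
    have \<D>E: "\<D> \<subseteq> ?E" using \<D>(2,3) by blast
    have E_sets: "X \<in> sets (restrict_space borel D)" if "X \<in> ?E" for X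
      unfolding gen by (rule sigma_sets.Basic[OF that])
    show ?thesis
    proof (rule measure_eqI_generator_eq_countable[where E="?E" and \<Omega>=D, OF _ _ _ _ _ \<D>E \<D>(4,1)])
      show "Int_stable ?E"
      proof (rule Int_stableI)
        fix X Y assume "X \<in> ?E" "Y \<in> ?E"
        then obtain a b c d where ab: "X = box a b" "Y = box c d" "X \<subseteq> D" by auto
        have "X \<inter> Y \<subseteq> D" using ab(3) by blast
        then show "X \<inter> Y \<in> ?E" unfolding ab(1,2) box_Int_box by blast
      qed
      show "sets (sum_measure P N') = sigma_sets D ?E" "sets (sum_measure P' N) = sigma_sets D ?E"
        using gen by (simp_all add: sets_sum_measure sets)
      show "emeasure (sum_measure P N') X \<noteq> \<infinity>" if "X \<in> \<D>" for X
      proof -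
        have "X \<in> ?E" using that \<D>E by blast
        from em(1)[OF E_sets[OF this]] show ?thesis by (simp del: ennreal_plus)
      qed
      show "emeasure (sum_measure P N') X = emeasure (sum_measure P' N) X" if X: "X \<in> ?E" for X
      proof -
        obtain a b where ab: "X = box a b" "box a b \<subseteq> D" using X by blast
        have t: "test_function D (box_bump a b n)" for n
          by (rule test_function_mono[OF test_function_box_bump ab(2)])
        have "(\<integral>x. box_bump a b n x \<partial>P) + (\<integral>x. box_bump a b n x \<partial>N') =
              (\<integral>x. box_bump a b n x \<partial>P') + (\<integral>x. box_bump a b n x \<partial>N)" for n
          using eq[OF t[of n]] by linarith
        then have "(\<lambda>n. (\<integral>x. box_bump a b n x \<partial>P) + (\<integral>x. box_bump a b n x \<partial>N')) \<longlonglongrightarrow> measure P' X + measure N X"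
          using tendsto_add[OF integral_box_bump_tendsto[OF fin(3) ab(2)] integral_box_bump_tendsto[OF fin(2) ab(2)]]
          unfolding ab(1) by simp
        with tendsto_add[OF integral_box_bump_tendsto[OF fin(1) ab(2)] integral_box_bump_tendsto[OF fin(4) ab(2)]]
        have "measure P X + measure N' X = measure P' X + measure N X"
          unfolding ab(1) by (rule LIMSEQ_unique)
        then show ?thesis using em[OF E_sets[OF X]] by simp
      qed
    qed auto
  qed
  then have "ennreal (measure P A + measure N' A) = ennreal (measure P' A + measure N A)"
    using em[OF A] by simp
  then have "measure P A + measure N' A = measure P' A + measure N A"
    by (simp add: measure_nonneg flip: ennreal_plus)
  then show ?thesis
    using PN A by (simp add: signed_measure_diff_def)
qed

abbreviation curl_pairing :: "(real^3) set \<Rightarrow> (real^3 \<Rightarrow> real^2) \<Rightarrow> (real^3 \<Rightarrow> real) \<Rightarrow> real" where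
  "curl_pairing D v \<phi> \<equiv> (LINT x|lebesgue_on D. v x $ 1 * pderiv_at 2 \<phi> x - v x $ 2 * pderiv_at 1 \<phi> x)"

lemma has_curl_measure_unique:
  assumes "open D" "has_curl_measure D v \<mu>" "has_curl_measure D v \<nu>" "A \<in> sets (restrict_space borel D)"
  shows "\<mu> A = \<nu> A"
proof -
  obtain P N where P: "signed_measure_diff D \<mu> P N" "\<And>\<phi>. test_function D \<phi> \<Longrightarrow>
        (\<integral>x. \<phi> x \<partial>P) - (\<integral>x. \<phi> x \<partial>N) =
        curl_pairing D v \<phi>"
    using assms(2) unfolding has_curl_measure_def by blast
  obtain P' N' where P': "signed_measure_diff D \<nu> P' N'" "\<And>\<phi>. test_function D \<phi> \<Longrightarrow>
        (\<integral>x. \<phi> x \<partial>P') - (\<integral>x. \<phi> x \<partial>N') =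
        curl_pairing D v \<phi>"
    using assms(3) unfolding has_curl_measure_def by blast
  show ?thesis
    by (rule signed_measure_unique[OF assms(1) P(1) P'(1) _ assms(4)]) (rule trans[OF P(2) P'(2)[symmetric]])
qed

lemma has_curl_measure_curl_measure:
  "has_curl_measure D v \<mu> \<Longrightarrow> has_curl_measure D v (curl_measure D v)"
  unfolding curl_measure_def by (rule someI[of "has_curl_measure D v"])

text \<open>
  Since the predicates themselves agree, so do the measures chosen from them.
\<close>
lemma curl_measure_cong:
  assumes "\<And>\<phi>. test_function D \<phi> \<Longrightarrow>
    curl_pairing D v \<phi> =
    curl_pairing D w \<phi>"
  shows "has_curl_measure D v = has_curl_measure D w" "curl_measure D v = curl_measure D w"
proof -
  show *: "has_curl_measure D v = has_curl_measure D w"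
    unfolding has_curl_measure_def using assms by (intro ext) simp
  show "curl_measure D v = curl_measure D w"
    unfolding curl_measure_def * ..
qed

section \<open>Scaling of the total variation\<close>

abbreviation borel_partitions :: "'a::euclidean_space set \<Rightarrow> (nat \<Rightarrow> 'a set) set" where
  "borel_partitions D \<equiv> {E. disjoint_family E \<and> (\<forall>i. E i \<in> sets (restrict_space borel D)) \<and> (\<Union>i. E i) = D}"

lemma total_variation_cong:
  assumes "\<And>A. A \<in> sets (restrict_space borel D) \<Longrightarrow> \<mu> A = \<nu> A"
  shows "total_variation D \<mu> = total_variation D \<nu>"
  unfolding total_variation_def using assms by (intro SUP_cong refl) simp

text \<open>
  The sums in the definition of the total variation converge and are bounded; otherwise the supremum
  over reals would be unspecified.
\<close>
lemma signed_measure_partition: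
  assumes \<mu>: "signed_measure_diff D \<mu> P N" and E: "E \<in> borel_partitions D"
  shows "summable (\<lambda>i. \<bar>\<mu> (E i)\<bar>)" "(\<Sum>i. \<bar>\<mu> (E i)\<bar>) \<le> measure P D + measure N D"
proof -
  have fin: "finite_borel_measure_on D P" "finite_borel_measure_on D N"
    using \<mu> by (simp_all add: signed_measure_diff_def)
  have sums: "(\<lambda>i. measure M (E i)) sums measure M D" if "finite_borel_measure_on D M" for M
  proof -
    interpret finite_measure M using that by (simp add: finite_borel_measure_on_def)
    have "sets M = sets (restrict_space borel D)" using that by (simp add: finite_borel_measure_on_def)
    then show ?thesis
      using finite_measure_UNION[of E] E by auto
  qed
  note s = sums_add[OF sums[OF fin(1)] sums[OF fin(2)]]
  have le: "norm \<bar>\<mu> (E i)\<bar> \<le> measure P (E i) + measure N (E i)" for i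
  proof -
    have "\<mu> (E i) = measure P (E i) - measure N (E i)"
      using \<mu> E by (auto simp: signed_measure_diff_def)
    then show ?thesis using measure_nonneg[of P "E i"] measure_nonneg[of N "E i"] by (simp add: abs_le_iff)
  qed
  show *: "summable (\<lambda>i. \<bar>\<mu> (E i)\<bar>)"
    by (rule summable_comparison_test'[OF sums_summable[OF s] le])
  show "(\<Sum>i. \<bar>\<mu> (E i)\<bar>) \<le> measure P D + measure N D"
    using suminf_le[OF _ * sums_summable[OF s]] le sums_unique[OF s] by simp
qed

lemma total_variation_scale_le:
  assumes \<mu>: "signed_measure_diff D \<mu> P N" and c: "c > 0"
  shows "total_variation D (\<lambda>A. c * \<mu> A) \<le> c * total_variation D \<mu>"
proof -
  have "(\<lambda>i::nat. if i = 0 then D else {}) \<in> borel_partitions D"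
    by (auto simp: disjoint_family_on_def sets_restrict_space split: if_splits intro: image_eqI[of _ _ UNIV] image_eqI[of _ _ "{}"])
  then have ne: "borel_partitions D \<noteq> {}" by blast
  show ?thesis
    unfolding total_variation_def
  proof (rule cSUP_least[OF ne])
    fix E assume E: "E \<in> borel_partitions D"
    have "(\<Sum>i. \<bar>c * \<mu> (E i)\<bar>) = c * (\<Sum>i. \<bar>\<mu> (E i)\<bar>)"
      using c by (simp add: abs_mult suminf_mult[OF signed_measure_partition(1)[OF \<mu> E]])
    also have "\<dots> \<le> c * (SUP E\<in>borel_partitions D. \<Sum>i. \<bar>\<mu> (E i)\<bar>)"
    proof (intro mult_left_mono cSUP_upper E)
      show "bdd_above ((\<lambda>E. \<Sum>i. \<bar>\<mu> (E i)\<bar>) ` borel_partitions D)"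
        using signed_measure_partition(2)[OF \<mu>] by (intro bdd_aboveI[of _ "measure P D + measure N D"]) blast
    qed (use c in simp)
    finally show "(\<Sum>i. \<bar>c * \<mu> (E i)\<bar>) \<le> c * (SUP E\<in>borel_partitions D. \<Sum>i. \<bar>\<mu> (E i)\<bar>)" .
  qed
qed

lemma has_curl_measure_scale:
  assumes v: "has_curl_measure D v \<mu>" and c: "c > 0"
  shows "has_curl_measure D (\<lambda>x. c *\<^sub>R v x) (\<lambda>A. c * \<mu> A)"
proof -
  obtain P N where P: "signed_measure_diff D \<mu> P N" "\<And>\<phi>. test_function D \<phi> \<Longrightarrow>
        (\<integral>x. \<phi> x \<partial>P) - (\<integral>x. \<phi> x \<partial>N) =
        curl_pairing D v \<phi>"
    using v unfolding has_curl_measure_def by blast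
  define S where "S M = density M (\<lambda>_. ennreal c)" for M :: "(real^3) measure"
  have S: "finite_borel_measure_on D (S M)" "A \<in> sets (restrict_space borel D) \<Longrightarrow> measure (S M) A = c * measure M A"
      "test_function D \<phi> \<Longrightarrow> (\<integral>x. \<phi> x \<partial>S M) = c * (\<integral>x. \<phi> x \<partial>M)"
    if M: "finite_borel_measure_on D M" for M A and \<phi> :: "real^3 \<Rightarrow> real"
  proof -
    interpret finite_measure M using M by (simp add: finite_borel_measure_on_def)
    have sets: "sets M = sets (restrict_space borel D)" using M by (simp add: finite_borel_measure_on_def)
    have em: "emeasure (S M) A = ennreal c * emeasure M A" if "A \<in> sets M" for A
      unfolding S_def by (rule emeasure_density_const[OF that])
    show "finite_borel_measure_on D (S M)"
      unfolding finite_borel_measure_on_def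
    proof (intro conjI finite_measureI)
      have "space (S M) = space M" by (simp add: S_def)
      then show "emeasure (S M) (space (S M)) \<noteq> \<infinity>"
        by (simp add: em[OF sets.top] ennreal_mult_eq_top_iff)
    qed (simp add: S_def sets)
    show "A \<in> sets (restrict_space borel D) \<Longrightarrow> measure (S M) A = c * measure M A"
      using em[of A] c by (simp add: measure_def sets enn2real_mult)
    assume "test_function D \<phi>"
    then have "\<phi> \<in> borel_measurable borel"
      by (intro borel_measurable_continuous_onI smooth_on_continuous test_function_smooth)
    then have "\<phi> \<in> borel_measurable M"
      using measurable_restrict_space1 measurable_cong_sets[OF sets refl] by blast
    then show "(\<integral>x. \<phi> x \<partial>S M) = c * (\<integral>x. \<phi> x \<partial>M)"
      unfolding S_def using c by (subst integral_density) auto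
  qed
  have fin: "finite_borel_measure_on D P" "finite_borel_measure_on D N"
    using P(1) by (simp_all add: signed_measure_diff_def)
  show ?thesis
    unfolding has_curl_measure_def
  proof (rule exI[of _ "S P"], rule exI[of _ "S N"], intro conjI allI impI)
    show "signed_measure_diff D (\<lambda>A. c * \<mu> A) (S P) (S N)"
      using P(1) S[OF fin(1)] S[OF fin(2)] by (simp add: signed_measure_diff_def right_diff_distrib)
    fix \<phi> :: "real^3 \<Rightarrow> real" assume t: "test_function D \<phi>"
    have "(\<integral>x. \<phi> x \<partial>S P) - (\<integral>x. \<phi> x \<partial>S N) = c * ((\<integral>x. \<phi> x \<partial>P) - (\<integral>x. \<phi> x \<partial>N))"
      using S(3)[OF fin(1) t] S(3)[OF fin(2) t] by (simp add: right_diff_distrib)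
    also have "\<dots> = (LINT x|lebesgue_on D. c * (v x $ 1 * pderiv_at 2 \<phi> x - v x $ 2 * pderiv_at 1 \<phi> x))"
      unfolding P(2)[OF t] by simp
    finally show "(\<integral>x. \<phi> x \<partial>S P) - (\<integral>x. \<phi> x \<partial>S N) =
        (LINT x|lebesgue_on D. (c *\<^sub>R v x) $ 1 * pderiv_at 2 \<phi> x - (c *\<^sub>R v x) $ 2 * pderiv_at 1 \<phi> x)"
      by (simp add: right_diff_distrib mult.assoc)
  qed
qed

text \<open>
  One inequality suffices: the reverse one is the same inequality for the factor \<open>1 / c\<close>.
\<close>
lemma total_variation_curl_measure_scale:
  assumes D: "open D" and v: "has_curl_measure D v \<mu>" and c: "c > 0"
  shows "total_variation D (curl_measure D (\<lambda>x. c *\<^sub>R v x)) = c * total_variation D (curl_measure D v)"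
proof -
  have le: "total_variation D (curl_measure D (\<lambda>x. c *\<^sub>R v x)) \<le> c * total_variation D (curl_measure D v)"
    if v: "has_curl_measure D v \<mu>" and c: "c > 0" for v \<mu> c
  proof -
    note cv = has_curl_measure_curl_measure[OF v]
    obtain P N where "signed_measure_diff D (curl_measure D v) P N"
      using cv unfolding has_curl_measure_def by blast
    from total_variation_scale_le[OF this c]
    have "total_variation D (\<lambda>A. c * curl_measure D v A) \<le> c * total_variation D (curl_measure D v)" .
    moreover have "total_variation D (curl_measure D (\<lambda>x. c *\<^sub>R v x)) = total_variation D (\<lambda>A. c * curl_measure D v A)"
      by (rule total_variation_cong)
        (rule has_curl_measure_unique[OF D has_curl_measure_curl_measure has_curl_measure_scale[OF cv c]], rule has_curl_measure_scale[OF cv c])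
    ultimately show ?thesis by simp
  qed
  have "total_variation D (curl_measure D v) \<le> (1 / c) * total_variation D (curl_measure D (\<lambda>x. c *\<^sub>R v x))"
    using le[OF has_curl_measure_scale[OF v c], of "1 / c"] c by simp
  then show ?thesis
    using le[OF v c] c by (simp add: field_simps)
qed

section \<open>Convolution with compactly supported kernels\<close>

text \<open>
  Only the second factor will be smooth; the kernel \<open>k\<close> is merely continuous with compact support.
\<close>
definition conv :: "('a::euclidean_space \<Rightarrow> real) \<Rightarrow> ('a \<Rightarrow> 'b::euclidean_space) \<Rightarrow> 'a \<Rightarrow> 'b" where
  "conv k \<phi> x = (LINT y|lborel. k y *\<^sub>R \<phi> (x - y))"

lemma integrable_conv:
  fixes \<phi> :: "'a::euclidean_space \<Rightarrow> 'b::euclidean_space"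
  assumes "continuous_on UNIV k" "compact K" "\<forall>y. y \<notin> K \<longrightarrow> k y = 0" "continuous_on UNIV \<phi>"
  shows "integrable lborel (\<lambda>y. k y *\<^sub>R \<phi> (x - y))"
  by (rule integrable_continuous_compact_support[OF _ assms(2)])
    (auto intro!: continuous_intros assms(1) continuous_on_compose2[OF assms(4)] simp: assms(3))

lemma conv_eq_integral_cbox:
  fixes \<phi> :: "'a::euclidean_space \<Rightarrow> 'b::euclidean_space"
  assumes "continuous_on UNIV k" "\<forall>y. y \<notin> cbox a b \<longrightarrow> k y = 0" "continuous_on UNIV \<phi>"
  shows "conv k \<phi> x = integral (cbox a b) (\<lambda>y. k y *\<^sub>R \<phi> (x - y))"
proof -
  have eq: "(\<lambda>y. indicator (cbox a b) y *\<^sub>R (k y *\<^sub>R \<phi> (x - y))) = (\<lambda>y. k y *\<^sub>R \<phi> (x - y))"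
    using assms(2) by (auto simp: indicator_def fun_eq_iff)
  have "set_integrable lborel (cbox a b) (\<lambda>y. k y *\<^sub>R \<phi> (x - y))"
    unfolding set_integrable_def eq by (rule integrable_conv[OF assms(1) compact_cbox assms(2,3)])
  from set_borel_integral_eq_integral(2)[OF this] show ?thesis
    unfolding conv_def set_lebesgue_integral_def eq .
qed

text \<open>
  All derivatives fall on \<open>\<phi>\<close>, so a continuous kernel is enough.
  Differentiation under the integral sign applies because the integral is effectively one over a box.
\<close>
lemma conv_has_derivative:
  fixes \<phi> :: "'a::euclidean_space \<Rightarrow> 'b::euclidean_space"
  assumes k: "continuous_on UNIV k" "\<forall>y. y \<notin> cbox a b \<longrightarrow> k y = 0" and \<phi>: "smooth_on UNIV \<phi>"
  shows "(conv k \<phi> has_derivative (\<lambda>v. conv k (\<lambda>x. frechet_derivative \<phi> (at x) v) x)) (at x)"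
proof -
  let ?d = "\<lambda>x. frechet_derivative \<phi> (at x)"
  note d = smooth_on_has_derivative[OF \<phi>]
  note cont = smooth_on_continuous[OF \<phi>]
  have contd: "continuous_on UNIV (\<lambda>x. ?d x v)" for v
    by (rule smooth_on_continuous[OF smooth_on_frechet[OF \<phi>]])
  define F where "F x t = k t *\<^sub>R Blinfun (?d (x - t))" for x t
  have F: "blinfun_apply (F x t) v = k t *\<^sub>R ?d (x - t) v" for x t v
    unfolding F_def by (simp add: blinfun.scaleR_left bounded_linear_Blinfun_apply has_derivative_bounded_linear[OF d])
  have contF: "continuous_on S (\<lambda>p. F (fst p) (snd p))" for S
  proof (rule continuous_on_blinfun_componentwise)
    fix i :: 'a
    show "continuous_on S (\<lambda>p. F (fst p) (snd p) i)"
      unfolding F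
      by (intro continuous_on_scaleR continuous_on_compose2[OF k(1)] continuous_on_compose2[OF contd] continuous_intros) auto
  qed
  have "((\<lambda>x. integral (cbox a b) (\<lambda>t. k t *\<^sub>R \<phi> (x - t))) has_derivative integral (cbox a b) (F x)) (at x within UNIV)"
  proof (rule leibniz_rule)
    fix x t :: 'a
    have "((\<lambda>x. x - t) has_derivative (\<lambda>v. v)) (at x)" by (auto intro!: derivative_eq_intros)
    from has_derivative_compose[OF this d]
    have "((\<lambda>x. \<phi> (x - t)) has_derivative ?d (x - t)) (at x)" by simp
    from has_derivative_scaleR_right[OF this, of "k t"]
    show "((\<lambda>x. k t *\<^sub>R \<phi> (x - t)) has_derivative blinfun_apply (F x t)) (at x within UNIV)"
      unfolding F[abs_def] by simp
    show "(\<lambda>t. k t *\<^sub>R \<phi> (x - t)) integrable_on cbox a b"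
      by (intro integrable_continuous continuous_on_scaleR continuous_on_subset[OF k(1)] continuous_on_compose2[OF cont] continuous_intros) auto
    show "continuous_on (UNIV \<times> cbox a b) (\<lambda>(x, t). F x t)"
      using contF by (simp add: case_prod_unfold)
  qed auto
  moreover have "blinfun_apply (integral (cbox a b) (F x)) v = conv k (\<lambda>x. ?d x v) x" for v
  proof -
    have "continuous_on (cbox a b) (\<lambda>t. (x, t))" by (intro continuous_intros)
    from continuous_on_compose2[OF contF[of UNIV] this] have "continuous_on (cbox a b) (F x)" by simp
    then have "F x integrable_on cbox a b" by (rule integrable_continuous)
    from integral_linear[OF this blinfun.bounded_linear_left[of v]]
    show ?thesis
      by (simp add: o_def F conv_eq_integral_cbox[OF k contd])
  qed
  then have "blinfun_apply (integral (cbox a b) (F x)) = (\<lambda>v. conv k (\<lambda>x. ?d x v) x)" by blast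
  moreover have "conv k \<phi> = (\<lambda>x. integral (cbox a b) (\<lambda>t. k t *\<^sub>R \<phi> (x - t)))"
    by (intro ext conv_eq_integral_cbox[OF k cont])
  ultimately show ?thesis by simp
qed

lemma smooth_on_conv:
  fixes \<phi> :: "'a::euclidean_space \<Rightarrow> 'b::euclidean_space"
  assumes k: "continuous_on UNIV k" "\<forall>y. y \<notin> cbox a b \<longrightarrow> k y = 0" and \<phi>: "smooth_on UNIV \<phi>"
  shows "smooth_on UNIV (conv k \<phi>)"
proof -
  have "Ck_on n UNIV (conv k \<phi>)" for n
    using \<phi>
  proof (induction n arbitrary: \<phi>)
    case 0
    have "conv k \<phi> differentiable_on UNIV"
      using conv_has_derivative[OF k 0] by (auto simp: differentiable_on_UNIV_iff differentiable_def)
    then show ?case by (simp add: differentiable_imp_continuous_on)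
  next
    case (Suc n)
    show ?case
      by (rule Ck_on_Suc_has_derivative[OF conv_has_derivative[OF k Suc.prems]])
        (rule Suc.IH[OF smooth_on_frechet[OF Suc.prems]])
  qed
  then show ?thesis by (simp add: smooth_on_def)
qed

lemma pderiv_at_conv:
  fixes \<phi> :: "real^'n \<Rightarrow> 'b::euclidean_space"
  assumes k: "continuous_on UNIV k" "\<forall>y. y \<notin> cbox a b \<longrightarrow> k y = 0" and \<phi>: "smooth_on UNIV \<phi>"
  shows "pderiv_at i (conv k \<phi>) x = conv k (pderiv_at i \<phi>) x"
  using pderiv_at_eqI[OF conv_has_derivative[OF k \<phi>]] by (simp add: pderiv_at_def[abs_def])

lemma conv_eq_0:
  assumes "\<forall>y. y \<notin> K \<longrightarrow> k y = 0" "\<forall>y. y \<notin> L \<longrightarrow> \<phi> y = 0" "x \<notin> {a + b |a b. a \<in> K \<and> b \<in> L}"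
  shows "conv k \<phi> x = 0"
proof -
  have zero: "k y *\<^sub>R \<phi> (x - y) = 0" for y
  proof (rule ccontr)
    assume "k y *\<^sub>R \<phi> (x - y) \<noteq> 0"
    then have "y \<in> K" "x - y \<in> L" using assms(1,2) by fastforce+
    then have "y + (x - y) \<in> {a + b |a b. a \<in> K \<and> b \<in> L}" by blast
    then show False using assms(3) by simp
  qed
  show ?thesis unfolding conv_def zero by simp
qed

lemma test_function_conv:
  fixes \<phi> :: "'a::euclidean_space \<Rightarrow> 'b::euclidean_space"
  assumes k: "continuous_on UNIV k" "\<forall>y. y \<notin> cbox a b \<longrightarrow> k y = 0" and \<phi>: "test_function UNIV \<phi>"
  shows "test_function UNIV (conv k \<phi>)"
proof -
  obtain L where L: "smooth_on UNIV \<phi>" "compact L" "\<forall>y. y \<notin> L \<longrightarrow> \<phi> y = 0"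
    using \<phi> unfolding test_function_iff by blast
  show ?thesis
    by (rule test_functionI[OF smooth_on_conv[OF k L(1)] compact_sums[OF compact_cbox L(2)] subset_UNIV conv_eq_0[OF k(2) L(3)]])
qed

lemma conv_linear:
  fixes \<phi> :: "'a::euclidean_space \<Rightarrow> 'b::euclidean_space" and h :: "'b \<Rightarrow> 'c::euclidean_space"
  assumes "continuous_on UNIV k" "compact K" "\<forall>y. y \<notin> K \<longrightarrow> k y = 0" "continuous_on UNIV \<phi>" and h: "bounded_linear h"
  shows "conv k (\<lambda>x. h (\<phi> x)) x = h (conv k \<phi> x)"
proof -
  have "conv k (\<lambda>x. h (\<phi> x)) x = (LINT y|lborel. h (k y *\<^sub>R \<phi> (x - y)))"
    by (simp add: conv_def linear_scale[OF bounded_linear.linear[OF h]])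
  also have "\<dots> = h (conv k \<phi> x)"
    unfolding conv_def by (rule integral_bounded_linear[OF h integrable_conv[OF assms(1-4)]])
  finally show ?thesis .
qed

lemma curl3_conv:
  assumes k: "continuous_on UNIV k" "\<forall>y. y \<notin> cbox a b \<longrightarrow> k y = 0" and \<phi>: "smooth_on UNIV \<phi>"
  shows "curl3 (conv k \<phi>) x = conv k (curl3 \<phi>) x"
proof -
  have nth: "conv k \<psi> x $ j = conv k (\<lambda>x. \<psi> x $ j) x" if "smooth_on UNIV \<psi>" for \<psi> :: "real^3 \<Rightarrow> real^3" and j
    by (rule conv_linear[OF k(1) compact_cbox k(2) smooth_on_continuous[OF that] bounded_linear_vec_nth, symmetric])
  have diff: "conv k (\<lambda>x. f x - g x) x = conv k f x - conv k g x" if "smooth_on UNIV f" "smooth_on UNIV g" for f g :: "real^3 \<Rightarrow> real"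
    using integrable_conv[OF k(1) compact_cbox k(2) smooth_on_continuous[OF that(1)]]
      integrable_conv[OF k(1) compact_cbox k(2) smooth_on_continuous[OF that(2)]]
    by (simp add: conv_def right_diff_distrib)
  show ?thesis
    by (simp add: vec_eq_iff forall_3 nth[OF smooth_on_curl3[OF \<phi>]] pderiv_at_conv[OF k \<phi>] nth[OF smooth_on_pderiv[OF \<phi>]]
        diff smooth_on_nth smooth_on_pderiv \<phi>)
qed

section \<open>A compactly supported kernel whose Laplacian is a difference of bumps\<close>

text \<open>
  As a function of \<open>y\<close>, \<open>profile (\<bar>y\<bar>\<^sup>2)\<close> is the Newtonian potential \<open>1 / \<bar>y\<bar>\<close> outside the unit ball, continued
  inside by a polynomial. Its coefficients are determined by matching the value \<open>1\<close> and the derivatives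
  \<open>- 1 / 2\<close> and \<open>3 / 4\<close> of \<open>1 / sqrt s\<close> at \<open>s = 1\<close>, which makes the result twice continuously differentiable.
\<close>
definition profile :: "real \<Rightarrow> real" where
  "profile s = (if s \<le> 1 then 15 / 8 - 5 / 4 * s + 3 / 8 * s\<^sup>2 else 1 / sqrt s)"

definition profile' :: "real \<Rightarrow> real" where
  "profile' s = (if s \<le> 1 then - 5 / 4 + 3 / 4 * s else - 1 / (2 * s * sqrt s))"

definition profile'' :: "real \<Rightarrow> real" where
  "profile'' s = (if s \<le> 1 then 3 / 4 else 3 / (4 * s\<^sup>2 * sqrt s))"

lemma DERIV_glue:
  fixes f g :: "real \<Rightarrow> real"
  assumes f: "\<And>s. s \<le> c \<Longrightarrow> (f has_real_derivative f' s) (at s)"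
    and g: "\<And>s. s \<ge> c \<Longrightarrow> (g has_real_derivative g' s) (at s)"
    and eq: "f c = g c" "f' c = g' c"
  shows "((\<lambda>s. if s \<le> c then f s else g s) has_real_derivative (if s \<le> c then f' s else g' s)) (at s)"
proof (cases s c rule: linorder_cases)
  case less
  show ?thesis
    by (rule has_field_derivative_transform_within_open[where S="{..<c}" and f=f]) (use less f[of s] in auto)
next
  case greater
  show ?thesis
    by (rule has_field_derivative_transform_within_open[where S="{c<..}" and f=g]) (use greater g[of s] in auto)
next
  case equal
  let ?h = "\<lambda>s. if s \<le> c then f s else g s"
  have "((\<lambda>y. (?h y - ?h c) / (y - c)) \<longlongrightarrow> f' c) (at c)"
  proof (rule filterlim_split_at)
    have "((\<lambda>y. (f y - f c) / (y - c)) \<longlongrightarrow> f' c) (at c within {..<c})"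
      using has_field_derivative_at_within[OF f[of c]] by (simp add: has_field_derivative_iff)
    then show "((\<lambda>y. (?h y - ?h c) / (y - c)) \<longlongrightarrow> f' c) (at_left c)"
      by (rule Lim_transform_eventually) (auto simp: eventually_at_filter)
    have "((\<lambda>y. (g y - g c) / (y - c)) \<longlongrightarrow> g' c) (at c within {c<..})"
      using has_field_derivative_at_within[OF g[of c]] by (simp add: has_field_derivative_iff)
    then show "((\<lambda>y. (?h y - ?h c) / (y - c)) \<longlongrightarrow> f' c) (at_right c)"
      unfolding eq(2) by (rule Lim_transform_eventually) (auto simp: eventually_at_filter eq(1))
  qed
  then show ?thesis using equal by (simp add: has_field_derivative_iff)
qed

lemma DERIV_profile: "(profile has_real_derivative profile' s) (at s)"
  unfolding profile_def[abs_def] profile'_def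
proof (rule DERIV_glue)
  show "((\<lambda>s. 15 / 8 - 5 / 4 * s + 3 / 8 * s\<^sup>2) has_real_derivative - 5 / 4 + 3 / 4 * s) (at s)" for s :: real
    by (auto intro!: derivative_eq_intros)
  show "((\<lambda>s. 1 / sqrt s) has_real_derivative - 1 / (2 * s * sqrt s)) (at s)" if "1 \<le> s" for s
    using that by (auto intro!: derivative_eq_intros simp: field_simps power2_eq_square)
qed (simp_all)

lemma DERIV_profile': "(profile' has_real_derivative profile'' s) (at s)"
  unfolding profile'_def[abs_def] profile''_def
proof (rule DERIV_glue)
  show "((\<lambda>s. - 5 / 4 + 3 / 4 * s) has_real_derivative 3 / 4) (at s)" for s :: real
    by (auto intro!: derivative_eq_intros)
  show "((\<lambda>s. - 1 / (2 * s * sqrt s)) has_real_derivative 3 / (4 * s\<^sup>2 * sqrt s)) (at s)" if "1 \<le> s" for s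
  proof -
    have r: "s = sqrt s * sqrt s" "sqrt s > 0" using that by simp_all
    show ?thesis
      using that r(2) by (auto intro!: derivative_eq_intros simp: field_simps power2_eq_square)
  qed
qed (simp_all)

lemma continuous_profile'': "continuous_on UNIV profile''"
proof -
  have "continuous_on ({..1} \<union> {1..}) (\<lambda>s. if s \<le> 1 then 3 / 4 else 3 / (4 * s\<^sup>2 * sqrt s) :: real)"
    by (rule continuous_on_If) (auto intro!: continuous_intros)
  moreover have "{..1} \<union> {1..} = (UNIV :: real set)" by auto
  ultimately show ?thesis by (simp add: profile''_def[abs_def])
qed

text \<open>
  For a function \<open>p (\<bar>y\<bar>\<^sup>2)\<close> on three-space, half of the Laplacian is \<open>3 p' + 2 s p''\<close> at \<open>s = \<bar>y\<bar>\<^sup>2\<close>. It vanishes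
  outside the unit ball, where the potential is harmonic, and is a multiple of \<open>1 - s\<close> inside.
\<close>
lemma profile_laplacian: "3 * profile' s + 2 * s * profile'' s = - 15 / 4 * max 0 (1 - s)"
proof (cases "s \<le> 1")
  case False
  then have "s > 0" by simp
  then show ?thesis using False by (simp add: profile'_def profile''_def field_simps power2_eq_square)
qed (simp add: profile'_def profile''_def max_def field_simps)

definition potential :: "real \<Rightarrow> real^3 \<Rightarrow> real" where
  "potential R y = profile (y \<bullet> y / R\<^sup>2) / R"

definition bump :: "real \<Rightarrow> real^3 \<Rightarrow> real" where
  "bump R y = max 0 (1 - y \<bullet> y / R\<^sup>2) / R ^ 3"

lemma has_derivative_profile_norm:
  fixes y :: "'a::euclidean_space"
  assumes "(p has_real_derivative p') (at (y \<bullet> y / c))"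
  shows "((\<lambda>y. p (y \<bullet> y / c)) has_derivative (\<lambda>v. p' * (2 * (y \<bullet> v) / c))) (at y)"
proof -
  have q: "((\<lambda>y. y \<bullet> y / c) has_derivative (\<lambda>v. 2 * (y \<bullet> v) / c)) (at y)"
    by (auto intro!: derivative_eq_intros simp: inner_commute divide_inverse algebra_simps)
  show ?thesis
    using has_derivative_compose[OF q assms[unfolded has_field_derivative_def]] by simp
qed

lemma potential_derivative:
  "((potential R) has_derivative (\<lambda>v. 2 / R ^ 3 * profile' (y \<bullet> y / R\<^sup>2) * (y \<bullet> v))) (at y)"
proof -
  have "((\<lambda>y. profile (y \<bullet> y / R\<^sup>2) / R) has_derivative (\<lambda>v. profile' (y \<bullet> y / R\<^sup>2) * (2 * (y \<bullet> v) / R\<^sup>2) / R)) (at y)"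
    using has_derivative_divide'[OF has_derivative_profile_norm[OF DERIV_profile]] 
      bounded_linear.has_derivative[OF bounded_linear_divide has_derivative_profile_norm[OF DERIV_profile]] by blast
  then show ?thesis
    by (simp add: potential_def[abs_def] power2_eq_square power3_eq_cube field_simps)
qed

lemma pderiv_potential: "pderiv_at i (potential R) y = 2 / R ^ 3 * profile' (y \<bullet> y / R\<^sup>2) * y $ i"
  using pderiv_at_eqI[OF potential_derivative] by (simp add: inner_axis)

lemma pderiv_potential_derivative:
  "(pderiv_at i (potential R) has_derivative
    (\<lambda>v. 2 / R ^ 3 * (profile' (y \<bullet> y / R\<^sup>2) * v $ i + profile'' (y \<bullet> y / R\<^sup>2) * (2 * (y \<bullet> v) / R\<^sup>2) * y $ i))) (at y)"
proof -
  have "((\<lambda>y. 2 / R ^ 3 * (profile' (y \<bullet> y / R\<^sup>2) * y $ i)) has_derivative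
    (\<lambda>v. 2 / R ^ 3 * (profile' (y \<bullet> y / R\<^sup>2) * v $ i + profile'' (y \<bullet> y / R\<^sup>2) * (2 * (y \<bullet> v) / R\<^sup>2) * y $ i))) (at y)"
    by (intro has_derivative_mult_right has_derivative_mult has_derivative_profile_norm DERIV_profile'
        bounded_linear_imp_has_derivative bounded_linear_vec_nth)
  moreover have "pderiv_at i (potential R) = (\<lambda>y. 2 / R ^ 3 * (profile' (y \<bullet> y / R\<^sup>2) * y $ i))"
    by (simp add: fun_eq_iff pderiv_potential)
  ultimately show ?thesis by simp
qed

lemma pderiv_pderiv_potential:
  "pderiv_at i (pderiv_at i (potential R)) y =
    2 / R ^ 3 * (profile' (y \<bullet> y / R\<^sup>2) + profile'' (y \<bullet> y / R\<^sup>2) * (2 / R\<^sup>2) * (y $ i * y $ i))"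
  using pderiv_at_eqI[OF pderiv_potential_derivative] by (simp add: inner_axis)

lemma laplacian_potential: "laplacian (potential R) y = - (15 / 2) * bump R y"
proof -
  let ?s = "y \<bullet> y / R\<^sup>2"
  have *: "(\<Sum>i\<in>UNIV. c * (A + B * d * q i)) = c * (3 * A + B * d * (\<Sum>i\<in>UNIV. q i))"
    for c A B d :: real and q :: "3 \<Rightarrow> real"
    by (simp add: sum_3 algebra_simps)
  have "laplacian (potential R) y = 2 / R ^ 3 * (3 * profile' ?s + profile'' ?s * (2 / R\<^sup>2) * (y \<bullet> y))"
    unfolding laplacian_def pderiv_pderiv_potential * by (simp only: inner_vec_def[of y y] inner_real_def)
  also have "\<dots> = 2 / R ^ 3 * (3 * profile' ?s + 2 * ?s * profile'' ?s)" by (simp add: mult.commute)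
  also have "\<dots> = - (15 / 2) * bump R y" unfolding profile_laplacian bump_def by simp
  finally show ?thesis .
qed

lemma continuous_profile_norm:
  "continuous_on UNIV p \<Longrightarrow> continuous_on UNIV (\<lambda>y::'a::euclidean_space. p (y \<bullet> y / c :: real) :: real)"
  by (erule continuous_on_compose2) (auto intro!: continuous_intros simp: divide_inverse)

lemma potential_eq:
  assumes "R > 0" "norm y > R"
  shows "potential R y = 1 / norm y"
proof -
  have "R\<^sup>2 < (norm y)\<^sup>2" using assms by (intro power_strict_mono) auto
  then have "y \<bullet> y / R\<^sup>2 > 1" using assms by (simp add: power2_norm_eq_inner)
  then show ?thesis
    using assms by (simp add: potential_def profile_def real_sqrt_divide norm_eq_sqrt_inner)
qed

lemma continuous_bump: "continuous_on UNIV (bump R)"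
  unfolding bump_def[abs_def] by (auto intro!: continuous_intros simp: divide_inverse)

lemma norm_le_imp_mem_cbox:
  fixes x :: "'a::euclidean_space"
  assumes "norm x \<le> r"
  shows "x \<in> cbox (- (r *\<^sub>R One)) (r *\<^sub>R One)"
proof -
  have "\<bar>x \<bullet> i\<bar> \<le> r" if "i \<in> Basis" for i
    using Basis_le_norm[OF that, of x] assms by linarith
  then show ?thesis by (simp add: mem_box abs_le_iff) (metis minus_le_iff)
qed

lemma bump_eq_0: "R > 0 \<Longrightarrow> norm y > R \<Longrightarrow> bump R y = 0"
proof -
  assume *: "R > 0" "norm y > R"
  have "R\<^sup>2 < (norm y)\<^sup>2" using * by (intro power_strict_mono) auto
  then have "y \<bullet> y / R\<^sup>2 > 1" using * by (simp add: power2_norm_eq_inner)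
  then show ?thesis by (simp add: bump_def)
qed

lemma bump_bounds: "R > 0 \<Longrightarrow> 0 \<le> bump R y" "R > 0 \<Longrightarrow> bump R y \<le> 1 / R ^ 3"
  by (auto simp: bump_def intro!: divide_right_mono)

text \<open>
  The kernel \<open>potential r - potential R\<close> vanishes where both potentials equal \<open>1 / \<bar>y\<bar>\<close>, so its convolution
  with \<open>\<phi>\<close> is a test function. Two integrations by parts move the Laplacian from \<open>\<phi>\<close> to the kernel.
\<close>
lemma conv_bump_invariance:
  fixes \<phi> :: "real^3 \<Rightarrow> 'b::euclidean_space"
  assumes \<phi>: "test_function UNIV \<phi>" and r: "r > 0" "R > 0"
  shows "\<exists>\<xi>. test_function UNIV \<xi> \<and> (\<forall>x. laplacian \<xi> x = (15 / 2) *\<^sub>R (conv (bump R) \<phi> x - conv (bump r) \<phi> x))"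
proof -
  define k where "k y = potential r y - potential R y" for y
  define M where "M = max r R"
  define Q where "Q = (cbox (- (M *\<^sub>R One)) (M *\<^sub>R One) :: (real^3) set)"
  have outside: "norm y > M" if "y \<notin> Q" for y
    using norm_le_imp_mem_cbox[of y M] that unfolding Q_def by (meson not_le)
  have k0: "k y = 0" if "y \<notin> Q" for y
    using outside[OF that] r by (simp add: k_def M_def potential_eq)
  have diffp: "potential R differentiable (at y)" "pderiv_at i (potential R) differentiable (at y)" for R y i
    using potential_derivative pderiv_potential_derivative unfolding differentiable_def by blast+
  have cont: "continuous_on UNIV (potential R)" "continuous_on UNIV (pderiv_at i (potential R))"
      "continuous_on UNIV (pderiv_at i (pderiv_at i (potential R)))" for R i
  proof -
    show "continuous_on UNIV (potential R)" "continuous_on UNIV (pderiv_at i (potential R))"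
      using diffp by (simp_all add: differentiable_imp_continuous_on differentiable_on_UNIV_iff)
    have "continuous_on UNIV profile'"
      using DERIV_isCont[OF DERIV_profile'] by (simp add: continuous_at_imp_continuous_on)
    then show "continuous_on UNIV (pderiv_at i (pderiv_at i (potential R)))"
      unfolding pderiv_pderiv_potential
      by (intro continuous_intros continuous_profile_norm continuous_profile'')
  qed
  have pk: "pderiv_at i k = (\<lambda>y. pderiv_at i (potential r) y - pderiv_at i (potential R) y)"
      "pderiv_at i (pderiv_at i k) = (\<lambda>y. pderiv_at i (pderiv_at i (potential r)) y - pderiv_at i (pderiv_at i (potential R)) y)" for i
  proof -
    show *: "pderiv_at i k = (\<lambda>y. pderiv_at i (potential r) y - pderiv_at i (potential R) y)"
      unfolding k_def[abs_def] by (intro ext pderiv_at_diff diffp)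
    show "pderiv_at i (pderiv_at i k) = (\<lambda>y. pderiv_at i (pderiv_at i (potential r)) y - pderiv_at i (pderiv_at i (potential R)) y)"
      unfolding * by (intro ext pderiv_at_diff diffp)
  qed
  have diffk: "k differentiable (at y)" "pderiv_at i k differentiable (at y)" for y i
    by (unfold pk(1), unfold k_def[abs_def]) (intro differentiable_diff diffp)+
  have contk: "continuous_on UNIV k" "continuous_on UNIV (pderiv_at i k)" "continuous_on UNIV (pderiv_at i (pderiv_at i k))" for i
    by (unfold pk(2), unfold pk(1), unfold k_def[abs_def]) (intro continuous_on_diff cont)+
  have Q: "compact Q" "closed Q" by (simp_all add: Q_def closed_cbox)
  note k0' = k0 pderiv_at_eq_0_off_support[OF Q(2) k0] pderiv_at_eq_0_off_support[OF Q(2) pderiv_at_eq_0_off_support[OF Q(2) k0]]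
  have kQ: "\<forall>y. y \<notin> cbox (- (M *\<^sub>R One)) (M *\<^sub>R One) \<longrightarrow> k y = 0" using k0 by (simp add: Q_def)
  note \<phi>s = test_function_smooth[OF \<phi>]
  have lap: "laplacian (conv k \<phi>) x = (15 / 2) *\<^sub>R (conv (bump R) \<phi> x - conv (bump r) \<phi> x)" for x
  proof -
    define g where "g y = \<phi> (x - y)" for y
    have lin: "bounded_linear (\<lambda>y::real^3. - y)" by (rule bounded_linear_minus[OF bounded_linear_ident])
    have gs: "smooth_on UNIV (\<lambda>y. \<psi> (x - y))" if "smooth_on UNIV \<psi>" for \<psi> :: "real^3 \<Rightarrow> 'b"
      using that Ck_on_compose_affine[OF lin, of _ \<psi> x] by (simp add: smooth_on_def)
    have dg: "pderiv_at i (\<lambda>y. \<psi> (x - y)) y = - pderiv_at i \<psi> (x - y)" if "smooth_on UNIV \<psi>" for \<psi> :: "real^3 \<Rightarrow> 'b" and i y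
    proof -
      have "((\<lambda>y. x - y) has_derivative (\<lambda>v. - v)) (at y)" by (auto intro!: derivative_eq_intros)
      from pderiv_at_eqI[OF has_derivative_compose[OF this smooth_on_has_derivative[OF that]]]
      show ?thesis
        using linear_neg[OF has_derivative_linear[OF smooth_on_has_derivative[OF that]]] by (simp add: pderiv_at_def)
    qed
    have ddg: "pderiv_at i (pderiv_at i g) y = pderiv_at i (pderiv_at i \<phi>) (x - y)" for i y
    proof -
      have 1: "pderiv_at i g = (\<lambda>y. - pderiv_at i \<phi> (x - y))"
        unfolding g_def[abs_def] by (intro ext dg \<phi>s)
      have "pderiv_at i (\<lambda>y. - pderiv_at i \<phi> (x - y)) y = - pderiv_at i (\<lambda>y. pderiv_at i \<phi> (x - y)) y"
        by (rule pderiv_at_linear[OF bounded_linear_minus[OF bounded_linear_ident]])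
          (intro smooth_on_differentiable gs smooth_on_pderiv \<phi>s)
      then show ?thesis unfolding 1 by (simp add: dg[OF smooth_on_pderiv[OF \<phi>s]])
    qed
    have g: "smooth_on UNIV g" unfolding g_def by (rule gs[OF \<phi>s])
    note gd = smooth_on_differentiable[OF g] smooth_on_differentiable[OF smooth_on_pderiv[OF g]]
    note gc = smooth_on_continuous[OF g] smooth_on_continuous[OF smooth_on_pderiv[OF g]]
      smooth_on_continuous[OF smooth_on_pderiv[OF smooth_on_pderiv[OF g]]]
    have int: "integrable lebesgue (\<lambda>y. f y *\<^sub>R g y)" "integrable lborel (\<lambda>y. f y *\<^sub>R g y)"
      if "continuous_on UNIV f" "\<And>y. y \<notin> Q \<Longrightarrow> f y = 0" for f
      by (rule integrable_continuous_compact_support[OF continuous_on_scaleR[OF that(1) gc(1)] Q(1)]; simp add: that(2))+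
    have "pderiv_at i (pderiv_at i (conv k \<phi>)) x = (LINT y|lebesgue. pderiv_at i (pderiv_at i k) y *\<^sub>R g y)" for i
    proof -
      have "pderiv_at i (conv k \<phi>) = conv k (pderiv_at i \<phi>)"
        by (intro ext pderiv_at_conv[OF contk(1) kQ \<phi>s])
      then have "pderiv_at i (pderiv_at i (conv k \<phi>)) x = conv k (pderiv_at i (pderiv_at i \<phi>)) x"
        by (simp add: pderiv_at_conv[OF contk(1) kQ smooth_on_pderiv[OF \<phi>s]])
      also have "\<dots> = (LINT y|lborel. k y *\<^sub>R pderiv_at i (pderiv_at i g) y)"
        unfolding conv_def ddg ..
      also have "\<dots> = (LINT y|lebesgue. k y *\<^sub>R pderiv_at i (pderiv_at i g) y)"
        by (rule integral_completion[symmetric])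
          (simp add: borel_measurable_continuous_onI contk gc borel_measurable_scaleR)
      also have "\<dots> = - (LINT y|lebesgue. pderiv_at i k y *\<^sub>R pderiv_at i g y)"
        by (rule integral_by_parts[OF bounded_bilinear_scaleR diffk(1) contk(2) gd(2) gc(3) Q(1)])
          (auto simp: k0')
      also have "\<dots> = (LINT y|lebesgue. pderiv_at i (pderiv_at i k) y *\<^sub>R g y)"
        by (subst integral_by_parts[OF bounded_bilinear_scaleR diffk(2) contk(3) gd(1) gc(2) Q(1)])
          (auto simp: k0')
      finally show ?thesis .
    qed
    then have "laplacian (conv k \<phi>) x = (LINT y|lebesgue. laplacian k y *\<^sub>R g y)"
      unfolding laplacian_def scaleR_sum_left
      by (subst Bochner_Integration.integral_sum) (auto intro!: int contk k0')
    also have "laplacian k y = laplacian (potential r) y - laplacian (potential R) y" for y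
      unfolding laplacian_def pk(2) by (rule sum_subtractf)
    then have lk: "laplacian k = (\<lambda>y. (15 / 2) * (bump R y - bump r y))"
      by (simp add: laplacian_potential fun_eq_iff algebra_simps)
    have "(LINT y|lebesgue. laplacian k y *\<^sub>R g y) = (LINT y|lebesgue. (15 / 2) *\<^sub>R (bump R y *\<^sub>R g y - bump r y *\<^sub>R g y))"
      by (simp only: lk scaleR_diff_left[symmetric] scaleR_scaleR)
    also have "\<dots> = (LINT y|lborel. (15 / 2) *\<^sub>R (bump R y *\<^sub>R g y - bump r y *\<^sub>R g y))"
      by (rule integral_completion)
        (simp add: borel_measurable_continuous_onI continuous_bump gc borel_measurable_scaleR borel_measurable_diff)
    also have "\<dots> = (15 / 2) *\<^sub>R (conv (bump R) \<phi> x - conv (bump r) \<phi> x)"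
    proof -
      have b0: "bump r y = 0" "bump R y = 0" if "y \<notin> Q" for y
        using outside[OF that] r by (simp_all add: M_def bump_eq_0)
      show ?thesis
        using int(2)[OF continuous_bump b0(1)] int(2)[OF continuous_bump b0(2)] by (simp add: conv_def g_def)
    qed
    finally show ?thesis .
  qed
  show ?thesis
    using test_function_conv[OF contk(1) kQ \<phi>] lap by blast
qed

section \<open>A Liouville principle\<close>

lemma lborel_integral_affine:
  fixes f :: "'a::euclidean_space \<Rightarrow> 'b::{banach, second_countable_topology}"
  assumes [measurable]: "f \<in> borel_measurable borel" and c: "c \<noteq> 0"
  shows "(LINT x|lborel. f x) = \<bar>c\<bar> ^ DIM('a) *\<^sub>R (LINT x|lborel. f (t + c *\<^sub>R x))"
proof -
  have "(LINT x|lborel. f x) = (LINT x|density (distr lborel borel (\<lambda>x. t + c *\<^sub>R x)) (\<lambda>_. ennreal (\<bar>c\<bar> ^ DIM('a))). f x)"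
    by (subst lborel_affine[OF c, of t]) (simp add: ennreal_power)
  also have "\<dots> = (LINT x|distr lborel borel (\<lambda>x. t + c *\<^sub>R x). \<bar>c\<bar> ^ DIM('a) *\<^sub>R f x)"
    by (rule integral_density) simp_all
  also have "\<dots> = (LINT x|lborel. \<bar>c\<bar> ^ DIM('a) *\<^sub>R f (t + c *\<^sub>R x))"
    by (rule integral_distr) simp_all
  finally show ?thesis by simp
qed

lemma bump_off_cball: "R > 0 \<Longrightarrow> y \<notin> cball 0 R \<Longrightarrow> bump R y = 0"
  by (simp add: bump_eq_0)

lemma bump_support: "R > 0 \<Longrightarrow> \<forall>y. y \<notin> cbox (- (R *\<^sub>R One)) (R *\<^sub>R One) \<longrightarrow> bump R y = 0"
proof (intro allI impI)
  fix y :: "real^3" assume "R > 0" "y \<notin> cbox (- (R *\<^sub>R One)) (R *\<^sub>R One)"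
  then show "bump R y = 0"
    using norm_le_imp_mem_cbox[of y R] by (intro bump_eq_0) (auto simp: not_le[symmetric])
qed

lemma integrable_bump: "R > 0 \<Longrightarrow> integrable lborel (bump R)"
  by (rule integrable_continuous_compact_support[OF continuous_bump compact_cball bump_off_cball])

definition bump_mass :: real where
  "bump_mass = (LINT z|lborel. bump 1 z)"

lemma bump_mass_pos: "bump_mass > 0"
proof -
  let ?B = "cball (0::real^3) (1 / 2)"
  have "3 / 4 * indicator ?B z \<le> bump 1 z" for z
  proof (cases "z \<in> ?B")
    case True
    then have "norm z ^ 2 \<le> (1 / 2) ^ 2" by (intro power_mono) auto
    then have "z \<bullet> z \<le> (1 / 2)\<^sup>2" by (simp only: power2_norm_eq_inner)
    then have "z \<bullet> z \<le> 1 / 4" by (simp add: power2_eq_square)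
    then show ?thesis using True by (simp add: bump_def)
  qed (simp add: bump_bounds)
  moreover have "integrable lborel (indicator ?B :: _ \<Rightarrow> real)"
    by (rule integrable_real_indicator) (use emeasure_compact_finite[OF compact_cball, of "0::real^3" "1 / 2"] in simp_all)
  ultimately have le: "(LINT z|lborel. 3 / 4 * indicator ?B z) \<le> bump_mass"
    unfolding bump_mass_def by (intro integral_mono integrable_mult_right integrable_bump) simp_all
  have pos: "0 < measure lborel ?B" by (rule content_cball_pos) simp
  have "3 / 4 * measure lborel ?B \<le> bump_mass" using le by simp
  with pos show ?thesis by linarith
qed

text \<open>
  In this form the weight is independent of \<open>R\<close>, which is convenient for small \<open>R\<close>.
\<close>
lemma conv_bump_scaled:
  fixes g :: "real^3 \<Rightarrow> 'b::euclidean_space"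
  assumes R: "R > 0" and g: "continuous_on UNIV g"
  shows "conv (bump R) g x = (LINT z|lborel. bump 1 z *\<^sub>R g (x - R *\<^sub>R z))"
proof -
  have "continuous_on UNIV (\<lambda>y. bump R y *\<^sub>R g (x - y))"
    by (intro continuous_on_scaleR continuous_bump continuous_on_compose2[OF g] continuous_intros) auto
  then have "(\<lambda>y. bump R y *\<^sub>R g (x - y)) \<in> borel_measurable borel"
    by (rule borel_measurable_continuous_onI)
  from lborel_integral_affine[OF this, of R 0]
  have "conv (bump R) g x = R ^ 3 *\<^sub>R (LINT z|lborel. bump R (R *\<^sub>R z) *\<^sub>R g (x - R *\<^sub>R z))"
    using R by (simp add: conv_def)
  also have "\<dots> = (LINT z|lborel. (R ^ 3 * bump R (R *\<^sub>R z)) *\<^sub>R g (x - R *\<^sub>R z))"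
    unfolding scaleR_scaleR[symmetric] by (rule integral_scaleR_right[symmetric])
  also have "(\<lambda>z. R ^ 3 * bump R (R *\<^sub>R z)) = bump 1"
    using R by (simp add: bump_def power2_eq_square fun_eq_iff)
  finally show ?thesis by (simp add: fun_eq_iff)
qed

lemma integrable_bump_mult_bounded:
  fixes g :: "real^3 \<Rightarrow> 'b::euclidean_space"
  assumes g: "continuous_on UNIV g"
  shows "integrable lborel (\<lambda>z. bump 1 z *\<^sub>R g (x - R *\<^sub>R z))"
  by (rule integrable_continuous_compact_support[OF _ compact_cball[of 0 1]])
    (auto intro!: continuous_intros continuous_bump continuous_on_compose2[OF g] simp: bump_eq_0)

lemma norm_conv_bump_le_sup:
  fixes g :: "real^3 \<Rightarrow> 'b::euclidean_space"
  assumes R: "R > 0" and g: "continuous_on UNIV g" "\<And>x. norm (g x) \<le> C"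
  shows "norm (conv (bump R) g x) \<le> bump_mass * C"
proof -
  have "norm (conv (bump R) g x) \<le> (LINT z|lborel. norm (bump 1 z *\<^sub>R g (x - R *\<^sub>R z)))"
    unfolding conv_bump_scaled[OF R g(1)] by (rule integral_norm_bound)
  also have "\<dots> \<le> (LINT z|lborel. bump 1 z * C)"
    by (intro integral_mono integrable_norm integrable_bump_mult_bounded g(1) integrable_mult_left integrable_bump)
      (auto simp: bump_bounds intro!: mult_mono g(2))
  finally show ?thesis by (simp add: bump_mass_def)
qed

lemma conv_bump_tendsto:
  fixes g :: "real^3 \<Rightarrow> 'b::euclidean_space"
  assumes g: "continuous_on UNIV g" "\<And>x. norm (g x) \<le> C"
  shows "(\<lambda>n. conv (bump (1 / real (Suc n))) g x) \<longlonglongrightarrow> bump_mass *\<^sub>R g x"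
proof -
  have "(\<lambda>n. LINT z|lborel. bump 1 z *\<^sub>R g (x - (1 / real (Suc n)) *\<^sub>R z)) \<longlonglongrightarrow> (LINT z|lborel. bump 1 z *\<^sub>R g x)"
  proof (rule integral_dominated_convergence[where w="\<lambda>z. bump 1 z * C"])
    show "integrable lborel (\<lambda>z. bump 1 z * C)" by (intro integrable_mult_left integrable_bump) simp
    show "(\<lambda>z. bump 1 z *\<^sub>R g (x - (1 / real (Suc n)) *\<^sub>R z)) \<in> borel_measurable lborel" for n
      by (rule borel_measurable_integrable[OF integrable_bump_mult_bounded[OF g(1)]])
    show "(\<lambda>z. bump 1 z *\<^sub>R g x) \<in> borel_measurable lborel"
      using borel_measurable_integrable[OF integrable_bump[of 1]] by simp
    show "AE z in lborel. norm (bump 1 z *\<^sub>R g (x - (1 / real (Suc n)) *\<^sub>R z)) \<le> bump 1 z * C" for n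
      by (intro always_eventually allI) (auto simp: bump_bounds intro!: mult_mono g(2))
    show "AE z in lborel. (\<lambda>n. bump 1 z *\<^sub>R g (x - (1 / real (Suc n)) *\<^sub>R z)) \<longlonglongrightarrow> bump 1 z *\<^sub>R g x"
    proof (intro always_eventually allI tendsto_scaleR tendsto_const)
      fix z :: "real^3"
      have "(\<lambda>n. 1 / real (Suc n)) \<longlonglongrightarrow> 0"
        using LIMSEQ_inverse_real_of_nat by (simp add: inverse_eq_divide)
      then have "(\<lambda>n. x - (1 / real (Suc n)) *\<^sub>R z) \<longlonglongrightarrow> x - 0 *\<^sub>R z"
        by (intro tendsto_intros)
      then show "(\<lambda>n. g (x - (1 / real (Suc n)) *\<^sub>R z)) \<longlonglongrightarrow> g x"
        by (intro continuous_on_tendsto_compose[OF g(1)]) simp_all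
    qed
  qed
  then show ?thesis
    using integrable_bump[of 1] by (simp add: conv_bump_scaled[OF _ g(1)] bump_mass_def)
qed

lemma integral_conv_bump_tendsto:
  fixes u g :: "real^3 \<Rightarrow> 'b::euclidean_space"
  assumes u: "locally_integrable u" and g: "test_function UNIV g"
  shows "(\<lambda>n. LINT x|lebesgue. u x \<bullet> conv (bump (1 / real (Suc n))) g x) \<longlonglongrightarrow> bump_mass * (LINT x|lebesgue. u x \<bullet> g x)"
proof -
  obtain K where K: "smooth_on UNIV g" "compact K" "\<And>x. x \<notin> K \<Longrightarrow> g x = 0"
    using g unfolding test_function_iff by blast
  note gc = smooth_on_continuous[OF K(1)]
  obtain C where C: "C > 0" "\<And>x. norm (g x) \<le> C"
    using bounded_continuous_compact_support[OF gc K(2,3)] by blast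
  define L where "L = {a + b |a b. a \<in> cball (0::real^3) 1 \<and> b \<in> K}"
  have L: "compact L" unfolding L_def by (rule compact_sums[OF compact_cball K(2)])
  have t: "test_function UNIV (conv (bump (1 / real (Suc n))) g)" for n
    by (rule test_function_conv[OF continuous_bump bump_support g]) simp
  have "(\<lambda>n. LINT x|lebesgue. u x \<bullet> conv (bump (1 / real (Suc n))) g x) \<longlonglongrightarrow> (LINT x|lebesgue. u x \<bullet> (bump_mass *\<^sub>R g x))"
  proof (rule integral_dominated_convergence[where w="\<lambda>x. (bump_mass * C) * norm (indicator L x *\<^sub>R u x)"])
    show "integrable lebesgue (\<lambda>x. bump_mass * C * norm (indicator L x *\<^sub>R u x))"
      by (intro integrable_mult_right integrable_norm locally_integrableD[OF u L])
    show "(\<lambda>x. u x \<bullet> conv (bump (1 / real (Suc n))) g x) \<in> borel_measurable lebesgue" for n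
      by (rule borel_measurable_integrable[OF integrable_test_inner[OF u t]])
    show "(\<lambda>x. u x \<bullet> (bump_mass *\<^sub>R g x)) \<in> borel_measurable lebesgue"
      by (rule borel_measurable_integrable[OF integrable_test_inner[OF u test_function_scaleR[OF g]]])
    show "AE x in lebesgue. (\<lambda>n. u x \<bullet> conv (bump (1 / real (Suc n))) g x) \<longlonglongrightarrow> u x \<bullet> (bump_mass *\<^sub>R g x)"
      by (intro always_eventually allI tendsto_inner tendsto_const conv_bump_tendsto[OF gc C(2)])
    show "AE x in lebesgue. norm (u x \<bullet> conv (bump (1 / real (Suc n))) g x) \<le> bump_mass * C * norm (indicator L x *\<^sub>R u x)" for n
    proof (intro always_eventually allI)
      fix x
      show "norm (u x \<bullet> conv (bump (1 / real (Suc n))) g x) \<le> bump_mass * C * norm (indicator L x *\<^sub>R u x)"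
      proof (cases "x \<in> L")
        case True
        have "norm (u x \<bullet> conv (bump (1 / real (Suc n))) g x) \<le> norm (u x) * norm (conv (bump (1 / real (Suc n))) g x)"
          by (simp add: Cauchy_Schwarz_ineq2)
        also have "\<dots> \<le> norm (u x) * (bump_mass * C)"
          by (intro mult_left_mono norm_conv_bump_le_sup gc C(2)) simp_all
        finally show ?thesis using True by (simp add: mult.commute)
      next
        case False
        have "\<forall>y. y \<notin> cball 0 1 \<longrightarrow> bump (1 / real (Suc n)) y = 0"
        proof (intro allI impI)
          fix y :: "real^3" assume "y \<notin> cball 0 1"
          then have "norm y > 1" by simp
          moreover have "1 / real (Suc n) \<le> 1" by simp
          ultimately have "norm y > 1 / real (Suc n)" by linarith
          then show "bump (1 / real (Suc n)) y = 0" by (intro bump_eq_0) simp_all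
        qed
        then have "conv (bump (1 / real (Suc n))) g x = 0"
          using False K(3) unfolding L_def by (intro conv_eq_0[where K="cball 0 1" and L=K]) auto
        then show ?thesis by (simp add: False)
      qed
    qed
  qed
  then show ?thesis by simp
qed

lemma Lp_on_UNIV:
  "Lp_on p UNIV f \<longleftrightarrow> f \<in> borel_measurable lebesgue \<and> integrable lebesgue (\<lambda>x. norm (f x) ^ p)"
  by (simp add: Lp_on_def lebesgue_on_UNIV_eq)

text \<open>
  This replaces Hoelder's inequality on sets of finite measure: integrated with a large parameter \<open>s\<close>, it
  bounds the mean of an \<open>L\<^sup>p\<close> function over a large set by a small constant plus a vanishing term.
\<close>
lemma le_scaled_power_plus:
  fixes v s :: real
  assumes "v \<ge> 0" "s > 0"
  shows "v \<le> s ^ q * v ^ Suc q + 1 / s"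
proof (cases "s * v \<le> 1")
  case True
  then have "v \<le> 1 / s" using assms by (simp add: field_simps)
  moreover have "0 \<le> s ^ q * v ^ Suc q" using assms by simp
  ultimately show ?thesis by linarith
next
  case False
  then have "1 \<le> (s * v) ^ q" by (intro one_le_power) simp
  then have "v * 1 \<le> v * (s * v) ^ q" using assms by (intro mult_left_mono)
  also have "\<dots> = s ^ q * v ^ Suc q" by (simp add: power_mult_distrib)
  finally have "v \<le> s ^ q * v ^ Suc q" by simp
  moreover have "0 \<le> 1 / s" using assms by simp
  ultimately show ?thesis by linarith
qed

lemma Lp_on_integral_le:
  fixes u :: "'a::euclidean_space \<Rightarrow> 'b::euclidean_space"
  assumes u: "Lp_on (Suc q) UNIV u" and K: "K \<in> lmeasurable" and s: "s > 0"
  shows "integrable lebesgue (\<lambda>x. indicator K x *\<^sub>R u x)"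
    "(LINT x|lebesgue. norm (indicator K x *\<^sub>R u x)) \<le> s ^ q * (LINT x|lebesgue. norm (u x) ^ Suc q) + measure lebesgue K / s"
proof -
  have Ks: "K \<in> sets lebesgue" using K by (simp add: fmeasurable_def)
  have le: "norm (indicator K x *\<^sub>R u x) \<le> s ^ q * norm (u x) ^ Suc q + indicator K x * (1 / s)" for x
  proof (cases "x \<in> K")
    case True
    then show ?thesis using le_scaled_power_plus[OF norm_ge_zero s, of "u x" q] by simp
  next
    case False
    have "0 \<le> s ^ q * norm (u x) ^ Suc q" using s by (intro mult_nonneg_nonneg zero_le_power) auto
    with False show ?thesis by simp
  qed
  have int: "integrable lebesgue (\<lambda>x. s ^ q * norm (u x) ^ Suc q)" "integrable lebesgue (\<lambda>x. indicator K x * (1 / s) :: real)"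
    using u Ks K by (auto simp: Lp_on_UNIV fmeasurable_def intro!: integrable_mult_right integrable_mult_left integrable_real_indicator)
  show *: "integrable lebesgue (\<lambda>x. indicator K x *\<^sub>R u x)"
  proof (rule Bochner_Integration.integrable_bound[OF Bochner_Integration.integrable_add[OF int]])
    show "(\<lambda>x. indicator K x *\<^sub>R u x) \<in> borel_measurable lebesgue"
      using u Ks by (auto simp: Lp_on_UNIV intro!: borel_measurable_scaleR borel_measurable_indicator)
  qed (use le in \<open>auto intro: order_trans[OF _ abs_ge_self]\<close>)
  have "(LINT x|lebesgue. norm (indicator K x *\<^sub>R u x)) \<le> (LINT x|lebesgue. s ^ q * norm (u x) ^ Suc q + indicator K x * (1 / s))"
    by (intro integral_mono integrable_norm * Bochner_Integration.integrable_add int le)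
  also have "\<dots> = s ^ q * (LINT x|lebesgue. norm (u x) ^ Suc q) + measure lebesgue K / s"
    unfolding Bochner_Integration.integral_add[OF int] using Ks by simp
  finally show "(LINT x|lebesgue. norm (indicator K x *\<^sub>R u x)) \<le> s ^ q * (LINT x|lebesgue. norm (u x) ^ Suc q) + measure lebesgue K / s" .
qed

lemma Lp_on_imp_locally_integrable:
  "Lp_on (Suc q) UNIV u \<Longrightarrow> locally_integrable u"
  unfolding locally_integrable_def set_integrable_def
  using Lp_on_integral_le(1)[of q u _ 1] lmeasurable_compact by auto

text \<open>
  This bound serves for large \<open>R\<close>: it decays like the reciprocal of the volume.
\<close>
lemma norm_conv_bump_le_L1:
  fixes g :: "real^3 \<Rightarrow> 'b::euclidean_space"
  assumes R: "R > 0" and g: "continuous_on UNIV g" "compact K" "\<And>x. x \<notin> K \<Longrightarrow> g x = 0"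
  shows "norm (conv (bump R) g x) \<le> (LINT y|lborel. norm (g y)) / R ^ 3"
proof -
  have gi: "integrable lborel g" by (rule integrable_continuous_compact_support(1)[OF g])
  have gm: "(\<lambda>y. norm (g y)) \<in> borel_measurable borel"
    using borel_measurable_continuous_onI[OF g(1)] by simp
  have c: "continuous_on UNIV (\<lambda>y. g (x - y))"
    by (intro continuous_on_compose2[OF g(1)] continuous_intros) auto
  have "compact ((\<lambda>y. x - y) ` K)" by (intro compact_continuous_image g(2) continuous_intros)
  then have gi': "integrable lborel (\<lambda>y. g (x - y))"
    by (rule integrable_continuous_compact_support(1)[OF c]) (rule g(3), force simp: image_iff)
  have "norm (conv (bump R) g x) \<le> (LINT y|lborel. norm (bump R y *\<^sub>R g (x - y)))"
    unfolding conv_def by (rule integral_norm_bound)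
  also have "\<dots> \<le> (LINT y|lborel. norm (g (x - y)) / R ^ 3)"
  proof (intro integral_mono integrable_norm integrable_divide gi')
    show "integrable lborel (\<lambda>y. bump R y *\<^sub>R g (x - y))"
      by (rule integrable_conv[OF continuous_bump compact_cbox bump_support[OF R] g(1)])
    show "norm (bump R y *\<^sub>R g (x - y)) \<le> norm (g (x - y)) / R ^ 3" for y
      using mult_right_mono[OF bump_bounds(2)[OF R, of y] norm_ge_zero[of "g (x - y)"]] bump_bounds(1)[OF R, of y]
      by simp
  qed
  also have "\<dots> = (LINT y|lborel. norm (g y)) / R ^ 3"
    using lborel_integral_affine[OF gm, of "-1" x] by simp
  finally show ?thesis .
qed

text \<open>
  For fixed \<open>s\<close>, the integral is at most \<open>G (s ^ q U / R\<^sup>3 + 64 / s)\<close>. The second term is the volume of a cube of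
  side \<open>4 R\<close> times \<open>1 / (s R\<^sup>3)\<close>; it is made small by the choice of \<open>s\<close>, and the first one then by that of \<open>R\<close>.
\<close>
lemma integral_conv_bump_tendsto_0:
  fixes u g :: "real^3 \<Rightarrow> 'b::euclidean_space"
  assumes u: "Lp_on (Suc q) UNIV u" and g: "test_function UNIV g"
  shows "(\<lambda>n. LINT x|lebesgue. u x \<bullet> conv (bump (real (Suc n))) g x) \<longlonglongrightarrow> 0"
proof -
  obtain K where K: "smooth_on UNIV g" "compact K" "\<And>x. x \<notin> K \<Longrightarrow> g x = 0"
    using g unfolding test_function_iff by blast
  note gc = smooth_on_continuous[OF K(1)]
  obtain A where A: "A > 0" "\<And>x. x \<in> K \<Longrightarrow> norm x \<le> A"
    using compact_imp_bounded[OF K(2)] unfolding bounded_pos by blast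
  define G where "G = (LINT y|lborel. norm (g y))"
  define U where "U = (LINT x|lebesgue. norm (u x) ^ Suc q)"
  have G: "G \<ge> 0" unfolding G_def by simp
  define Q where "Q R = cbox (- ((2 * R) *\<^sub>R One)) ((2 * R) *\<^sub>R One :: real^3)" for R :: real
  have vol: "measure lebesgue (Q R) = 64 * R ^ 3" if "R > 0" for R
  proof -
    have ne: "Q R \<noteq> {}"
      unfolding Q_def box_ne_empty using that by simp
    have "measure lebesgue (Q R) = measure lborel (Q R)"
      by (simp add: Q_def)
    also have "\<dots> = (\<Prod>b\<in>(Basis :: (real^3) set). 4 * R)"
      using ne unfolding Q_def by (subst content_cbox') (auto intro!: prod.cong)
    finally have "measure lebesgue (Q R) = (\<Prod>b\<in>(Basis :: (real^3) set). 4 * R)" .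
    then show ?thesis by (simp add: power_mult_distrib)
  qed
  have bound: "\<bar>LINT x|lebesgue. u x \<bullet> conv (bump R) g x\<bar> \<le> G * (s ^ q * U / R ^ 3 + 64 / s)"
    if R: "R \<ge> A" and s: "s > 0" for R s
  proof -
    have R0: "R > 0" using A R by linarith
    note int = Lp_on_integral_le[OF u, of "Q R", OF _ s]
    have Q: "Q R \<in> lmeasurable" by (simp add: Q_def)
    have "\<bar>LINT x|lebesgue. u x \<bullet> conv (bump R) g x\<bar> \<le> (LINT x|lebesgue. norm (indicator (Q R) x *\<^sub>R u x) * (G / R ^ 3))"
    proof (rule order_trans[OF integral_abs_bound], rule integral_mono)
      show "integrable lebesgue (\<lambda>x. \<bar>u x \<bullet> conv (bump R) g x\<bar>)"
        by (intro integrable_abs integrable_test_inner[OF Lp_on_imp_locally_integrable[OF u], where U=UNIV]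
            test_function_conv[OF continuous_bump bump_support[OF R0] g])
      show "integrable lebesgue (\<lambda>x. norm (indicator (Q R) x *\<^sub>R u x) * (G / R ^ 3))"
        by (intro integrable_mult_left integrable_norm int(1) Q)
      fix x
      show "\<bar>u x \<bullet> conv (bump R) g x\<bar> \<le> norm (indicator (Q R) x *\<^sub>R u x) * (G / R ^ 3)"
      proof (cases "x \<in> Q R")
        case True
        have "\<bar>u x \<bullet> conv (bump R) g x\<bar> \<le> norm (u x) * norm (conv (bump R) g x)"
          by (rule Cauchy_Schwarz_ineq2)
        also have "\<dots> \<le> norm (u x) * (G / R ^ 3)"
          unfolding G_def by (intro mult_left_mono norm_conv_bump_le_L1[OF R0 gc K(2,3)]) simp_all
        finally show ?thesis using True by simp
      next
        case False
        then have "norm x > 2 * R" using norm_le_imp_mem_cbox[of x "2 * R"] unfolding Q_def by (meson not_le)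
        moreover have "norm (a + b) \<le> 2 * R" if "a \<in> cball 0 R" "b \<in> K" for a b
          using norm_triangle_ineq[of a b] that A(2)[of b] R by simp
        ultimately have "x \<notin> {a + b |a b. a \<in> cball 0 R \<and> b \<in> K}" by force
        then have "conv (bump R) g x = 0"
          by (rule conv_eq_0[rotated 2]) (use bump_off_cball[OF R0] K(3) in blast)+
        then show ?thesis using False by simp
      qed
    qed
    also have "\<dots> = (LINT x|lebesgue. norm (indicator (Q R) x *\<^sub>R u x)) * (G / R ^ 3)"
      by (rule integral_mult_left_zero)
    also have "\<dots> \<le> (s ^ q * U + measure lebesgue (Q R) / s) * (G / R ^ 3)"
      using int(2)[OF Q] G R0 unfolding U_def by (intro mult_right_mono) auto
    also have "\<dots> = G * (s ^ q * U / R ^ 3 + 64 / s)"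
      using R0 s by (simp add: vol field_simps)
    finally show ?thesis .
  qed
  show ?thesis
  proof (rule LIMSEQ_I)
    fix e :: real assume e: "e > 0"
    \<comment> \<open>This makes \<open>64 G / s\<close> at most \<open>e / 2\<close>, also if \<open>G = 0\<close>.\<close>
    define s where "s = (128 * G + 1) / e"
    have s: "s > 0" using e G by (simp add: s_def)
    have gs: "G * (64 / s) \<le> e / 2"
      using e G by (simp add: s_def field_simps)
    have lim: "(\<lambda>n. G * (s ^ q * U / real (Suc n) ^ 3)) \<longlonglongrightarrow> 0"
      by real_asymp
    have "\<forall>\<^sub>F n in sequentially. \<bar>G * (s ^ q * U / real (Suc n) ^ 3)\<bar> < e / 2"
      using tendstoD[OF lim half_gt_zero[OF e]] unfolding dist_real_def diff_0_right .
    moreover have "\<forall>\<^sub>F n in sequentially. real (Suc n) \<ge> A"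
      by real_asymp
    ultimately have "\<forall>\<^sub>F n in sequentially. norm (LINT x|lebesgue. u x \<bullet> conv (bump (real (Suc n))) g x) < e"
    proof eventually_elim
      case (elim n)
      have "\<bar>LINT x|lebesgue. u x \<bullet> conv (bump (real (Suc n))) g x\<bar> \<le> G * (s ^ q * U / real (Suc n) ^ 3) + G * (64 / s)"
        using bound[OF elim(2) s] by (simp only: distrib_left)
      then show ?case using elim(1) gs by (simp only: real_norm_def abs_less_iff) linarith
    qed
    then show "\<exists>no. \<forall>n\<ge>no. norm ((LINT x|lebesgue. u x \<bullet> conv (bump (real (Suc n))) g x) - 0) < e"
      by (simp add: eventually_sequentially)
  qed
qed

text \<open>
  The difference of the two integrals, with averages in place of \<open>\<phi>\<close> and \<open>\<psi>\<close>, is constant in the radius. Comparing its limits at infinity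
  and at zero gives the claim. In the applications, invariance holds because the difference of two averages is
  the Laplacian of a test function; \<open>\<psi>\<close> is the curl of \<open>\<phi>\<close>, or \<open>w\<close> is zero.
\<close>
lemma liouville_principle:
  fixes u \<phi> :: "real^3 \<Rightarrow> 'b::euclidean_space" and w \<psi> :: "real^3 \<Rightarrow> 'c::euclidean_space"
  assumes u: "Lp_on (Suc p) UNIV u" and w: "Lp_on (Suc q) UNIV w"
    and t: "test_function UNIV \<phi>" "test_function UNIV \<psi>"
    and inv: "\<And>r R. r > 0 \<Longrightarrow> R > 0 \<Longrightarrow>
      (LINT x|lebesgue. u x \<bullet> conv (bump R) \<phi> x) - (LINT x|lebesgue. w x \<bullet> conv (bump R) \<psi> x) =
      (LINT x|lebesgue. u x \<bullet> conv (bump r) \<phi> x) - (LINT x|lebesgue. w x \<bullet> conv (bump r) \<psi> x)"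
  shows "(LINT x|lebesgue. u x \<bullet> \<phi> x) = (LINT x|lebesgue. w x \<bullet> \<psi> x)"
proof -
  let ?J = "\<lambda>R. (LINT x|lebesgue. u x \<bullet> conv (bump R) \<phi> x) - (LINT x|lebesgue. w x \<bullet> conv (bump R) \<psi> x)"
  have "(\<lambda>n. ?J (real (Suc n))) \<longlonglongrightarrow> 0 - 0"
    by (intro tendsto_diff integral_conv_bump_tendsto_0[OF u t(1)] integral_conv_bump_tendsto_0[OF w t(2)])
  moreover have "?J (real (Suc n)) = ?J 1" for n by (rule inv) simp_all
  ultimately have J: "?J 1 = 0" by (simp add: LIMSEQ_const_iff)
  have "(\<lambda>n. ?J (1 / real (Suc n))) \<longlonglongrightarrow> bump_mass * (LINT x|lebesgue. u x \<bullet> \<phi> x) - bump_mass * (LINT x|lebesgue. w x \<bullet> \<psi> x)"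
    by (intro tendsto_diff integral_conv_bump_tendsto Lp_on_imp_locally_integrable[OF u] Lp_on_imp_locally_integrable[OF w] t)
  moreover have "?J (1 / real (Suc n)) = ?J 1" for n by (rule inv) simp_all
  ultimately have "bump_mass * (LINT x|lebesgue. u x \<bullet> \<phi> x) - bump_mass * (LINT x|lebesgue. w x \<bullet> \<psi> x) = 0"
    using J by (simp add: LIMSEQ_const_iff)
  then show ?thesis using bump_mass_pos by simp
qed

section \<open>Weak derivatives\<close>

lemma locally_integrable_iff:
  "locally_integrable f \<longleftrightarrow> (\<forall>K. compact K \<longrightarrow> integrable lebesgue (\<lambda>x. indicator K x *\<^sub>R f x))"
  by (simp add: locally_integrable_def set_integrable_def)

lemma locally_integrable_continuous:
  fixes f :: "'a::euclidean_space \<Rightarrow> 'b::euclidean_space"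
  assumes "continuous_on UNIV f"
  shows "locally_integrable f"
  unfolding locally_integrable_iff
proof (intro allI impI)
  fix K :: "'a set" assume "compact K"
  then have "integrable lborel (\<lambda>x. indicator K x *\<^sub>R f x)"
    by (rule borel_integrable_compact) (rule continuous_on_subset[OF assms subset_UNIV])
  then show "integrable lebesgue (\<lambda>x. indicator K x *\<^sub>R f x)" by (simp add: integrable_completion)
qed

lemma locally_integrable_add_scaleR:
  fixes f g :: "'a::euclidean_space \<Rightarrow> 'b::euclidean_space"
  assumes "locally_integrable f" "locally_integrable g"
  shows "locally_integrable (\<lambda>x. f x + c *\<^sub>R g x)"
  unfolding locally_integrable_iff
proof (intro allI impI)
  fix K :: "'a set" assume K: "compact K"
  have "integrable lebesgue (\<lambda>x. indicator K x *\<^sub>R f x + c *\<^sub>R (indicator K x *\<^sub>R g x))"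
    by (intro Bochner_Integration.integrable_add integrable_scaleR_right locally_integrableD assms K)
  then show "integrable lebesgue (\<lambda>x. indicator K x *\<^sub>R (f x + c *\<^sub>R g x))"
    by (simp add: scaleR_add_right mult.commute)
qed

lemma
  fixes h :: "'b::real_normed_vector \<Rightarrow> 'c::real_normed_vector \<Rightarrow> 'd::euclidean_space"
    and f :: "real^'n \<Rightarrow> 'b"
  assumes h: "bounded_bilinear h" and f: "smooth_on UNIV f" and \<phi>: "test_function UNIV \<phi>"
  shows integrable_smooth_test: "integrable lebesgue (\<lambda>x. h (f x) (\<phi> x))"
    and integral_by_parts_test:
      "(LINT x|lebesgue. h (f x) (pderiv_at i \<phi> x)) = - (LINT x|lebesgue. h (pderiv_at i f x) (\<phi> x))"
proof -
  obtain K where K: "smooth_on UNIV \<phi>" "compact K" "\<And>x. x \<notin> K \<Longrightarrow> \<phi> x = 0"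
    using \<phi> unfolding test_function_iff by blast
  note K' = pderiv_at_eq_0_off_support[OF compact_imp_closed[OF K(2)] K(3)]
  show "integrable lebesgue (\<lambda>x. h (f x) (\<phi> x))"
    by (rule integrable_continuous_compact_support(2)[OF bounded_bilinear.continuous_on[OF h smooth_on_continuous[OF f] smooth_on_continuous[OF K(1)]] K(2)])
      (simp add: K(3) bounded_bilinear.zero_right[OF h])
  show "(LINT x|lebesgue. h (f x) (pderiv_at i \<phi> x)) = - (LINT x|lebesgue. h (pderiv_at i f x) (\<phi> x))"
    by (rule integral_by_parts[OF h smooth_on_differentiable[OF f] smooth_on_continuous[OF smooth_on_pderiv[OF f]]
          smooth_on_differentiable[OF K(1)] smooth_on_continuous[OF smooth_on_pderiv[OF K(1)]] K(2)])
      (simp_all add: K(3) K')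
qed

lemma has_weak_pderiv_smooth:
  fixes f :: "real^'n \<Rightarrow> 'b::euclidean_space"
  assumes f: "smooth_on UNIV f"
  shows "has_weak_pderiv i f (pderiv_at i f)"
  unfolding has_weak_pderiv_def
  using integral_by_parts_test[OF bounded_bilinear.flip[OF bounded_bilinear_scaleR] f]
  by (auto intro!: locally_integrable_continuous smooth_on_continuous smooth_on_pderiv f)

lemma has_weak_curl_smooth:
  assumes f: "smooth_on UNIV f"
  shows "has_weak_curl f (curl3 f)"
  unfolding has_weak_curl_def
proof (intro conjI allI impI locally_integrable_continuous smooth_on_continuous smooth_on_curl3 f)
  fix \<Phi> :: "real^3 \<Rightarrow> real^3" assume \<Phi>: "test_function UNIV \<Phi>"
  let ?f = "\<lambda>j x. f x $ j" and ?P = "\<lambda>j x. \<Phi> x $ j"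
  have f': "smooth_on UNIV (?f j)" "pderiv_at i f x $ j = pderiv_at i (?f j) x" for i j x
    by (auto intro!: smooth_on_nth f pderiv_at_nth[symmetric] smooth_on_differentiable)
  have P': "test_function UNIV (?P j)" "pderiv_at i \<Phi> x $ j = pderiv_at i (?P j) x" for i j x
    by (auto intro!: test_function_nth \<Phi> pderiv_at_nth[symmetric] smooth_on_differentiable test_function_smooth[OF \<Phi>])
  note int = integrable_smooth_test[OF bounded_bilinear_mult f'(1) test_function_pderiv[OF P'(1)]]
    integrable_smooth_test[OF bounded_bilinear_mult smooth_on_pderiv[OF f'(1)] P'(1)]
  note ibp = integral_by_parts_test[OF bounded_bilinear_mult f'(1) P'(1)]
  show "(LINT x|lebesgue. curl3 f x \<bullet> \<Phi> x) = (LINT x|lebesgue. f x \<bullet> curl3 \<Phi> x)"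
    by (simp add: inner_vec_def sum_3 f'(2) P'(2) left_diff_distrib right_diff_distrib int ibp)
qed

lemma weakly_div_free_smooth:
  fixes f :: "real^'n \<Rightarrow> real^'n"
  assumes f: "smooth_on UNIV f" and div: "\<And>x. divergence f x = 0"
  shows "weakly_div_free f"
  unfolding weakly_div_free_def
proof (intro conjI allI impI locally_integrable_continuous smooth_on_continuous f)
  fix \<phi> :: "real^'n \<Rightarrow> real" assume \<phi>: "test_function UNIV \<phi>"
  let ?f = "\<lambda>j x. f x $ j"
  have f': "smooth_on UNIV (?f j)" "pderiv_at i f x $ j = pderiv_at i (?f j) x" for i j x
    by (auto intro!: smooth_on_nth f pderiv_at_nth[symmetric] smooth_on_differentiable)
  have int: "integrable lebesgue (\<lambda>x. ?f j x * pderiv_at j \<phi> x)" "integrable lebesgue (\<lambda>x. pderiv_at j (?f j) x * \<phi> x)" for j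
    using integrable_smooth_test[OF bounded_bilinear_mult f'(1) test_function_pderiv[OF \<phi>]]
      integrable_smooth_test[OF bounded_bilinear_mult smooth_on_pderiv[OF f'(1)] \<phi>] by blast+
  have "(LINT x|lebesgue. f x \<bullet> gradient \<phi> x) = (\<Sum>j\<in>UNIV. LINT x|lebesgue. ?f j x * pderiv_at j \<phi> x)"
    by (simp add: inner_vec_def gradient_def int)
  also have "\<dots> = (\<Sum>j\<in>UNIV. - (LINT x|lebesgue. pderiv_at j (?f j) x * \<phi> x))"
    by (intro sum.cong refl integral_by_parts_test[OF bounded_bilinear_mult f'(1) \<phi>])
  also have "\<dots> = - (LINT x|lebesgue. (\<Sum>j\<in>UNIV. pderiv_at j (?f j) x) * \<phi> x)"
    by (simp add: sum_negf sum_distrib_right int)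
  also have "(\<lambda>x. \<Sum>j\<in>UNIV. pderiv_at j (?f j) x) = (\<lambda>x. 0)"
    using div by (simp add: divergence_def f'(2))
  then have "(LINT x|lebesgue. (\<Sum>j\<in>UNIV. pderiv_at j (?f j) x) * \<phi> x) = 0"
    by (simp add: fun_eq_iff)
  finally show "(LINT x|lebesgue. f x \<bullet> gradient \<phi> x) = 0" by simp
qed

lemma has_weak_curl_add_scaleR:
  assumes "has_weak_curl f g" "has_weak_curl f' g'"
  shows "has_weak_curl (\<lambda>x. f x + c *\<^sub>R f' x) (\<lambda>x. g x + c *\<^sub>R g' x)"
  unfolding has_weak_curl_def
proof (intro conjI allI impI)
  have li: "locally_integrable f" "locally_integrable g" "locally_integrable f'" "locally_integrable g'"
    using assms by (simp_all add: has_weak_curl_def)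
  then show "locally_integrable (\<lambda>x. f x + c *\<^sub>R f' x)" "locally_integrable (\<lambda>x. g x + c *\<^sub>R g' x)"
    by (simp_all add: locally_integrable_add_scaleR)
  fix \<Phi> :: "real^3 \<Rightarrow> real^3" assume \<Phi>: "test_function UNIV \<Phi>"
  note int = integrable_test_inner[OF li(1) test_function_curl3[OF \<Phi>]] integrable_test_inner[OF li(2) \<Phi>]
    integrable_test_inner[OF li(3) test_function_curl3[OF \<Phi>]] integrable_test_inner[OF li(4) \<Phi>]
  have "(LINT x|lebesgue. g x \<bullet> \<Phi> x) = (LINT x|lebesgue. f x \<bullet> curl3 \<Phi> x)"
    "(LINT x|lebesgue. g' x \<bullet> \<Phi> x) = (LINT x|lebesgue. f' x \<bullet> curl3 \<Phi> x)"
    using assms \<Phi> by (simp_all add: has_weak_curl_def)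
  then show "(LINT x|lebesgue. (g x + c *\<^sub>R g' x) \<bullet> \<Phi> x) = (LINT x|lebesgue. (f x + c *\<^sub>R f' x) \<bullet> curl3 \<Phi> x)"
    by (simp add: inner_add_left int)
qed

lemma weakly_div_free_add_scaleR:
  assumes "weakly_div_free f" "weakly_div_free g"
  shows "weakly_div_free (\<lambda>x. f x + c *\<^sub>R g x)"
  unfolding weakly_div_free_def
proof (intro conjI allI impI)
  have li: "locally_integrable f" "locally_integrable g"
    using assms by (simp_all add: weakly_div_free_def)
  then show "locally_integrable (\<lambda>x. f x + c *\<^sub>R g x)" by (rule locally_integrable_add_scaleR)
  fix \<phi> :: "real^'a \<Rightarrow> real" assume \<phi>: "test_function UNIV \<phi>"
  show "(LINT x|lebesgue. (f x + c *\<^sub>R g x) \<bullet> gradient \<phi> x) = 0"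
    using assms \<phi> integrable_test_inner[OF li(1) test_function_gradient[OF \<phi>]] integrable_test_inner[OF li(2) test_function_gradient[OF \<phi>]]
    by (simp add: inner_add_left weakly_div_free_def)
qed

lemma has_weak_pderiv_add_scaleR:
  fixes f f' :: "real^'n \<Rightarrow> 'b::euclidean_space"
  assumes "has_weak_pderiv i f g" "has_weak_pderiv i f' g'"
  shows "has_weak_pderiv i (\<lambda>x. f x + c *\<^sub>R f' x) (\<lambda>x. g x + c *\<^sub>R g' x)"
  unfolding has_weak_pderiv_def
proof (intro conjI allI impI)
  have li: "locally_integrable f" "locally_integrable g" "locally_integrable f'" "locally_integrable g'"
    using assms by (simp_all add: has_weak_pderiv_def)
  then show "locally_integrable (\<lambda>x. f x + c *\<^sub>R f' x)" "locally_integrable (\<lambda>x. g x + c *\<^sub>R g' x)"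
    by (simp_all add: locally_integrable_add_scaleR)
  fix \<phi> :: "real^'n \<Rightarrow> real" assume \<phi>: "test_function UNIV \<phi>"
  note int = integrable_test_scaleR[OF li(1) test_function_pderiv[OF \<phi>]] integrable_test_scaleR[OF li(2) \<phi>]
    integrable_test_scaleR[OF li(3) test_function_pderiv[OF \<phi>]] integrable_test_scaleR[OF li(4) \<phi>]
  have eq: "(LINT x|lebesgue. pderiv_at i \<phi> x *\<^sub>R f x) = - (LINT x|lebesgue. \<phi> x *\<^sub>R g x)"
    "(LINT x|lebesgue. pderiv_at i \<phi> x *\<^sub>R f' x) = - (LINT x|lebesgue. \<phi> x *\<^sub>R g' x)"
    using assms \<phi> by (simp_all add: has_weak_pderiv_def)
  have "(LINT x|lebesgue. pderiv_at i \<phi> x *\<^sub>R (f x + c *\<^sub>R f' x)) =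
      (LINT x|lebesgue. pderiv_at i \<phi> x *\<^sub>R f x) + c *\<^sub>R (LINT x|lebesgue. pderiv_at i \<phi> x *\<^sub>R f' x)"
    using int by (simp add: scaleR_add_right scaleR_left_commute[of _ c] del: scaleR_scaleR)
  also have "\<dots> = - ((LINT x|lebesgue. \<phi> x *\<^sub>R g x) + c *\<^sub>R (LINT x|lebesgue. \<phi> x *\<^sub>R g' x))"
    unfolding eq by simp
  also have "(LINT x|lebesgue. \<phi> x *\<^sub>R g x) + c *\<^sub>R (LINT x|lebesgue. \<phi> x *\<^sub>R g' x) = (LINT x|lebesgue. \<phi> x *\<^sub>R (g x + c *\<^sub>R g' x))"
    using int by (simp add: scaleR_add_right scaleR_left_commute[of _ c] del: scaleR_scaleR)
  finally show "(LINT x|lebesgue. pderiv_at i \<phi> x *\<^sub>R (f x + c *\<^sub>R f' x)) = - (LINT x|lebesgue. \<phi> x *\<^sub>R (g x + c *\<^sub>R g' x))" .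
qed

lemma weak_curl_testD:
  "has_weak_curl f g \<Longrightarrow> test_function UNIV \<Phi> \<Longrightarrow> (LINT x|lebesgue. g x \<bullet> \<Phi> x) = (LINT x|lebesgue. f x \<bullet> curl3 \<Phi> x)"
  unfolding has_weak_curl_def by blast

text \<open>
  The fundamental lemma applies to the difference of the two curls, tested with fields \<open>\<phi>\<close> times a unit vector.
\<close>
lemma has_weak_curl_unique:
  assumes "has_weak_curl f g" "has_weak_curl f g'"
  shows "AE x in lebesgue. g x = g' x"
proof -
  have li: "locally_integrable g" "locally_integrable g'"
    using assms by (simp_all add: has_weak_curl_def)
  let ?u = "\<lambda>x. g x + (- 1) *\<^sub>R g' x"
  have lu: "locally_integrable ?u" by (rule locally_integrable_add_scaleR[OF li])
  have "AE x in lebesgue. ?u x = 0"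
  proof (rule fundamental_lemma[OF lu])
    fix \<phi> :: "real^3 \<Rightarrow> real" assume \<phi>: "test_function UNIV \<phi>"
    have "(LINT x|lebesgue. \<phi> x *\<^sub>R ?u x) $ j = 0" for j
    proof -
      let ?\<Phi> = "\<lambda>x. \<phi> x *\<^sub>R axis j (1::real)"
      have t: "test_function UNIV ?\<Phi>" by (rule test_function_axis[OF \<phi>])
      have "(LINT x|lebesgue. \<phi> x *\<^sub>R ?u x) $ j = (LINT x|lebesgue. (\<phi> x *\<^sub>R ?u x) $ j)"
        by (rule integral_bounded_linear[OF bounded_linear_vec_nth integrable_test_scaleR[OF lu \<phi>], symmetric])
      also have "\<dots> = (LINT x|lebesgue. g x \<bullet> ?\<Phi> x - g' x \<bullet> ?\<Phi> x)"
        by (simp add: inner_axis algebra_simps)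
      also have "\<dots> = (LINT x|lebesgue. g x \<bullet> ?\<Phi> x) - (LINT x|lebesgue. g' x \<bullet> ?\<Phi> x)"
        by (rule Bochner_Integration.integral_diff[OF integrable_test_inner[OF li(1) t] integrable_test_inner[OF li(2) t]])
      also have "\<dots> = (LINT x|lebesgue. f x \<bullet> curl3 ?\<Phi> x) - (LINT x|lebesgue. f x \<bullet> curl3 ?\<Phi> x)"
        by (simp only: weak_curl_testD[OF assms(1) t] weak_curl_testD[OF assms(2) t])
      also have "\<dots> = 0" by simp
      finally show ?thesis .
    qed
    then show "(LINT x|lebesgue. \<phi> x *\<^sub>R ?u x) = 0" by (simp add: vec_eq_iff)
  qed
  then show ?thesis by eventually_elim simp
qed

lemma has_weak_curl_weak_curl: "has_weak_curl f g \<Longrightarrow> has_weak_curl f (weak_curl f)"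
  unfolding weak_curl_def by (rule someI[of "has_weak_curl f"])

lemma weak_curl_AE_eq: "has_weak_curl f g \<Longrightarrow> AE x in lebesgue. weak_curl f x = g x"
  by (rule has_weak_curl_unique[OF has_weak_curl_weak_curl])

section \<open>Lebesgue spaces\<close>

lemma Lp_on_add_scaleR:
  fixes f g :: "'a::euclidean_space \<Rightarrow> 'b::euclidean_space"
  assumes "Lp_on p S f" "Lp_on p S g"
  shows "Lp_on p S (\<lambda>x. f x + c *\<^sub>R g x)"
proof -
  have [measurable]: "f \<in> borel_measurable (lebesgue_on S)" "g \<in> borel_measurable (lebesgue_on S)"
    using assms by (simp_all add: Lp_on_def)
  have "integrable (lebesgue_on S) (\<lambda>x. norm (f x + c *\<^sub>R g x) ^ p)"
  proof (rule Bochner_Integration.integrable_bound)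
    show "integrable (lebesgue_on S) (\<lambda>x. 2 ^ p * (norm (f x) ^ p + \<bar>c\<bar> ^ p * norm (g x) ^ p))"
      using assms by (intro integrable_mult_right Bochner_Integration.integrable_add) (simp_all add: Lp_on_def)
    show "AE x in lebesgue_on S. norm (norm (f x + c *\<^sub>R g x) ^ p) \<le> norm (2 ^ p * (norm (f x) ^ p + \<bar>c\<bar> ^ p * norm (g x) ^ p))"
    proof (intro always_eventually allI)
      fix x
      let ?m = "max (norm (f x)) (\<bar>c\<bar> * norm (g x))"
      have "norm (f x + c *\<^sub>R g x) \<le> 2 * ?m"
        using norm_triangle_ineq[of "f x" "c *\<^sub>R g x"] by simp
      then have "norm (f x + c *\<^sub>R g x) ^ p \<le> (2 * ?m) ^ p"
        by (rule power_mono) simp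
      also have "\<dots> = 2 ^ p * ?m ^ p" by (rule power_mult_distrib)
      also have "?m ^ p \<le> norm (f x) ^ p + (\<bar>c\<bar> * norm (g x)) ^ p"
        by (auto simp: max_def)
      finally have le: "norm (f x + c *\<^sub>R g x) ^ p \<le> 2 ^ p * (norm (f x) ^ p + \<bar>c\<bar> ^ p * norm (g x) ^ p)"
        by (simp add: power_mult_distrib)
      have "0 \<le> 2 ^ p * (norm (f x) ^ p + \<bar>c\<bar> ^ p * norm (g x) ^ p)"
        by (intro mult_nonneg_nonneg add_nonneg_nonneg zero_le_power) simp_all
      with le show "norm (norm (f x + c *\<^sub>R g x) ^ p) \<le> norm (2 ^ p * (norm (f x) ^ p + \<bar>c\<bar> ^ p * norm (g x) ^ p))"
        by (simp only: real_norm_def abs_of_nonneg zero_le_power norm_ge_zero)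
    qed
  qed measurable
  then show ?thesis by (simp add: Lp_on_def)
qed

lemma Lp_on_test:
  fixes \<phi> :: "'a::euclidean_space \<Rightarrow> 'b::euclidean_space"
  assumes "test_function UNIV \<phi>"
  shows "Lp_on (Suc p) UNIV \<phi>"
proof -
  obtain K where K: "smooth_on UNIV \<phi>" "compact K" "\<And>x. x \<notin> K \<Longrightarrow> \<phi> x = 0"
    using assms unfolding test_function_iff by blast
  note c = smooth_on_continuous[OF K(1)]
  have "integrable lebesgue (\<lambda>x. norm (\<phi> x) ^ Suc p)"
    by (rule integrable_continuous_compact_support(2)[OF _ K(2)])
      (auto intro!: continuous_intros c simp: K(3))
  moreover have "\<phi> \<in> borel_measurable lebesgue"
    using borel_measurable_continuous_onI[OF c] by (intro measurable_completion) simp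
  ultimately show ?thesis by (simp add: Lp_on_UNIV)
qed

lemma Lp_on_subset:
  fixes f :: "'a::euclidean_space \<Rightarrow> 'b::euclidean_space"
  assumes f: "Lp_on p T f" and S: "S \<subseteq> T" "S \<in> sets lebesgue" "T \<in> sets lebesgue"
  shows "Lp_on p S f"
proof -
  have "f \<in> borel_measurable (lebesgue_on S)"
    by (rule measurable_restrict_mono[OF _ S(1)]) (use f in \<open>simp add: Lp_on_def\<close>)
  moreover have "set_integrable lebesgue S (\<lambda>x. norm (f x) ^ p)"
    by (rule set_integrable_subset[OF _ S(2,1)])
      (use f S(3) in \<open>simp add: Lp_on_def set_integrable_def integrable_restrict_space\<close>)
  ultimately show ?thesis
    using S(2) by (simp add: Lp_on_def set_integrable_def integrable_restrict_space)
qed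

lemma Lp_on_cong_AE:
  fixes f g :: "'a::euclidean_space \<Rightarrow> 'b::euclidean_space"
  assumes "Lp_on p S f" "g \<in> borel_measurable (lebesgue_on S)" "AE x in lebesgue_on S. f x = g x"
  shows "Lp_on p S g"
proof -
  have [measurable]: "f \<in> borel_measurable (lebesgue_on S)" using assms(1) by (simp add: Lp_on_def)
  note [measurable] = assms(2)
  have "integrable (lebesgue_on S) (\<lambda>x. norm (f x) ^ p) \<longleftrightarrow> integrable (lebesgue_on S) (\<lambda>x. norm (g x) ^ p)"
    by (rule integrable_cong_AE) (measurable, use assms(3) in \<open>eventually_elim, simp\<close>)
  then show ?thesis using assms by (simp add: Lp_on_def)
qed

lemma Lp_on_linear_image_le:
  fixes f :: "'a::euclidean_space \<Rightarrow> 'b::euclidean_space" and h :: "'b \<Rightarrow> 'c::euclidean_space"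
  assumes f: "Lp_on p S f" and h: "bounded_linear h" and le: "\<And>v. norm (h v) \<le> norm v"
  shows "Lp_on p S (\<lambda>x. h (f x))"
proof -
  have m: "(\<lambda>x. h (f x)) \<in> borel_measurable (lebesgue_on S)"
    using f borel_measurable_continuous_onI[OF linear_continuous_on[OF h]]
    by (auto simp: Lp_on_def intro: measurable_compose)
  have "integrable (lebesgue_on S) (\<lambda>x. norm (h (f x)) ^ p)"
  proof (rule Bochner_Integration.integrable_bound)
    show "integrable (lebesgue_on S) (\<lambda>x. norm (f x) ^ p)" using f by (simp add: Lp_on_def)
    show "(\<lambda>x. norm (h (f x)) ^ p) \<in> borel_measurable (lebesgue_on S)"
      using m by measurable
    show "AE x in lebesgue_on S. norm (norm (h (f x)) ^ p) \<le> norm (norm (f x) ^ p)"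
      by (intro always_eventually allI) (simp add: power_mono le)
  qed
  with m show ?thesis by (simp add: Lp_on_def)
qed

lemma integrable_L2_inner:
  fixes f g :: "'a::euclidean_space \<Rightarrow> 'b::euclidean_space"
  assumes "Lp_on 2 S f" "Lp_on 2 S g"
  shows "integrable (lebesgue_on S) (\<lambda>x. f x \<bullet> g x)"
proof (rule Bochner_Integration.integrable_bound)
  have [measurable]: "f \<in> borel_measurable (lebesgue_on S)" "g \<in> borel_measurable (lebesgue_on S)"
    using assms by (simp_all add: Lp_on_def)
  show "integrable (lebesgue_on S) (\<lambda>x. (norm (f x))\<^sup>2 + (norm (g x))\<^sup>2)"
    using assms by (intro Bochner_Integration.integrable_add) (simp_all add: Lp_on_def)
  show "(\<lambda>x. f x \<bullet> g x) \<in> borel_measurable (lebesgue_on S)" by measurable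
  show "AE x in lebesgue_on S. norm (f x \<bullet> g x) \<le> norm ((norm (f x))\<^sup>2 + (norm (g x))\<^sup>2)"
  proof (intro always_eventually allI)
    fix x
    have "\<bar>f x \<bullet> g x\<bar> \<le> norm (f x) * norm (g x)" by (rule Cauchy_Schwarz_ineq2)
    also have "\<dots> \<le> (norm (f x))\<^sup>2 + (norm (g x))\<^sup>2"
      using sum_squares_bound[of "norm (f x)" "norm (g x)"] mult_nonneg_nonneg[OF norm_ge_zero norm_ge_zero, of "f x" "g x"]
      by linarith
    finally show "norm (f x \<bullet> g x) \<le> norm ((norm (f x))\<^sup>2 + (norm (g x))\<^sup>2)" by simp
  qed
qed

lemma L2_norm_on_power2: "(L2_norm_on S f)\<^sup>2 = (LINT x|lebesgue_on S. (norm (f x))\<^sup>2)"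
  unfolding L2_norm_on_def by (rule real_sqrt_pow2) simp

lemma L2_norm_on_add_scaleR:
  fixes f g :: "'a::euclidean_space \<Rightarrow> 'b::euclidean_space"
  assumes "Lp_on 2 S f" "Lp_on 2 S g"
  shows "(L2_norm_on S (\<lambda>x. f x + t *\<^sub>R g x))\<^sup>2 =
    (L2_norm_on S f)\<^sup>2 + 2 * t * (LINT x|lebesgue_on S. f x \<bullet> g x) + t\<^sup>2 * (L2_norm_on S g)\<^sup>2"
proof -
  have int: "integrable (lebesgue_on S) (\<lambda>x. (norm (f x))\<^sup>2)" "integrable (lebesgue_on S) (\<lambda>x. (norm (g x))\<^sup>2)"
    using assms by (simp_all add: Lp_on_def)
  have eq: "(norm (f x + t *\<^sub>R g x))\<^sup>2 = (norm (f x))\<^sup>2 + 2 * t * (f x \<bullet> g x) + t\<^sup>2 * (norm (g x))\<^sup>2" for x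
    unfolding power2_norm_eq_inner
    by (simp add: inner_add_left inner_add_right inner_commute algebra_simps power2_eq_square)
  show ?thesis
    unfolding L2_norm_on_power2 eq using int integrable_L2_inner[OF assms] by simp
qed

lemma L2_norm_on_cong_AE:
  fixes f g :: "'a::euclidean_space \<Rightarrow> 'b::euclidean_space"
  assumes "f \<in> borel_measurable (lebesgue_on S)" "g \<in> borel_measurable (lebesgue_on S)" "AE x in lebesgue_on S. f x = g x"
  shows "L2_norm_on S f = L2_norm_on S g"
proof -
  note [measurable] = assms(1,2)
  have "(LINT x|lebesgue_on S. (norm (f x))\<^sup>2) = (LINT x|lebesgue_on S. (norm (g x))\<^sup>2)"
    by (rule integral_cong_AE) (measurable, use assms(3) in \<open>eventually_elim, simp\<close>)
  then show ?thesis by (simp add: L2_norm_on_def)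
qed

text \<open>
  A minimum at \<open>t = 0\<close> forces the linear term to vanish. For \<open>b \<noteq> 0\<close> one takes \<open>t\<close> of the sign opposite to \<open>b\<close> and so
  small that the quadratic term cannot compensate the linear one.
\<close>
lemma linear_coefficient_eq_0:
  fixes b c \<delta> :: real
  assumes \<delta>: "\<delta> > 0" and nonneg: "\<And>t. \<bar>t\<bar> < \<delta> \<Longrightarrow> 0 \<le> t * b + t\<^sup>2 * c"
  shows "b = 0"
proof (rule ccontr)
  assume "b \<noteq> 0"
  define t where "t = min (\<delta> / 2) (\<bar>b\<bar> / (2 * (\<bar>c\<bar> + 1)))"
  have t: "0 < t" "t < \<delta>" using \<delta> \<open>b \<noteq> 0\<close> by (auto simp: t_def)
  have "t * (\<bar>c\<bar> + 1) \<le> \<bar>b\<bar> / 2"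
  proof -
    have "t \<le> \<bar>b\<bar> / (2 * (\<bar>c\<bar> + 1))" by (simp add: t_def)
    then have "t * (2 * (\<bar>c\<bar> + 1)) \<le> \<bar>b\<bar>" by (subst (asm) pos_le_divide_eq) simp_all
    then show ?thesis by (simp add: algebra_simps)
  qed
  moreover have "t * c \<le> t * \<bar>c\<bar>" using t by (intro mult_left_mono) auto
  ultimately have tc: "t * c < \<bar>b\<bar>" using t unfolding distrib_left by linarith
  \<comment> \<open>Now \<open>s b\<close> is negative.\<close>
  define s where "s = (if b > 0 then - t else t)"
  have "0 \<le> s * b + s\<^sup>2 * c" using t by (intro nonneg) (simp add: s_def)
  also have "s * b + s\<^sup>2 * c = t * (t * c - \<bar>b\<bar>)"
    using \<open>b \<noteq> 0\<close> by (simp add: s_def power2_eq_square algebra_simps)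
  also have "\<dots> < 0" using t tc by (simp add: mult_pos_neg)
  finally show False by simp
qed

section \<open>Horizontal components and the cylinder\<close>

lemma hat_nth [simp]: "hat w $ 1 = w $ 1" "hat w $ 2 = w $ 2"
  by (simp_all add: hat_def)

lemma bounded_linear_hat: "bounded_linear hat"
  unfolding linear_conv_bounded_linear[symmetric]
  by (rule linearI) (simp_all add: vec_eq_iff forall_2)

lemma norm_hat_le: "norm (hat w) \<le> norm w"
  unfolding norm_le by (simp add: inner_vec_def sum_2 sum_3)

lemma hat_add_scaleR: "hat (x + c *\<^sub>R y) = hat x + c *\<^sub>R hat y"
  by (simp add: vec_eq_iff forall_2)

lemma open_cylinder:
  assumes "open \<Omega>"
  shows "open (cylinder \<Omega> L)"
proof -
  have "open (hat -` \<Omega> \<inter> {x. 0 < x $ 3} \<inter> {x. x $ 3 < L})"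
    by (intro open_Int open_vimage assms open_Collect_less continuous_intros linear_continuous_on[OF bounded_linear_hat])
  then show ?thesis by (simp add: cylinder_def vimage_def Collect_conj_eq Int_assoc)
qed

lemma bounded_cylinder:
  assumes "bounded \<Omega>"
  shows "bounded (cylinder \<Omega> L)"
proof -
  obtain C where C: "\<And>w. w \<in> \<Omega> \<Longrightarrow> norm w \<le> C" using assms unfolding bounded_iff by blast
  have "norm x \<le> C + C + L" if "x \<in> cylinder \<Omega> L" for x
  proof -
    have "\<bar>x $ 1\<bar> \<le> C" "\<bar>x $ 2\<bar> \<le> C"
      using that C[of "hat x"] component_le_norm_cart[of "hat x" 1] component_le_norm_cart[of "hat x" 2]
      by (auto simp: cylinder_def)
    moreover have "\<bar>x $ 3\<bar> \<le> L" using that by (auto simp: cylinder_def)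
    ultimately show ?thesis using norm_le_l1_cart[of x] by (simp add: sum_3)
  qed
  then show ?thesis unfolding bounded_iff by blast
qed

lemma integral_lebesgue_on_eq:
  fixes f :: "'a::euclidean_space \<Rightarrow> 'b::{banach, second_countable_topology}"
  assumes "S \<in> sets lebesgue" "\<And>x. x \<notin> S \<Longrightarrow> f x = 0"
  shows "integral\<^sup>L (lebesgue_on S) f = integral\<^sup>L lebesgue f"
proof -
  have "(\<lambda>x. indicator S x *\<^sub>R f x) = f"
    using assms(2) by (force simp: indicator_def)
  then show ?thesis using assms(1) by (simp add: integral_restrict_space)
qed

text \<open>
  This makes \<open>v0 + t hat (grad q)\<close> a competitor with the same curl measure as \<open>v0\<close>. After one more integration
  by parts the two terms are the mixed second derivatives of \<open>q\<close>, which cancel by symmetry.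
\<close>
lemma integral_gradient_curl_eq_0:
  fixes q \<phi> :: "real^3 \<Rightarrow> real"
  assumes D: "D \<in> sets lebesgue" and q: "smooth_on UNIV q" and \<phi>: "test_function D \<phi>"
  shows "(LINT x|lebesgue_on D. pderiv_at 1 q x * pderiv_at 2 \<phi> x - pderiv_at 2 q x * pderiv_at 1 \<phi> x) = 0"
proof -
  have \<phi>U: "test_function UNIV \<phi>" by (rule test_function_mono[OF \<phi>]) simp
  have 0: "pderiv_at i \<phi> x = 0" if "x \<notin> D" for i x
    using test_function_pderiv[OF \<phi>, of i] that unfolding test_function_iff by blast
  note int = integrable_smooth_test[OF bounded_bilinear_mult smooth_on_pderiv[OF q] test_function_pderiv[OF \<phi>U]]
  note ibp = integral_by_parts_test[OF bounded_bilinear_mult smooth_on_pderiv[OF q] \<phi>U]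
  have "(LINT x|lebesgue_on D. pderiv_at 1 q x * pderiv_at 2 \<phi> x - pderiv_at 2 q x * pderiv_at 1 \<phi> x) =
      (LINT x|lebesgue. pderiv_at 1 q x * pderiv_at 2 \<phi> x - pderiv_at 2 q x * pderiv_at 1 \<phi> x)"
    by (rule integral_lebesgue_on_eq[OF D]) (simp add: 0)
  also have "\<dots> = (LINT x|lebesgue. pderiv_at 1 q x * pderiv_at 2 \<phi> x) - (LINT x|lebesgue. pderiv_at 2 q x * pderiv_at 1 \<phi> x)"
    by (rule Bochner_Integration.integral_diff[OF int int])
  also have "\<dots> = 0"
    unfolding ibp by (simp add: pderiv_at_symmetric[OF q, of 2 1])
  finally show ?thesis .
qed

section \<open>Admissible variations of the magnetic potential\<close>

text \<open>
  The approximating test fields of \<open>A - a\<close> are shifted by \<open>t \<psi>\<close>, which leaves the distances to the limit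
  gradients unchanged.
\<close>
lemma K0_space_add_scaleR:
  assumes A: "A \<in> K0_space a" and \<psi>: "test_function UNIV \<psi>" and div: "\<And>x. divergence \<psi> x = 0"
  shows "(\<lambda>x. A x + t *\<^sub>R \<psi> x) \<in> K0_space a"
proof -
  note s = test_function_smooth[OF \<psi>]
  have H1: "H1_loc (\<lambda>x. A x + t *\<^sub>R \<psi> x)"
    unfolding H1_loc_def
  proof (intro conjI allI impI)
    have A': "H1_loc A" using A by (simp add: K0_space_def E0_space_def)
    have loc: "Lp_on 2 K f" if "test_function UNIV f" "compact K" for K and f :: "real^3 \<Rightarrow> real^3"
      by (rule Lp_on_subset[OF Lp_on_test[OF that(1), of 1, unfolded Suc_1] subset_UNIV])
        (simp_all add: fmeasurableD lmeasurable_compact that(2))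
    show "Lp_on 2 K (\<lambda>x. A x + t *\<^sub>R \<psi> x)" if "compact K" for K
      using A' that by (intro Lp_on_add_scaleR loc[OF \<psi>]) (simp_all add: H1_loc_def)
    fix i :: 3
    obtain g where g: "has_weak_pderiv i A g" "\<And>K. compact K \<Longrightarrow> Lp_on 2 K g"
      using A' unfolding H1_loc_def by blast
    show "\<exists>g. has_weak_pderiv i (\<lambda>x. A x + t *\<^sub>R \<psi> x) g \<and> (\<forall>K. compact K \<longrightarrow> Lp_on 2 K g)"
      by (intro exI[of _ "\<lambda>x. g x + t *\<^sub>R pderiv_at i \<psi> x"] conjI allI impI
          has_weak_pderiv_add_scaleR[OF g(1) has_weak_pderiv_smooth[OF s]]
          Lp_on_add_scaleR g(2) loc test_function_pderiv \<psi>)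
  qed
  obtain B where B: "has_weak_curl A B" "Lp_on 2 UNIV (\<lambda>x. B x - e3)"
    using A by (auto simp: K0_space_def E0_space_def)
  have "Lp_on 2 UNIV (curl3 \<psi>)"
    using Lp_on_test[OF test_function_curl3[OF \<psi>], of 1] by (simp add: numeral_2_eq_2)
  from Lp_on_add_scaleR[OF B(2) this, of t]
  have "Lp_on 2 UNIV (\<lambda>x. (B x + t *\<^sub>R curl3 \<psi> x) - e3)" by (simp add: algebra_simps)
  with H1 has_weak_curl_add_scaleR[OF B(1) has_weak_curl_smooth[OF s], of t]
  have E0: "(\<lambda>x. A x + t *\<^sub>R \<psi> x) \<in> E0_space"
    unfolding E0_space_def by blast
  have divA: "weakly_div_free (\<lambda>x. A x + t *\<^sub>R \<psi> x)"
  proof (rule weakly_div_free_add_scaleR[OF _ weakly_div_free_smooth[OF s div]])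
    show "weakly_div_free A" using A by (simp add: K0_space_def)
  qed
  have eq: "(\<lambda>x. A x + t *\<^sub>R \<psi> x - a x) = (\<lambda>x. (A x - a x) + t *\<^sub>R \<psi> x)"
    by (simp add: algebra_simps)
  have "check_H1 (\<lambda>x. (A x - a x) + t *\<^sub>R \<psi> x)"
  proof -
    obtain G \<phi> where G: "\<And>i. has_weak_pderiv i (\<lambda>x. A x - a x) (G i)" "\<And>i. Lp_on 2 UNIV (G i)"
        and \<phi>: "\<And>n::nat. test_function UNIV (\<phi> n)"
        and lim: "\<And>i. (\<lambda>n. L2_norm_on UNIV (\<lambda>x. pderiv_at i (\<phi> n) x - G i x)) \<longlonglongrightarrow> 0"
      using A unfolding K0_space_def check_H1_def by blast
    have p: "pderiv_at i (\<lambda>x. \<phi> n x + t *\<^sub>R \<psi> x) x = pderiv_at i (\<phi> n) x + t *\<^sub>R pderiv_at i \<psi> x" for i n x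
      using pderiv_at_add[OF smooth_on_differentiable[OF test_function_smooth[OF \<phi>[of n]]]
          smooth_on_differentiable[OF test_function_smooth[OF test_function_scaleR[OF \<psi>, of t]]]]
        pderiv_at_linear[OF bounded_linear_scaleR_right[of t] smooth_on_differentiable[OF s]]
      by simp
    show ?thesis
      unfolding check_H1_def
    proof (rule exI[of _ "\<lambda>i x. G i x + t *\<^sub>R pderiv_at i \<psi> x"], rule exI[of _ "\<lambda>n x. \<phi> n x + t *\<^sub>R \<psi> x"], intro conjI allI)
      show "has_weak_pderiv i (\<lambda>x. (A x - a x) + t *\<^sub>R \<psi> x) (\<lambda>x. G i x + t *\<^sub>R pderiv_at i \<psi> x)" for i
        by (rule has_weak_pderiv_add_scaleR[OF G(1) has_weak_pderiv_smooth[OF s]])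
      show "Lp_on 2 UNIV (\<lambda>x. G i x + t *\<^sub>R pderiv_at i \<psi> x)" for i
        using Lp_on_test[OF test_function_pderiv[OF \<psi>], of 1] by (intro Lp_on_add_scaleR G(2)) (simp add: numeral_2_eq_2)
      show "test_function UNIV (\<lambda>x. \<phi> n x + t *\<^sub>R \<psi> x)" for n
        by (intro test_function_add test_function_scaleR \<phi> \<psi>)
      show "(\<lambda>n. L2_norm_on UNIV (\<lambda>x. pderiv_at i (\<lambda>x. \<phi> n x + t *\<^sub>R \<psi> x) x - (G i x + t *\<^sub>R pderiv_at i \<psi> x))) \<longlonglongrightarrow> 0" for i
        unfolding p using lim[of i] by simp
    qed
  qed
  moreover have "Lp_on 6 UNIV (\<lambda>x. (A x - a x) + t *\<^sub>R \<psi> x)"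
    using A Lp_on_test[OF \<psi>, of 5] by (intro Lp_on_add_scaleR) (simp_all add: K0_space_def)
  ultimately show ?thesis
    using E0 divA unfolding K0_space_def mem_Collect_eq eq by blast
qed

section \<open>The Euler--Lagrange equations\<close>

locale minimizer =
  fixes D :: "(real^3) set" and h0 :: real and a A0 :: "real^3 \<Rightarrow> real^3" and v0 :: "real^3 \<Rightarrow> real^2"
  assumes open_D: "open D" and bounded_D: "bounded D" and h0: "h0 > 0"
    and smooth_a: "smooth_on UNIV a" and curl_a: "\<And>x. curl3 a x = e3" and div_a: "\<And>x. divergence a x = 0"
    and v0: "v0 \<in> V_space D" and A0: "A0 \<in> K0_space a"
    and minimal: "\<And>v A. v \<in> V_space D \<Longrightarrow> A \<in> K0_space a \<Longrightarrow> G_energy D h0 v0 A0 \<le> G_energy D h0 v A"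
begin

definition C0 :: "real^3 \<Rightarrow> real^3" where
  "C0 x = A0 x - a x"

definition B0 :: "real^3 \<Rightarrow> real^3" where
  "B0 = weak_curl C0"

definition J :: "real^3 \<Rightarrow> real^2" where
  "J x = v0 x - hat (A0 x)"

text \<open>
  By the Euler--Lagrange equations this is the curl of \<open>B0\<close>.
\<close>
definition F :: "real^3 \<Rightarrow> real^3" where
  "F x = (if x \<in> D then vector [J x $ 1, J x $ 2, 0] else 0)"

lemma D_sets: "D \<in> sets lebesgue"
  using open_D by (intro sets_completionI_sets) simp

lemma L2_v0: "Lp_on 2 D v0"
  using v0 by (simp add: V_space_def)

lemma L2_test: "test_function UNIV (\<phi> :: real^3 \<Rightarrow> 'b::euclidean_space) \<Longrightarrow> Lp_on 2 UNIV \<phi>"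
  using Lp_on_test[of \<phi> 1] by (simp add: numeral_2_eq_2)

lemma L2_D: "Lp_on 2 UNIV (f :: real^3 \<Rightarrow> 'b::euclidean_space) \<Longrightarrow> Lp_on 2 D f"
  by (erule Lp_on_subset) (simp_all add: D_sets)

lemma L2_D_hat: "Lp_on 2 D f \<Longrightarrow> Lp_on 2 D (\<lambda>x. hat (f x))"
  by (rule Lp_on_linear_image_le[OF _ bounded_linear_hat norm_hat_le])

lemma L2_J: "Lp_on 2 D J"
proof -
  have "compact (closure D)" using bounded_D by (simp add: compact_closure)
  then have "Lp_on 2 (closure D) A0"
    using A0 by (simp add: K0_space_def E0_space_def H1_loc_def)
  then have "Lp_on 2 D A0"
    by (rule Lp_on_subset[OF _ closure_subset D_sets]) simp
  from Lp_on_add_scaleR[OF L2_v0 L2_D_hat[OF this], of "- 1"]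
  show ?thesis by (simp add: J_def[abs_def])
qed

lemma weak_curl_C0:
  shows "has_weak_curl C0 B0" "Lp_on 2 UNIV B0" "AE x in lebesgue. weak_curl A0 x - e3 = B0 x"
    and has_weak_curl_A0: "has_weak_curl A0 (weak_curl A0)"
proof -
  obtain B where B: "has_weak_curl A0 B" "Lp_on 2 UNIV (\<lambda>x. B x - e3)"
    using A0 by (auto simp: K0_space_def E0_space_def)
  show "has_weak_curl A0 (weak_curl A0)" by (rule has_weak_curl_weak_curl[OF B(1)])
  have "has_weak_curl (\<lambda>x. A0 x + (- 1) *\<^sub>R a x) (\<lambda>x. B x + (- 1) *\<^sub>R curl3 a x)"
    by (rule has_weak_curl_add_scaleR[OF B(1) has_weak_curl_smooth[OF smooth_a]])
  then have c: "has_weak_curl C0 (\<lambda>x. B x - e3)" by (simp add: C0_def[abs_def] curl_a)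
  then show w: "has_weak_curl C0 B0" unfolding B0_def by (rule has_weak_curl_weak_curl)
  have ae: "AE x in lebesgue. B0 x = B x - e3"
    unfolding B0_def by (rule weak_curl_AE_eq[OF c])
  have m: "B0 \<in> borel_measurable lebesgue"
    using w by (intro locally_integrable_measurable) (simp add: has_weak_curl_def)
  show "Lp_on 2 UNIV B0"
    by (rule Lp_on_cong_AE[OF B(2)]) (unfold lebesgue_on_UNIV_eq, fact m, use ae in \<open>eventually_elim, simp\<close>)
  show "AE x in lebesgue. weak_curl A0 x - e3 = B0 x"
    using weak_curl_AE_eq[OF B(1)] ae by eventually_elim simp
qed

text \<open>
  The energy contains a chosen representative of the weak curl; by uniqueness it may be replaced by the
  explicit one.
\<close>
lemma magnetic_energy:
  assumes \<psi>: "test_function UNIV \<psi>"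
  shows "L2_norm_on UNIV (\<lambda>x. weak_curl (\<lambda>x. A0 x + t *\<^sub>R \<psi> x) x - e3) = L2_norm_on UNIV (\<lambda>x. B0 x + t *\<^sub>R curl3 \<psi> x)"
proof -
  note c = has_weak_curl_add_scaleR[OF has_weak_curl_A0 has_weak_curl_smooth[OF test_function_smooth[OF \<psi>]], of t]
  have "locally_integrable (weak_curl (\<lambda>x. A0 x + t *\<^sub>R \<psi> x))"
    using has_weak_curl_weak_curl[OF c] by (simp add: has_weak_curl_def)
  then have [measurable]: "weak_curl (\<lambda>x. A0 x + t *\<^sub>R \<psi> x) \<in> borel_measurable lebesgue"
    by (rule locally_integrable_measurable)
  have m: "(\<lambda>x. B0 x + t *\<^sub>R curl3 \<psi> x) \<in> borel_measurable lebesgue"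
    using Lp_on_add_scaleR[OF weak_curl_C0(2) L2_test[OF test_function_curl3[OF \<psi>]], of t] by (simp add: Lp_on_UNIV)
  show ?thesis
  proof (rule L2_norm_on_cong_AE)
    show "(\<lambda>x. B0 x + t *\<^sub>R curl3 \<psi> x) \<in> borel_measurable (lebesgue_on UNIV)"
      using m by (simp add: lebesgue_on_UNIV_eq)
    show "(\<lambda>x. weak_curl (\<lambda>x. A0 x + t *\<^sub>R \<psi> x) x - e3) \<in> borel_measurable (lebesgue_on UNIV)"
      unfolding lebesgue_on_UNIV_eq by measurable
    have "AE x in lebesgue. weak_curl (\<lambda>x. A0 x + t *\<^sub>R \<psi> x) x - e3 = B0 x + t *\<^sub>R curl3 \<psi> x"
      using weak_curl_AE_eq[OF c] weak_curl_C0(3) by eventually_elim (auto simp: algebra_simps)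
    then show "AE x in lebesgue_on UNIV. weak_curl (\<lambda>x. A0 x + t *\<^sub>R \<psi> x) x - e3 = B0 x + t *\<^sub>R curl3 \<psi> x"
      unfolding lebesgue_on_UNIV_eq .
  qed
qed

lemma curl3_zero: "curl3 (\<lambda>x. 0) x = 0"
  by (simp add: vec_eq_iff forall_3 pderiv_at_def)

lemma divergence_zero: "divergence (\<lambda>x. 0) x = 0"
  by (simp add: divergence_def pderiv_at_def)

lemma test_function_zero: "test_function U (\<lambda>x::'x::euclidean_space. 0::'y::euclidean_space)"
  using test_function_sum[of "{}"] by simp

text \<open>
  Both quadratic terms of the energy are expanded in \<open>t\<close>, while the total variation is assumed to be affine in \<open>t\<close>
  with relative slope \<open>\<kappa>\<close>. The three uses are \<open>\<kappa> = 0\<close> with a variation of \<open>A0\<close> alone, \<open>\<kappa> = 0\<close> with a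
  variation of \<open>v0\<close> by a gradient, and \<open>\<kappa> = 1\<close> for the scaling of \<open>v0\<close>. The range \<open>\<bar>t\<bar> < 1\<close> keeps the
  scaling factor \<open>1 + t\<close> positive.
\<close>
lemma first_variation:
  assumes \<psi>: "test_function UNIV \<psi>" "\<And>x. divergence \<psi> x = 0" and w: "Lp_on 2 D w"
    and v: "\<And>t. \<bar>t\<bar> < 1 \<Longrightarrow> v t \<in> V_space D" "\<And>t x. v t x - hat (A0 x + t *\<^sub>R \<psi> x) = J x + t *\<^sub>R w x"
      "\<And>t. \<bar>t\<bar> < 1 \<Longrightarrow> total_variation D (curl_measure D (v t)) = (1 + t * \<kappa>) * total_variation D (curl_measure D v0)"
  shows "(LINT x|lebesgue_on D. J x \<bullet> w x) + (LINT x|lebesgue. B0 x \<bullet> curl3 \<psi> x) +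
    \<kappa> / (2 * h0) * total_variation D (curl_measure D v0) = 0"
proof (rule linear_coefficient_eq_0[of 1 _ "((L2_norm_on D w)\<^sup>2 + (L2_norm_on UNIV (curl3 \<psi>))\<^sup>2) / 2"])
  fix t :: real assume t: "\<bar>t\<bar> < 1"
  have expand: "0 \<le> t * (p + q + \<kappa> / (2 * h0) * T) + t\<^sup>2 * ((c + d) / 2)"
    if "1 / 2 * (e + 1 / h0 * T + b) \<le>
      1 / 2 * ((e + 2 * t * p + t\<^sup>2 * c) + 1 / h0 * ((1 + t * \<kappa>) * T) + (b + 2 * t * q + t\<^sup>2 * d))"
    for p q c d e b T :: real
  proof -
    have "1 / h0 * ((1 + t * \<kappa>) * T) = 1 / h0 * T + 2 * t * (\<kappa> / (2 * h0) * T)"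
      by (simp add: algebra_simps)
    with that show ?thesis by (simp add: algebra_simps add_divide_distrib)
  qed
  have magnetic_A0: "L2_norm_on UNIV (\<lambda>x. weak_curl A0 x - e3) = L2_norm_on UNIV B0"
    using magnetic_energy[OF \<psi>(1), of 0] by simp
  have "G_energy D h0 v0 A0 \<le> G_energy D h0 (v t) (\<lambda>x. A0 x + t *\<^sub>R \<psi> x)"
    by (intro minimal v(1) t K0_space_add_scaleR A0 \<psi>)
  then show "0 \<le> t * ((LINT x|lebesgue_on D. J x \<bullet> w x) + (LINT x|lebesgue. B0 x \<bullet> curl3 \<psi> x) +
      \<kappa> / (2 * h0) * total_variation D (curl_measure D v0)) +
      t\<^sup>2 * (((L2_norm_on D w)\<^sup>2 + (L2_norm_on UNIV (curl3 \<psi>))\<^sup>2) / 2)"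
    unfolding G_energy_def magnetic_A0 v(2) v(3)[OF t] magnetic_energy[OF \<psi>(1)] J_def[symmetric]
      L2_norm_on_add_scaleR[OF L2_J w] L2_norm_on_add_scaleR[OF weak_curl_C0(2) L2_test[OF test_function_curl3[OF \<psi>(1)]]]
      lebesgue_on_UNIV_eq
    by (intro expand) simp
qed simp

lemma euler_lagrange_A:
  assumes \<eta>: "test_function UNIV \<eta>"
  shows "(LINT x|lebesgue_on D. J x \<bullet> hat (curl3 \<eta> x)) = (LINT x|lebesgue. B0 x \<bullet> curl3 (curl3 \<eta>) x)"
proof -
  have \<psi>: "test_function UNIV (curl3 \<eta>)" by (rule test_function_curl3[OF \<eta>])
  have "Lp_on 2 D (\<lambda>x. - hat (curl3 \<eta> x))"
    by (rule Lp_on_linear_image_le[OF L2_D_hat[OF L2_D[OF L2_test[OF \<psi>]]] bounded_linear_minus[OF bounded_linear_ident]]) simp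
  from first_variation[OF \<psi> divergence_curl3[OF test_function_smooth[OF \<eta>]] this, of "\<lambda>t. v0" 0]
  show ?thesis by (simp add: v0 J_def hat_add_scaleR)
qed

lemma V_space_add_gradient:
  fixes q :: "real^3 \<Rightarrow> real" and t :: real
  assumes q: "test_function UNIV q"
  defines "v \<equiv> \<lambda>x. v0 x + t *\<^sub>R hat (gradient q x)"
  shows "v \<in> V_space D" "curl_measure D v = curl_measure D v0"
proof -
  have eq: "curl_pairing D v \<phi> =
    curl_pairing D v0 \<phi>"
    if \<phi>: "test_function D \<phi>" for \<phi> :: "real^3 \<Rightarrow> real"
  proof -
    have \<phi>U: "test_function UNIV \<phi>" by (rule test_function_mono[OF \<phi>]) simp
    have int: "integrable (lebesgue_on D) (\<lambda>x. f x $ j * pderiv_at i \<phi> x)" if "Lp_on 2 D f" for i j and f :: "real^3 \<Rightarrow> real^2"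
    proof -
      have "Lp_on 2 D (\<lambda>x. f x $ j)"
        by (rule Lp_on_linear_image_le[OF that bounded_linear_vec_nth]) (simp add: component_le_norm_cart)
      from integrable_L2_inner[OF this L2_D[OF L2_test[OF test_function_pderiv[OF \<phi>U]]]]
      show ?thesis by simp
    qed
    note i0 = int[OF L2_v0] and iq = int[OF L2_D_hat[OF L2_D[OF L2_test[OF test_function_gradient[OF q]]]]]
    have "curl_pairing D v \<phi> =
      (LINT x|lebesgue_on D. (v0 x $ 1 * pderiv_at 2 \<phi> x - v0 x $ 2 * pderiv_at 1 \<phi> x) +
        t * (hat (gradient q x) $ 1 * pderiv_at 2 \<phi> x - hat (gradient q x) $ 2 * pderiv_at 1 \<phi> x))"
      by (rule Bochner_Integration.integral_cong) (simp_all add: v_def algebra_simps)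
    also have "\<dots> = curl_pairing D v0 \<phi> +
        t * curl_pairing D (\<lambda>x. hat (gradient q x)) \<phi>"
      by (subst Bochner_Integration.integral_add)
        (intro integrable_mult_right Bochner_Integration.integrable_diff i0 iq | simp)+
    also have "curl_pairing D (\<lambda>x. hat (gradient q x)) \<phi> = 0"
      using integral_gradient_curl_eq_0[OF D_sets test_function_smooth[OF q] \<phi>] by (simp add: gradient_def)
    finally show ?thesis by simp
  qed
  note c = curl_measure_cong[of D v v0, OF eq]
  have "Lp_on 2 D v"
    unfolding v_def by (intro Lp_on_add_scaleR L2_v0 L2_D_hat L2_D L2_test test_function_gradient q)
  then show "v \<in> V_space D" using v0 c(1) by (simp add: V_space_def)
  show "curl_measure D v = curl_measure D v0" by (rule c(2))
qed

lemma euler_lagrange_gradient: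
  assumes q: "test_function UNIV q"
  shows "(LINT x|lebesgue_on D. J x \<bullet> hat (gradient q x)) = 0"
proof -
  have "Lp_on 2 D (\<lambda>x. hat (gradient q x))" by (intro L2_D_hat L2_D L2_test test_function_gradient q)
  from first_variation[OF test_function_zero divergence_zero this, of "\<lambda>t x. v0 x + t *\<^sub>R hat (gradient q x)" 0]
  show ?thesis by (simp add: J_def V_space_add_gradient[OF q] curl3_zero)
qed

lemma euler_lagrange_scaling:
  "(LINT x|lebesgue_on D. J x \<bullet> v0 x) = - (1 / (2 * h0)) * total_variation D (curl_measure D v0)"
proof -
  obtain \<mu> where \<mu>: "has_curl_measure D v0 \<mu>" using v0 by (auto simp: V_space_def)
  have V: "(\<lambda>x. (1 + t) *\<^sub>R v0 x) \<in> V_space D" if "\<bar>t\<bar> < 1" for t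
  proof -
    have "0 < 1 + t" using that by linarith
    from has_curl_measure_scale[OF \<mu> this] Lp_on_add_scaleR[OF L2_v0 L2_v0, of t]
    show ?thesis by (auto simp: V_space_def scaleR_add_left)
  qed
  have "total_variation D (curl_measure D (\<lambda>x. (1 + t) *\<^sub>R v0 x)) = (1 + t * 1) * total_variation D (curl_measure D v0)"
    if "\<bar>t\<bar> < 1" for t
    using total_variation_curl_measure_scale[OF open_D \<mu>, of "1 + t"] that by simp
  from first_variation[OF test_function_zero divergence_zero L2_v0 V _ this]
  show ?thesis by (simp add: J_def curl3_zero algebra_simps)
qed

section \<open>The current\<close>

lemma F_inner: "F x \<bullet> w = indicator D x * (J x \<bullet> hat w)"
  by (simp add: F_def inner_vec_def sum_2 sum_3 indicator_def)

lemma integral_F_inner: "(LINT x|lebesgue. F x \<bullet> w x) = (LINT x|lebesgue_on D. J x \<bullet> hat (w x))"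
  using D_sets by (simp add: F_inner integral_restrict_space)

lemma L2_F: "Lp_on 2 UNIV F"
proof -
  define e where "e u = (vector [u $ 1, u $ 2, 0] :: real^3)" for u :: "real^2"
  have e: "bounded_linear e"
    unfolding linear_conv_bounded_linear[symmetric] e_def[abs_def]
    by (rule linearI) (simp_all add: vec_eq_iff forall_3)
  have n: "norm (e u) \<le> norm u" for u
    unfolding norm_le by (simp add: e_def inner_vec_def sum_2 sum_3)
  have L: "Lp_on 2 D (\<lambda>x. e (J x))" by (rule Lp_on_linear_image_le[OF L2_J e n])
  have F: "F = (\<lambda>x. indicator D x *\<^sub>R e (J x))" by (simp add: F_def e_def indicator_def fun_eq_iff)
  have m: "F \<in> borel_measurable lebesgue"
    using L D_sets unfolding F Lp_on_def by (simp add: borel_measurable_restrict_space_iff)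
  have "(\<lambda>x. (norm (F x))\<^sup>2) = (\<lambda>x. indicator D x *\<^sub>R (norm (e (J x)))\<^sup>2)"
    by (simp add: F indicator_def fun_eq_iff)
  then have "integrable lebesgue (\<lambda>x. (norm (F x))\<^sup>2)"
    using L D_sets by (simp add: Lp_on_def integrable_restrict_space)
  with m show ?thesis by (simp add: Lp_on_UNIV)
qed

text \<open>
  Split \<open>laplacian \<xi>\<close> into the gradient of \<open>div \<xi>\<close> and \<open>- curl (curl \<xi>)\<close>. On the left the gradient
  drops out by \<open>euler_lagrange_gradient\<close>, on the right because its curl is zero; the other parts
  agree by \<open>euler_lagrange_A\<close> with \<open>\<eta> = curl \<xi>\<close>.
\<close>
lemma current_laplacian:
  assumes \<xi>: "test_function UNIV \<xi>"
  shows "(LINT x|lebesgue. F x \<bullet> laplacian \<xi> x) = (LINT x|lebesgue. B0 x \<bullet> curl3 (laplacian \<xi>) x)"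
proof -
  note s = test_function_smooth[OF \<xi>]
  have liF: "locally_integrable F" using Lp_on_imp_locally_integrable[of 1 F] L2_F by (simp add: numeral_2_eq_2)
  let ?g = "gradient (divergence \<xi>)" and ?c = "curl3 (curl3 \<xi>)"
  have tg: "test_function UNIV ?g" and tc: "test_function UNIV ?c"
    by (intro test_function_gradient test_function_divergence test_function_curl3 \<xi>)+
  have lap: "laplacian \<xi> = (\<lambda>x. ?g x - ?c x)"
    using curl3_curl3[OF s] by (simp add: fun_eq_iff)
  have "curl3 (laplacian \<xi>) x = curl3 ?g x - curl3 ?c x" for x
    unfolding lap
    by (simp add: vec_eq_iff forall_3 pderiv_at_diff[OF smooth_on_differentiable[OF test_function_smooth[OF tg]]
          smooth_on_differentiable[OF test_function_smooth[OF tc]]])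
  then have clap: "curl3 (laplacian \<xi>) x = - curl3 ?c x" for x
    by (simp add: curl3_gradient[OF smooth_on_divergence[OF s]])
  have "(LINT x|lebesgue. F x \<bullet> laplacian \<xi> x) = (LINT x|lebesgue. F x \<bullet> ?g x) - (LINT x|lebesgue. F x \<bullet> ?c x)"
    unfolding lap inner_diff_right
    by (rule Bochner_Integration.integral_diff) (rule integrable_test_inner[OF liF], fact)+
  also have "(LINT x|lebesgue. F x \<bullet> ?g x) = 0"
    unfolding integral_F_inner by (rule euler_lagrange_gradient[OF test_function_divergence[OF \<xi>]])
  also have "(LINT x|lebesgue. F x \<bullet> ?c x) = (LINT x|lebesgue. B0 x \<bullet> curl3 ?c x)"
    unfolding integral_F_inner by (rule euler_lagrange_A[OF test_function_curl3[OF \<xi>]])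
  finally show ?thesis by (simp add: clap)
qed

text \<open>
  Curl commutes with convolution, so \<open>current_laplacian\<close> shows that the defect of the equation is the same for all averages
  of \<open>\<Phi>\<close>, and the Liouville principle shows that it is zero.
\<close>
lemma has_weak_curl_B0: "has_weak_curl B0 F"
  unfolding has_weak_curl_def
proof (intro conjI allI impI)
  show liB: "locally_integrable B0" using weak_curl_C0(1) by (simp add: has_weak_curl_def)
  show liF: "locally_integrable F" using Lp_on_imp_locally_integrable[of 1 F] L2_F by (simp add: numeral_2_eq_2)
  fix \<Phi> :: "real^3 \<Rightarrow> real^3" assume \<Phi>: "test_function UNIV \<Phi>"
  note s = test_function_smooth[OF \<Phi>]
  show "(LINT x|lebesgue. F x \<bullet> \<Phi> x) = (LINT x|lebesgue. B0 x \<bullet> curl3 \<Phi> x)"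
  proof (rule liouville_principle[of 1 F 1 B0])
    show "Lp_on (Suc 1) UNIV F" "Lp_on (Suc 1) UNIV B0" using L2_F weak_curl_C0(2) by (simp_all add: numeral_2_eq_2)
    show "test_function UNIV \<Phi>" "test_function UNIV (curl3 \<Phi>)" by (fact \<Phi>, rule test_function_curl3[OF \<Phi>])
    fix r R :: real assume r: "r > 0" "R > 0"
    obtain \<xi> where \<xi>: "test_function UNIV \<xi>" "\<And>x. laplacian \<xi> x = (15 / 2) *\<^sub>R (conv (bump R) \<Phi> x - conv (bump r) \<Phi> x)"
      using conv_bump_invariance[OF \<Phi> r] by blast
    have t: "test_function UNIV (conv (bump R) \<Phi>)" if "R > 0" for R
      by (rule test_function_conv[OF continuous_bump bump_support[OF that] \<Phi>])
    have t': "test_function UNIV (conv (bump R) (curl3 \<Phi>))" if "R > 0" for R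
      by (rule test_function_conv[OF continuous_bump bump_support[OF that] test_function_curl3[OF \<Phi>]])
    note d = smooth_on_differentiable[OF test_function_smooth[OF t]]
    have "laplacian \<xi> = (\<lambda>x. (15 / 2) *\<^sub>R (conv (bump R) \<Phi> x - conv (bump r) \<Phi> x))"
      using \<xi>(2) by blast
    then have p: "pderiv_at i (laplacian \<xi>) x = (15 / 2) *\<^sub>R (pderiv_at i (conv (bump R) \<Phi>) x - pderiv_at i (conv (bump r) \<Phi>) x)" for i x
      using pderiv_at_linear[OF bounded_linear_scaleR_right differentiable_diff[OF d[OF r(2)] d[OF r(1)]], of i "15 / 2" x]
      by (simp add: pderiv_at_diff[OF d[OF r(2)] d[OF r(1)]])
    have "curl3 (laplacian \<xi>) x = (15 / 2) *\<^sub>R (curl3 (conv (bump R) \<Phi>) x - curl3 (conv (bump r) \<Phi>) x)" for x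
      by (simp add: vec_eq_iff forall_3 p algebra_simps)
    then have curl: "curl3 (laplacian \<xi>) x = (15 / 2) *\<^sub>R (conv (bump R) (curl3 \<Phi>) x - conv (bump r) (curl3 \<Phi>) x)" for x
      by (simp add: curl3_conv[OF continuous_bump bump_support s] r)
    note intF = integrable_test_inner[OF liF t[OF r(1)]] integrable_test_inner[OF liF t[OF r(2)]]
    note intB = integrable_test_inner[OF liB t'[OF r(1)]] integrable_test_inner[OF liB t'[OF r(2)]]
    have "(15 / 2) * ((LINT x|lebesgue. F x \<bullet> conv (bump R) \<Phi> x) - (LINT x|lebesgue. F x \<bullet> conv (bump r) \<Phi> x)) =
      (15 / 2) * ((LINT x|lebesgue. B0 x \<bullet> conv (bump R) (curl3 \<Phi>) x) - (LINT x|lebesgue. B0 x \<bullet> conv (bump r) (curl3 \<Phi>) x))"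
      using current_laplacian[OF \<xi>(1)] intF intB unfolding curl \<xi>(2) by (simp add: inner_diff_right)
    then show "(LINT x|lebesgue. F x \<bullet> conv (bump R) \<Phi> x) - (LINT x|lebesgue. B0 x \<bullet> conv (bump R) (curl3 \<Phi>) x) =
      (LINT x|lebesgue. F x \<bullet> conv (bump r) \<Phi> x) - (LINT x|lebesgue. B0 x \<bullet> conv (bump r) (curl3 \<Phi>) x)"
      by simp
  qed
qed

lemma weak_curl_B0_AE: "AE x in lebesgue. weak_curl B0 x = F x"
  by (rule weak_curl_AE_eq[OF has_weak_curl_B0])

lemma weakly_div_free_C0: "weakly_div_free C0"
proof -
  have "weakly_div_free (\<lambda>x. A0 x + (- 1) *\<^sub>R a x)"
  proof (rule weakly_div_free_add_scaleR[OF _ weakly_div_free_smooth[OF smooth_a div_a]])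
    show "weakly_div_free A0" using A0 by (simp add: K0_space_def)
  qed
  then show ?thesis by (simp add: C0_def[abs_def])
qed

text \<open>
  Test \<open>curl B0 = F\<close> with the vertical field \<open>\<xi> e3\<close>, to which \<open>F\<close> is orthogonal, and write
  \<open>curl (curl (\<xi> e3))\<close> as a gradient minus \<open>laplacian \<xi>\<close> times \<open>e3\<close>. The gradient is
  annihilated by the divergence-free field \<open>C0\<close>.
\<close>
lemma weakly_harmonic_C0_3:
  fixes \<xi> :: "real^3 \<Rightarrow> real"
  assumes \<xi>: "test_function UNIV \<xi>"
  shows "(LINT x|lebesgue. C0 x $ 3 * laplacian \<xi> x) = 0"
proof -
  let ?\<Phi> = "\<lambda>x. \<xi> x *\<^sub>R axis 3 (1::real) :: real^3"
  have \<Phi>: "test_function UNIV ?\<Phi>" by (rule test_function_axis[OF \<xi>])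
  have li: "locally_integrable C0" using weakly_div_free_C0 by (simp add: weakly_div_free_def)
  have lap: "laplacian ?\<Phi> x = laplacian \<xi> x *\<^sub>R axis 3 1" for x
    by (rule laplacian_linear[OF bounded_linear_scaleR_left test_function_smooth[OF \<xi>]])
  note tg = test_function_gradient[OF test_function_divergence[OF \<Phi>]]
  note tc = test_function_curl3[OF test_function_curl3[OF \<Phi>]]
  have z: "F x \<bullet> ?\<Phi> x = 0" for x by (simp add: F_def inner_axis)
  have "0 = (LINT x|lebesgue. F x \<bullet> ?\<Phi> x)" unfolding z by simp
  also have "\<dots> = (LINT x|lebesgue. B0 x \<bullet> curl3 ?\<Phi> x)" by (rule weak_curl_testD[OF has_weak_curl_B0 \<Phi>])
  also have "\<dots> = (LINT x|lebesgue. C0 x \<bullet> curl3 (curl3 ?\<Phi>) x)"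
    by (rule weak_curl_testD[OF weak_curl_C0(1) test_function_curl3[OF \<Phi>]])
  finally have c0: "(LINT x|lebesgue. C0 x \<bullet> curl3 (curl3 ?\<Phi>) x) = 0" by simp
  have g0: "(LINT x|lebesgue. C0 x \<bullet> gradient (divergence ?\<Phi>) x) = 0"
    using weakly_div_free_C0 test_function_divergence[OF \<Phi>] unfolding weakly_div_free_def by blast
  have "C0 x $ 3 * laplacian \<xi> x = C0 x \<bullet> gradient (divergence ?\<Phi>) x - C0 x \<bullet> curl3 (curl3 ?\<Phi>) x" for x
  proof -
    have "gradient (divergence ?\<Phi>) x - curl3 (curl3 ?\<Phi>) x = laplacian \<xi> x *\<^sub>R axis 3 1"
      using curl3_curl3[OF test_function_smooth[OF \<Phi>], of x] lap[of x] by simp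
    then show ?thesis by (simp add: inner_diff_right[symmetric] inner_axis)
  qed
  then have "(LINT x|lebesgue. C0 x $ 3 * laplacian \<xi> x) =
      (LINT x|lebesgue. C0 x \<bullet> gradient (divergence ?\<Phi>) x - C0 x \<bullet> curl3 (curl3 ?\<Phi>) x)" by simp
  also have "\<dots> = 0"
    unfolding Bochner_Integration.integral_diff[OF integrable_test_inner[OF li tg] integrable_test_inner[OF li tc]] c0 g0
    by simp
  finally show ?thesis .
qed

lemma C0_3_AE: "AE x in lebesgue. C0 x $ 3 = 0"
proof -
  let ?u = "\<lambda>x. C0 x $ 3"
  have "Lp_on 6 UNIV C0" using A0 by (simp add: K0_space_def C0_def[abs_def])
  then have u: "Lp_on (Suc 5) UNIV ?u"
    using Lp_on_linear_image_le[OF _ bounded_linear_vec_nth, of 6 UNIV C0 3] by (simp add: component_le_norm_cart)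
  note li = Lp_on_imp_locally_integrable[OF u]
  show ?thesis
  proof (rule fundamental_lemma[OF li])
    fix \<phi> :: "real^3 \<Rightarrow> real" assume \<phi>: "test_function UNIV \<phi>"
    have "(LINT x|lebesgue. ?u x \<bullet> \<phi> x) = (LINT x|lebesgue. (0::real) \<bullet> \<phi> x)"
    proof (rule liouville_principle[OF u _ \<phi> \<phi>])
      show "Lp_on (Suc 0) UNIV (\<lambda>x::real^3. 0::real)" by (rule Lp_on_test[OF test_function_zero])
      fix r R :: real assume r: "r > 0" "R > 0"
      obtain \<xi> where \<xi>: "test_function UNIV \<xi>" "\<And>x. laplacian \<xi> x = (15 / 2) *\<^sub>R (conv (bump R) \<phi> x - conv (bump r) \<phi> x)"
        using conv_bump_invariance[OF \<phi> r] by blast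
      have int: "integrable lebesgue (\<lambda>x. ?u x * conv (bump R) \<phi> x)" if "R > 0" for R
        using integrable_test_inner[OF li test_function_conv[OF continuous_bump bump_support[OF that] \<phi>]] by simp
      have "0 = (LINT x|lebesgue. (15 / 2) * (?u x * conv (bump R) \<phi> x - ?u x * conv (bump r) \<phi> x))"
        using weakly_harmonic_C0_3[OF \<xi>(1)] unfolding \<xi>(2) by (simp add: algebra_simps)
      also have "\<dots> = (15 / 2) * ((LINT x|lebesgue. ?u x * conv (bump R) \<phi> x) - (LINT x|lebesgue. ?u x * conv (bump r) \<phi> x))"
        using int[OF r(1)] int[OF r(2)] by simp
      finally show "(LINT x|lebesgue. ?u x \<bullet> conv (bump R) \<phi> x) - (LINT x|lebesgue. (0::real) \<bullet> conv (bump R) \<phi> x) =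
        (LINT x|lebesgue. ?u x \<bullet> conv (bump r) \<phi> x) - (LINT x|lebesgue. (0::real) \<bullet> conv (bump r) \<phi> x)"
        by simp
    qed
    then show "(LINT x|lebesgue. \<phi> x *\<^sub>R ?u x) = 0" by (simp add: mult.commute)
  qed
qed

text \<open>
  Since \<open>F\<close> is horizontal and vanishes outside \<open>D\<close>, only the values \<open>hat w = v0\<close> on \<open>D\<close> enter the pairing,
  and these were tested by scaling \<open>v0\<close>.
\<close>
lemma current_pairing:
  fixes w :: "real^3 \<Rightarrow> real^3"
  assumes w: "Lp_on 2 UNIV w" and eq: "AE x in lebesgue_on D. hat (w x) = v0 x"
  shows "(LINT x|lebesgue. weak_curl B0 x \<bullet> w x) = - (1 / (2 * h0)) * total_variation D (curl_measure D (\<lambda>x. hat (w x)))"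
proof -
  have [measurable]: "w \<in> borel_measurable lebesgue" "F \<in> borel_measurable lebesgue"
    using w L2_F by (simp_all add: Lp_on_UNIV)
  have [measurable]: "weak_curl B0 \<in> borel_measurable lebesgue"
    using has_weak_curl_weak_curl[OF has_weak_curl_B0] by (intro locally_integrable_measurable) (simp add: has_weak_curl_def)
  have [measurable]: "(\<lambda>x. hat (w x)) \<in> borel_measurable (lebesgue_on D)" "v0 \<in> borel_measurable (lebesgue_on D)"
      "J \<in> borel_measurable (lebesgue_on D)"
    using L2_D_hat[OF L2_D[OF w]] L2_v0 L2_J by (simp_all add: Lp_on_def)
  have "(LINT x|lebesgue. weak_curl B0 x \<bullet> w x) = (LINT x|lebesgue. F x \<bullet> w x)"
    by (rule integral_cong_AE) (measurable, use weak_curl_B0_AE in \<open>eventually_elim, simp\<close>)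
  also have "\<dots> = (LINT x|lebesgue_on D. J x \<bullet> hat (w x))" by (rule integral_F_inner)
  also have "\<dots> = (LINT x|lebesgue_on D. J x \<bullet> v0 x)"
    by (rule integral_cong_AE) (measurable, use eq in \<open>eventually_elim, simp\<close>)
  also have "\<dots> = - (1 / (2 * h0)) * total_variation D (curl_measure D v0)" by (rule euler_lagrange_scaling)
  also have "curl_measure D v0 = curl_measure D (\<lambda>x. hat (w x))"
  proof (rule curl_measure_cong(2)[symmetric])
    fix \<phi> :: "real^3 \<Rightarrow> real" assume \<phi>: "test_function D \<phi>"
    have p: "pderiv_at i \<phi> \<in> borel_measurable (lebesgue_on D)" for i
      using L2_D[OF L2_test[OF test_function_pderiv[OF test_function_mono[OF \<phi> subset_UNIV]]]] by (simp add: Lp_on_def)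
    have n: "(\<lambda>x. f x $ j) \<in> borel_measurable (lebesgue_on D)"
      if "f \<in> borel_measurable (lebesgue_on D)" for f :: "real^3 \<Rightarrow> real^2" and j
      using measurable_compose[OF that borel_measurable_continuous_onI[OF linear_continuous_on[OF bounded_linear_vec_nth]]] .
    show "curl_pairing D (\<lambda>x. hat (w x)) \<phi> =
      curl_pairing D v0 \<phi>"
    proof (rule integral_cong_AE)
      show "(\<lambda>x. hat (w x) $ 1 * pderiv_at 2 \<phi> x - hat (w x) $ 2 * pderiv_at 1 \<phi> x) \<in> borel_measurable (lebesgue_on D)"
        by (intro borel_measurable_diff borel_measurable_times n p) fact+
      show "(\<lambda>x. v0 x $ 1 * pderiv_at 2 \<phi> x - v0 x $ 2 * pderiv_at 1 \<phi> x) \<in> borel_measurable (lebesgue_on D)"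
        by (intro borel_measurable_diff borel_measurable_times n p) fact+
      show "AE x in lebesgue_on D. hat (w x) $ 1 * pderiv_at 2 \<phi> x - hat (w x) $ 2 * pderiv_at 1 \<phi> x =
          v0 x $ 1 * pderiv_at 2 \<phi> x - v0 x $ 2 * pderiv_at 1 \<phi> x"
        using eq by eventually_elim (simp only:)
    qed
  qed
  finally show ?thesis .
qed

end

theorem corollary2:
  fixes \<Omega> :: "(real^2) set" and L h0 :: real and D :: "(real^3) set"
    and a A0 B0 :: "real^3 \<Rightarrow> real^3" and v0 :: "real^3 \<Rightarrow> real^2"
  assumes "smooth_domain \<Omega>" and "bounded \<Omega>" and "simply_connected \<Omega>"
    and "L > 0" and "h0 > 0"
    and "D = cylinder \<Omega> L"
    and "smooth_on UNIV a" and "\<forall>x. a x $ 3 = 0"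
    and "\<forall>x. curl3 a x = e3" and "\<forall>x. divergence a x = 0"
    and "v0 \<in> V_space D" and "A0 \<in> K0_space a"
    and "\<forall>v\<in>V_space D. \<forall>A\<in>K0_space a. G_energy D h0 v0 A0 \<le> G_energy D h0 v A"
    and "B0 = weak_curl (\<lambda>x. A0 x - a x)"
  shows "(AE x in lebesgue. A0 x $ 3 = 0) \<and>
    has_weak_curl B0 (weak_curl B0) \<and> Lp_on 2 UNIV (weak_curl B0) \<and>
    (AE x in lebesgue. weak_curl B0 x $ 3 = 0) \<and>
    (\<forall>w0 :: real^3 \<Rightarrow> real^3. Lp_on 2 UNIV w0 \<longrightarrow>
       (AE x in lebesgue_on D. hat (w0 x) = v0 x) \<longrightarrow>
       (LINT x|lebesgue. weak_curl B0 x \<bullet> w0 x) =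
         - (1 / (2 * h0)) * total_variation D (curl_measure D (\<lambda>x. hat (w0 x))))"
proof -
  interpret M: minimizer D h0 a A0 v0
    using assms by unfold_locales (auto simp: smooth_domain_def open_cylinder bounded_cylinder)
  have C0: "M.C0 = (\<lambda>x. A0 x - a x)" by (simp add: M.C0_def fun_eq_iff)
  have B0: "B0 = M.B0" by (simp add: assms(14) M.B0_def C0)
  have A0_3: "AE x in lebesgue. A0 x $ 3 = 0"
    using M.C0_3_AE by eventually_elim (use assms(8) in \<open>simp add: C0\<close>)
  have curl: "has_weak_curl B0 (weak_curl B0)"
    unfolding B0 by (rule has_weak_curl_weak_curl[OF M.has_weak_curl_B0])
  have "weak_curl B0 \<in> borel_measurable lebesgue"
    using curl by (intro locally_integrable_measurable) (simp add: has_weak_curl_def)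
  moreover have ae: "AE x in lebesgue. weak_curl B0 x = M.F x"
    unfolding B0 by (rule M.weak_curl_B0_AE)
  then have "AE x in lebesgue. M.F x = weak_curl B0 x" by eventually_elim simp
  ultimately have L2: "Lp_on 2 UNIV (weak_curl B0)"
    by (intro Lp_on_cong_AE[OF M.L2_F]) (unfold lebesgue_on_UNIV_eq)
  have "AE x in lebesgue. weak_curl B0 x $ 3 = 0"
    using ae by eventually_elim (simp add: M.F_def)
  with A0_3 curl L2 show ?thesis
    using M.current_pairing unfolding B0 by blast
qed

end
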